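(* Let $D:=D_1*D_2$ be the join of two weighted oriented graphs $D_1$ and $D_2$, where, for $i=1,2$, $D_i$ consists of isolated vertices with (nonempty) vertex set $V_i=\{x_{ij}\mid j\in[n_i]\}$. Let $S=\mathbb{K}[x_{ij}: i\in[2], j\in[n_i]]$. Then for all $t\ge 1$: (1) $\operatorname{depth}(S/I(D)^t)=\operatorname{depth}(S/I(D)^{(t)})=1$; (2) $\operatorname{reg}(S/I(D)^t)=\operatorname{reg}(S/I(D)^{(t)})=\sum_{x\in V(D)}w(x)-|V(D)|+1+(t-1)(w+1)$, where $w=\max\{w(x)\mid x\in V(D)\}$.
   Context: $\mathbb{K}$ is a field and $[n]=\{1,\dots,n\}$. A weighted oriented graph is a triple $D=(V(D),E(D),w)$, where $V(D)$ is a finite set of vertices, $E(D)$ is a set of ordered pairs (directed edges) obtained by choosing one orientation of each edge of a finite simple graph on $V(D)$, and $w:V(D)\to\{1,2,\dots\}$ is a weight function. Vertices are identified with variables of the polynomial ring $S$, and the edge ideal is $I(D)=(x\,y^{w(y)}\mid (x,y)\in E(D))\subset S$. The join $D_1*D_2$ of weighted oriented graphs with disjoint vertex sets $V_1,V_2$ is the weighted oriented graph on $V_1\sqcup V_2$ with edge set $E(D_1)\cup E(D_2)\cup\{(x,y): x\in V_1,\ y\in V_2\}$, each vertex keeping its weight. A source is a vertex with no incoming edges. Convention: source vertices of $D$ have weight one (their weight does not affect $I(D)$); hence here all vertices of $V_1$ have weight $1$, while those of $V_2$ have arbitrary weights. For an ideal $I\subset S$ and $k\geq 1$, the $k$-th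 symbolic power is $I^{(k)}=\bigcap_{P\in\operatorname{Ass}(I)}(I^kS_P\cap S)$, where $\operatorname{Ass}(I)$ is the set of associated primes of $I$. $\operatorname{reg}$ is Castelnuovo–Mumford regularity with respect to the standard grading. *)

theory Defs
  imports "HOL-Library.Poly_Mapping" "Jordan_Normal_Form.Matrix"
begin

section \<open>Ideals of a commutative ring\<close>

text \<open>The ring is a whole type, regarded as a module over itself through multiplication. The
  qualifier is needed because HOL-Algebra has a different constant called module.\<close>

abbreviation is_ideal :: "'a::comm_ring_1 set \<Rightarrow> bool" where
  "is_ideal \<equiv> Modules.module.subspace (*)"

abbreviation ideal_span :: "'a::comm_ring_1 set \<Rightarrow> 'a set" where
  "ideal_span \<equiv> Modules.module.span (*)"

definition ideal_mult :: "'a::comm_ring_1 set \<Rightarrow> 'a set \<Rightarrow> 'a set" where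
  "ideal_mult I J = ideal_span {a * b | a b. a \<in> I \<and> b \<in> J}"

primrec ideal_power :: "'a::comm_ring_1 set \<Rightarrow> nat \<Rightarrow> 'a set" where
  "ideal_power I 0 = UNIV"
| "ideal_power I (Suc k) = ideal_mult I (ideal_power I k)"

definition is_prime_ideal :: "'a::comm_ring_1 set \<Rightarrow> bool" where
  "is_prime_ideal P \<longleftrightarrow>
     is_ideal P \<and> P \<noteq> UNIV \<and> (\<forall>a b. a * b \<in> P \<longrightarrow> a \<in> P \<or> b \<in> P)"

text \<open>The primes of the form \<open>(I : f)\<close>, i.e. the annihilators of elements of \<open>R/I\<close> that are
  prime.\<close>

definition associated_primes :: "'a::comm_ring_1 set \<Rightarrow> 'a set set" where
  "associated_primes I = {P. is_prime_ideal P \<and> (\<exists>f. P = {g. g * f \<in> I})}"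

text \<open>Equality of the fractions \<open>a/s\<close> and \<open>b/t\<close> in the localization \<open>R\<^sub>P\<close>.\<close>

definition loc_eq :: "'a::comm_ring_1 set \<Rightarrow> 'a \<Rightarrow> 'a \<Rightarrow> 'a \<Rightarrow> 'a \<Rightarrow> bool" where
  "loc_eq P a s b t \<longleftrightarrow> (\<exists>u. u \<notin> P \<and> u * (a * t - b * s) = 0)"

text \<open>\<open>J R\<^sub>P \<inter> R\<close>: the \<open>f\<close> whose image \<open>f/1\<close> is one of the fractions \<open>a/s\<close> with \<open>a \<in> J\<close> and
  \<open>s \<notin> P\<close>, which are exactly the elements of the extended ideal \<open>J R\<^sub>P\<close>.\<close>

definition loc_contraction :: "'a::comm_ring_1 set \<Rightarrow> 'a set \<Rightarrow> 'a set" where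
  "loc_contraction P J = {f. \<exists>a\<in>J. \<exists>s. s \<notin> P \<and> loc_eq P f 1 a s}"

definition symbolic_power :: "'a::comm_ring_1 set \<Rightarrow> nat \<Rightarrow> 'a set" where
  "symbolic_power I k = (\<Inter>P\<in>associated_primes I. loc_contraction P (ideal_power I k))"

section \<open>The standard graded polynomial ring\<close>

text \<open>Polynomials over \<open>'k\<close> in variables indexed by the elements of \<open>'v\<close>; monomials are exponent
  vectors \<open>'v \<Rightarrow>\<^sub>0 nat\<close>.\<close>

type_synonym ('v, 'k) polys = "('v \<Rightarrow>\<^sub>0 nat) \<Rightarrow>\<^sub>0 'k"

definition Var :: "'v \<Rightarrow> ('v, 'k::field) polys" where
  "Var v = Poly_Mapping.single (Poly_Mapping.single v 1) 1"

definition mon_degree :: "('v \<Rightarrow>\<^sub>0 nat) \<Rightarrow> nat" where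
  "mon_degree m = (\<Sum>v\<in>Poly_Mapping.keys m. Poly_Mapping.lookup m v)"

text \<open>The zero polynomial is homogeneous of every degree, and it is the only polynomial that is
  homogeneous of a negative degree.\<close>

definition homogeneous :: "int \<Rightarrow> ('v, 'k::field) polys \<Rightarrow> bool" where
  "homogeneous d p \<longleftrightarrow> (\<forall>m\<in>Poly_Mapping.keys p. int (mon_degree m) = d)"

definition irrelevant_ideal :: "('v, 'k::field) polys set" where
  "irrelevant_ideal = ideal_span (range Var)"

section \<open>Depth\<close>

definition regular_sequence :: "('v, 'k::field) polys set \<Rightarrow> ('v, 'k) polys list \<Rightarrow> bool" where
  "regular_sequence I fs \<longleftrightarrow>
     (\<forall>i<length fs. \<forall>g. fs ! i * g \<in> ideal_span (I \<union> set (take i fs))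
                        \<longrightarrow> g \<in> ideal_span (I \<union> set (take i fs))) \<and>
     ideal_span (I \<union> set fs) \<noteq> UNIV"

text \<open>The depth of \<open>S/I\<close>, i.e. the maximal length of an \<open>S/I\<close>-regular sequence in the graded
  maximal ideal.\<close>

definition depth_quot :: "('v, 'k::field) polys set \<Rightarrow> nat" where
  "depth_quot I = Max {length fs | fs. regular_sequence I fs \<and> set fs \<subseteq> irrelevant_ideal}"

section \<open>Castelnuovo-Mumford regularity\<close>

text \<open>A graded free module of finite rank \<open>S(-a\<^sub>0) \<oplus> \<dots> \<oplus> S(-a\<^sub>n)\<close> is given by the list of the
  degrees of its basis elements. Its elements are the vectors of the length of this list, and a
  degree preserving map from the module with degrees \<open>bs\<close> to the one with degrees \<open>as\<close> is a matrix.\<close>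

definition graded_matrix :: "int list \<Rightarrow> int list \<Rightarrow> ('v, 'k::field) polys mat \<Rightarrow> bool" where
  "graded_matrix as bs A \<longleftrightarrow> A \<in> carrier_mat (length as) (length bs) \<and>
     (\<forall>i<length as. \<forall>j<length bs. homogeneous (bs ! j - as ! i) (A $$ (i, j)))"

text \<open>Graded free resolutions
  \<open>\<dots> \<rightarrow> F\<^sub>2 \<rightarrow> F\<^sub>1 \<rightarrow> F\<^sub>0 \<rightarrow> S/I \<rightarrow> 0\<close>
  of \<open>S/I\<close>, where \<open>F\<^sub>i\<close> has basis degrees \<open>a i\<close> and the matrix \<open>d i\<close> describes
  \<open>F\<^sub>i\<^sub>+\<^sub>1 \<rightarrow> F\<^sub>i\<close>. The augmentation \<open>F\<^sub>0 \<rightarrow> S/I\<close> sends \<open>v\<close> to the class of \<open>e \<bullet> v\<close>.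
  Finite length is obtained by taking \<open>a i = []\<close> from some point on.\<close>

definition graded_free_resolution ::
  "('v, 'k::field) polys set \<Rightarrow> (nat \<Rightarrow> int list) \<Rightarrow> (nat \<Rightarrow> ('v, 'k) polys mat)
     \<Rightarrow> ('v, 'k) polys vec \<Rightarrow> bool" where
  "graded_free_resolution I a d e \<longleftrightarrow>
     e \<in> carrier_vec (length (a 0)) \<and>
     (\<forall>k<length (a 0). homogeneous (a 0 ! k) (e $ k)) \<and>
     (\<forall>i. graded_matrix (a i) (a (Suc i)) (d i)) \<and>
     (\<forall>p. \<exists>v\<in>carrier_vec (length (a 0)). p - e \<bullet> v \<in> I) \<and>
     (\<forall>v\<in>carrier_vec (length (a 0)).
        e \<bullet> v \<in> I \<longleftrightarrow> (\<exists>u\<in>carrier_vec (length (a 1)). v = d 0 *\<^sub>v u)) \<and>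
     (\<forall>i. \<forall>v\<in>carrier_vec (length (a (Suc i))).
        d i *\<^sub>v v = 0\<^sub>v (length (a i)) \<longleftrightarrow>
        (\<exists>u\<in>carrier_vec (length (a (Suc (Suc i)))). v = d (Suc i) *\<^sub>v u))"

definition minimal_graded_free_resolution ::
  "('v, 'k::field) polys set \<Rightarrow> (nat \<Rightarrow> int list) \<Rightarrow> (nat \<Rightarrow> ('v, 'k) polys mat)
     \<Rightarrow> ('v, 'k) polys vec \<Rightarrow> bool" where
  "minimal_graded_free_resolution I a d e \<longleftrightarrow>
     graded_free_resolution I a d e \<and> (\<forall>i. elements_mat (d i) \<subseteq> irrelevant_ideal)"

text \<open>The graded Betti number \<open>\<beta>\<^sub>i\<^sub>,\<^sub>j(S/I)\<close>. For homogeneous \<open>I\<close> and finitely many variables a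
  minimal graded free resolution exists and is unique up to isomorphism, so the choice made here is
  irrelevant.\<close>

definition min_res_degrees :: "('v, 'k::field) polys set \<Rightarrow> nat \<Rightarrow> int list" where
  "min_res_degrees I = (SOME a. \<exists>d e. minimal_graded_free_resolution I a d e)"

definition graded_betti :: "('v, 'k::field) polys set \<Rightarrow> nat \<Rightarrow> int \<Rightarrow> nat" where
  "graded_betti I i j = count_list (min_res_degrees I i) j"

text \<open>The regularity of \<open>S/I\<close>. By Hilbert's syzygy theorem the maximum is over a finite set.\<close>

definition reg_quot :: "('v, 'k::field) polys set \<Rightarrow> int" where
  "reg_quot I = Max {j - int i | i j. graded_betti I i j \<noteq> 0}"

section \<open>Weighted oriented graphs\<close>

record 'v wograph =
  verts :: "'v set"
  edges :: "('v \<times> 'v) set"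
  weight :: "'v \<Rightarrow> nat"

text \<open>Asymmetry of the edge relation says that there are no loops and that every edge of the
  underlying simple graph carries only one of its two orientations.\<close>

definition weighted_oriented_graph :: "'v wograph \<Rightarrow> bool" where
  "weighted_oriented_graph D \<longleftrightarrow>
     finite (verts D) \<and> edges D \<subseteq> verts D \<times> verts D \<and> asym (edges D) \<and>
     (\<forall>x\<in>verts D. weight D x \<ge> 1)"

definition source :: "'v wograph \<Rightarrow> 'v \<Rightarrow> bool" where
  "source D x \<longleftrightarrow> x \<in> verts D \<and> (\<forall>y. (y, x) \<notin> edges D)"

text \<open>Only meaningful for disjoint vertex sets.\<close>

definition graph_join :: "'v wograph \<Rightarrow> 'v wograph \<Rightarrow> 'v wograph" where
  "graph_join D1 D2 =
     \<lparr>verts = verts D1 \<union> verts D2,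
      edges = edges D1 \<union> edges D2 \<union> verts D1 \<times> verts D2,
      weight = (\<lambda>x. if x \<in> verts D1 then weight D1 x else weight D2 x)\<rparr>"

definition edge_ideal :: "'v wograph \<Rightarrow> ('v, 'k::field) polys set" where
  "edge_ideal D = ideal_span {Var x * Var y ^ weight D y | x y. (x, y) \<in> edges D}"

end

theory Submission
  imports Defs "HOL-Library.Countable" "HOL-Library.FuncSet" "HOL-Library.Function_Algebras"
begin

text \<open>Let \<open>X\<close> and \<open>Y\<close> be the two vertex sets. The ideal \<open>I\<close> is the product of \<open>(x)\<close> and \<open>(y\<^sup>w)\<close>, so \<open>I\<^sup>t\<close> is
  spanned by the monomials \<open>m\<close> whose \<open>X\<close>-degree is at least \<open>t\<close> and for which the sum of the \<open>m(y) div w(y)\<close>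
  is at least \<open>t\<close>. These two conditions define ideals \<open>A\<close> and \<open>B\<close> that are primary to the two associated
  primes \<open>(x)\<close> and \<open>(y)\<close> of \<open>I\<close>, hence \<open>I\<^sup>t = A \<inter> B\<close> is also the symbolic power.

  The form \<open>x + y\<close> is regular modulo \<open>A\<close> and \<open>B\<close>. The module \<open>S/(A + B)\<close> has a nonzero element killed by the
  maximal ideal; the exact sequence linking \<open>S/(A \<inter> B)\<close>, \<open>S/A \<oplus> S/B\<close> and \<open>S/(A + B)\<close> turns it into an
  obstruction to regular sequences of length two.

  Whether a degree occurs in a minimal resolution is decided by the Koszul homology of \<open>S/I\<^sup>t\<close>, by
  dimension shifting along the resolution. A Koszul cycle modulo \<open>A \<inter> B\<close> of large degree splits into one part
  outside \<open>B\<close> and one outside \<open>A\<close>, since in that degree every monomial lies in \<open>A\<close> or \<open>B\<close>; each part is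
  contracted along a variable that does not occur in the ideal. The socle of \<open>S/(A + B)\<close> provides a cycle
  on \<open>Y\<close> which shows that the bound is attained. The vanishing also bounds the degrees of minimal
  generators of syzygies, so that minimal resolutions of finite rank exist.\<close>

section \<open>Monomials and monomial ideals\<close>

text \<open>\<open>reg_quot\<close> refers to a minimal resolution picked by an arbitrary choice, so
  no explicit resolution can be put in its place. Existence must be proved for the choice to mean
  anything, and the degrees must be found by an argument valid for every minimal resolution. Koszul
  homology serves this purpose, and only its vanishing in single bidegrees is ever compared. The
  constant arises as follows. A monomial outside \<open>A\<close> and \<open>B\<close> has
  \<open>X\<close>-degree at most t - 1 and \<open>Y\<close>-degree at most (t - 1)w plus the sum of
  all w(y) - 1, which counts the incomplete blocks of exponents. The socle monomial attains both if
  its complete blocks sit at a vertex of maximal weight. The connecting map from S/(A + B) to S/(A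
  \<inter> B) lowers the homological degree by one and keeps the internal degree, which accounts for
  one more. The vertices of \<open>X\<close> have weight 1 and add nothing to the sum of the w(v) -
  1, so that sum may be taken over all vertices.\<close>

abbreviation coef :: "('v, 'k::field) polys \<Rightarrow> ('v \<Rightarrow>\<^sub>0 nat) \<Rightarrow> 'k" where
  "coef \<equiv> Poly_Mapping.lookup"

abbreviation expo :: "('v \<Rightarrow>\<^sub>0 nat) \<Rightarrow> 'v \<Rightarrow> nat" where
  "expo \<equiv> Poly_Mapping.lookup"

abbreviation uvec :: "'v \<Rightarrow> 'v \<Rightarrow>\<^sub>0 nat" where
  "uvec v \<equiv> Poly_Mapping.single v 1"

abbreviation mono_of :: "('v \<Rightarrow>\<^sub>0 nat) \<Rightarrow> ('v, 'k::field) polys" where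
  "mono_of m \<equiv> Poly_Mapping.single m 1"

interpretation ideal: Modules.module "(*) :: 'a::comm_ring_1 \<Rightarrow> 'a \<Rightarrow> 'a"
  by unfold_locales (simp_all add: algebra_simps)

lemma coef_sum: "coef (sum f A) m = (\<Sum>a\<in>A. coef (f a) m)"
  by (rule lookup_sum)

lemma monom_eqI: "(\<And>v. expo m v = expo n v) \<Longrightarrow> m = n"
  by (rule poly_mapping_eqI)

lemma monom_diff_add: "(\<And>v. expo a v \<le> expo m v) \<Longrightarrow> a + (m - a) = m"
  by (rule monom_eqI) (simp add: lookup_add lookup_minus)

lemma coef_mult_single:
  "coef (Poly_Mapping.single a c * p) m = (if \<forall>v. expo a v \<le> expo m v then c * coef p (m - a) else 0)"
proof (cases "c = 0")
  case False
  have "coef (Poly_Mapping.single a c * p) m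
      = c * (\<Sum>q. coef p q when m = a + q)"
    unfolding lookup_mult lookup_single when_mult by (rule Sum_any_when_equal')
  also have "\<dots> = (if \<forall>v. expo a v \<le> expo m v then c * coef p (m - a) else 0)"
  proof (cases "\<forall>v. expo a v \<le> expo m v")
    case True
    then have "m = a + q \<longleftrightarrow> q = m - a" for q
      using monom_diff_add[of a m] by auto
    then show ?thesis using True by simp
  next
    case False
    then have "m \<noteq> a + q" for q
      by (auto simp: lookup_add)
    then show ?thesis unfolding if_not_P[OF False] by simp
  qed
  finally show ?thesis .
qed simp

lemma uvec_le_iff: "(\<forall>u. expo (uvec v) u \<le> expo m u) \<longleftrightarrow> 0 < expo m v"
  by (auto simp: lookup_single when_def)

lemma coef_Var_mult:
  "coef (Var v * p) m = (if 0 < expo m v then coef p (m - uvec v) else 0)"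
  using uvec_le_iff[of v m] by (simp add: Var_def coef_mult_single)

lemma coef_mult_unique:
  assumes "\<And>a' b'. a' \<in> Poly_Mapping.keys g \<Longrightarrow> b' \<in> Poly_Mapping.keys f \<Longrightarrow> a' + b' = a + b
            \<Longrightarrow> a' = a \<and> b' = b"
  shows "coef (g * f) (a + b) = coef g a * coef f b"
proof -
  have "coef (g * f) (a + b) = (\<Sum>l. \<Sum>q. coef g l * coef f q when a + b = l + q)"
    by (simp add: lookup_mult Sum_any_right_distrib mult_when)
  also have "\<dots> = (\<Sum>l. \<Sum>q. (coef g l * coef f q when q = b) when l = a)"
  proof (intro Sum_any.cong)
    fix l q
    show "(coef g l * coef f q when a + b = l + q) = ((coef g l * coef f q when q = b) when l = a)"
      using assms[of l q] by (cases "coef g l = 0 \<or> coef f q = 0") (auto simp: when_def in_keys_iff)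
  qed
  also have "\<dots> = coef g a * coef f b"
    by (simp add: Sum_any_when_independent)
  finally show ?thesis .
qed

text \<open>Free abelian monoids have unique products: compare lexicographically largest elements.\<close>

lemma unique_product:
  fixes A B :: "('v::finite \<Rightarrow>\<^sub>0 nat) set"
  assumes "finite A" "A \<noteq> {}" "finite B" "B \<noteq> {}"
  obtains a b where "a \<in> A" "b \<in> B" "\<And>a' b'. a' \<in> A \<Longrightarrow> b' \<in> B \<Longrightarrow> a' + b' = a + b \<Longrightarrow> a' = a \<and> b' = b"
proof -
  \<comment> \<open>The induction runs over the set \<open>W\<close> of coordinates in which
    elements of \<open>A\<close>, or elements of \<open>B\<close>, may still differ; for empty
    \<open>W\<close> both sets are singletons.\<close>
  have "\<exists>a\<in>A. \<exists>b\<in>B. \<forall>a'\<in>A. \<forall>b'\<in>B. a' + b' = a + b \<longrightarrow> a' = a \<and> b' = b"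
    if "finite W" "finite A" "A \<noteq> {}" "finite B" "B \<noteq> {}"
      "\<forall>a\<in>A. \<forall>a'\<in>A. \<forall>v. v \<notin> W \<longrightarrow> expo a v = expo a' v"
      "\<forall>b\<in>B. \<forall>b'\<in>B. \<forall>v. v \<notin> W \<longrightarrow> expo b v = expo b' v"
    for W :: "'v set" and A B :: "('v \<Rightarrow>\<^sub>0 nat) set"
    using that
  proof (induction W arbitrary: A B rule: finite_induct)
    case empty
    obtain a b where ab: "a \<in> A" "b \<in> B" using empty(2,4) by blast
    have "a' = a" if "a' \<in> A" for a' using empty(5) ab that by (auto intro!: monom_eqI)
    moreover have "b' = b" if "b' \<in> B" for b' using empty(6) ab that by (auto intro!: monom_eqI)
    ultimately show ?case using ab by blast
  next
    case (insert v W)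
    \<comment> \<open>Fixing the top exponent at \<open>v\<close> removes \<open>v\<close> from the
      varying coordinates. A sum with exponent \<open>M A + M B\<close> at \<open>v\<close> can only
      come from two top elements, so a unique product in the top slices is unique in the full
      sets.\<close>
    define M where "M C = Max ((\<lambda>a. expo a v) ` C)" for C :: "('v \<Rightarrow>\<^sub>0 nat) set"
    define T where "T C = {a \<in> C. expo a v = M C}" for C
    have M: "expo a v \<le> M C" if "finite C" "a \<in> C" for a C
      unfolding M_def using that by simp
    have T: "finite (T C)" "T C \<noteq> {}" if "finite C" "C \<noteq> {}" for C
    proof -
      have "M C \<in> (\<lambda>a. expo a v) ` C" unfolding M_def using that by (intro Max_in) auto
      then show "T C \<noteq> {}" unfolding T_def by auto
      show "finite (T C)" using that unfolding T_def by simp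
    qed
    have "\<exists>a\<in>T A. \<exists>b\<in>T B. \<forall>a'\<in>T A. \<forall>b'\<in>T B. a' + b' = a + b \<longrightarrow> a' = a \<and> b' = b"
    proof (rule insert.IH)
      show "\<forall>a\<in>T A. \<forall>a'\<in>T A. \<forall>u. u \<notin> W \<longrightarrow> expo a u = expo a' u"
        using insert.prems(5) unfolding T_def
        by (metis (mono_tags, lifting) insert_iff mem_Collect_eq)
      show "\<forall>b\<in>T B. \<forall>b'\<in>T B. \<forall>u. u \<notin> W \<longrightarrow> expo b u = expo b' u"
        using insert.prems(6) unfolding T_def
        by (metis (mono_tags, lifting) insert_iff mem_Collect_eq)
    qed (use T insert.prems in auto)
    then obtain a b where ab: "a \<in> T A" "b \<in> T B"
      "\<forall>a'\<in>T A. \<forall>b'\<in>T B. a' + b' = a + b \<longrightarrow> a' = a \<and> b' = b" by blast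
    have "a' = a \<and> b' = b" if "a' \<in> A" "b' \<in> B" "a' + b' = a + b" for a' b'
    proof -
      have "expo a' v + expo b' v = M A + M B"
        using that(3) ab(1,2) unfolding T_def by (metis (mono_tags, lifting) lookup_add mem_Collect_eq)
      moreover have "expo a' v \<le> M A" "expo b' v \<le> M B" using M that insert.prems by auto
      ultimately have "a' \<in> T A" "b' \<in> T B" using that unfolding T_def by auto
      then show ?thesis using ab(3) that(3) by blast
    qed
    then show ?case using ab(1,2) unfolding T_def by blast
  qed
  from this[of UNIV A B]
  have "\<exists>a\<in>A. \<exists>b\<in>B. \<forall>a'\<in>A. \<forall>b'\<in>B. a' + b' = a + b \<longrightarrow> a' = a \<and> b' = b"
    using assms by simp
  then show ?thesis using that by blast
qed

section \<open>Degrees of monomials and monomial ideals\<close>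

definition deg_on :: "'v set \<Rightarrow> ('v \<Rightarrow>\<^sub>0 nat) \<Rightarrow> nat" where
  "deg_on W m = (\<Sum>v\<in>W. expo m v)"

lemma deg_on_add: "deg_on W (m + n) = deg_on W m + deg_on W n"
  by (simp add: deg_on_def lookup_add sum.distrib)

lemma deg_on_uvec: "finite W \<Longrightarrow> deg_on W (uvec v) = (if v \<in> W then 1 else 0)"
proof -
  have "deg_on W (uvec v) = (\<Sum>u\<in>W. if v = u then 1 else 0)"
    unfolding deg_on_def by (intro sum.cong) (auto simp: lookup_single)
  then show "finite W \<Longrightarrow> ?thesis" by simp
qed

lemma mon_degree_eq_deg_on: "mon_degree m = deg_on UNIV (m :: 'v::finite \<Rightarrow>\<^sub>0 nat)"
  unfolding mon_degree_def deg_on_def by (rule sum.mono_neutral_left) (auto simp: in_keys_iff)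

lemma mon_degree_add: "mon_degree (m + n) = mon_degree m + mon_degree (n :: 'v::finite \<Rightarrow>\<^sub>0 nat)"
  by (simp add: mon_degree_eq_deg_on deg_on_add)

lemma mon_degree_uvec: "mon_degree (uvec v) = 1"
  by (simp add: mon_degree_def)

lemma mon_degree_zero: "mon_degree 0 = 0"
  by (simp add: mon_degree_def)

definition upset :: "('v \<Rightarrow>\<^sub>0 nat) set \<Rightarrow> bool" where
  "upset U \<longleftrightarrow> (\<forall>m n. m \<in> U \<longrightarrow> m + n \<in> U)"

text \<open>Given by the monomials that may occur and not by generators: membership becomes a
  condition on single coefficients, and intersecting ideals is intersecting sets of monomials. It is
  an ideal once \<open>U\<close> is an upset.\<close>

definition mono_ideal :: "('v \<Rightarrow>\<^sub>0 nat) set \<Rightarrow> ('v, 'k::field) polys set" where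
  "mono_ideal U = {p. Poly_Mapping.keys p \<subseteq> U}"

lemma mem_mono_ideal_iff: "p \<in> mono_ideal U \<longleftrightarrow> (\<forall>m. m \<notin> U \<longrightarrow> coef p m = 0)"
  by (auto simp: mono_ideal_def in_keys_iff)

lemma mono_ideal_Int: "mono_ideal (U \<inter> V) = mono_ideal U \<inter> mono_ideal V"
  by (auto simp: mono_ideal_def)

lemma is_ideal_mono_ideal:
  assumes "upset U"
  shows "is_ideal (mono_ideal U :: ('v, 'k::field) polys set)"
proof (rule ideal.subspaceI)
  show "x + y \<in> mono_ideal U" if "x \<in> mono_ideal U" "y \<in> mono_ideal U" for x y :: "('v, 'k) polys"
    using that by (simp add: mem_mono_ideal_iff lookup_add)
  show "c * x \<in> mono_ideal U" if "x \<in> mono_ideal U" for c x :: "('v, 'k) polys"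
  proof -
    have "m \<in> U" if m: "m \<in> Poly_Mapping.keys (c * x)" for m
    proof -
      obtain a b where ab: "m = a + b" "b \<in> Poly_Mapping.keys x"
        using subsetD[OF keys_mult m] by auto
      then have "b \<in> U" using \<open>x \<in> mono_ideal U\<close> unfolding mono_ideal_def by auto
      then have "b + a \<in> U" using assms unfolding upset_def by simp
      then show ?thesis using ab by (simp add: add.commute)
    qed
    then show ?thesis unfolding mono_ideal_def by blast
  qed
qed (simp add: mem_mono_ideal_iff)

lemma single_in_mono_ideal: "m \<in> U \<Longrightarrow> Poly_Mapping.single m c \<in> mono_ideal U"
  by (auto simp: mem_mono_ideal_iff lookup_single when_def)

lemma poly_sum_singles:
  "p = (\<Sum>m\<in>Poly_Mapping.keys p. Poly_Mapping.single m (coef p m))"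
proof (rule poly_mapping_eqI)
  fix m
  have "coef (\<Sum>n\<in>Poly_Mapping.keys p. Poly_Mapping.single n (coef p n)) m
      = (\<Sum>n\<in>Poly_Mapping.keys p. if n = m then coef p m else 0)"
    unfolding coef_sum by (intro sum.cong) (auto simp: lookup_single)
  then show "coef p m = coef (\<Sum>n\<in>Poly_Mapping.keys p. Poly_Mapping.single n (coef p n)) m"
    by (simp add: in_keys_iff)
qed

lemma mono_ideal_eq_span:
  assumes "upset U" shows "mono_ideal U = (ideal_span (mono_of ` U) :: ('v, 'k::field) polys set)"
proof
  show "ideal_span (mono_of ` U) \<subseteq> (mono_ideal U :: ('v, 'k) polys set)"
    by (rule ideal.span_minimal) (auto simp: is_ideal_mono_ideal assms intro!: single_in_mono_ideal)
  show "mono_ideal U \<subseteq> (ideal_span (mono_of ` U) :: ('v, 'k) polys set)"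
  proof
    fix p :: "('v, 'k) polys" assume p: "p \<in> mono_ideal U"
    have "(\<Sum>m\<in>Poly_Mapping.keys p. Poly_Mapping.single m (coef p m)) \<in> ideal_span (mono_of ` U)"
    proof (rule ideal.span_sum)
      fix m assume "m \<in> Poly_Mapping.keys p"
      then have "mono_of m \<in> ideal_span (mono_of ` U)" using p by (auto simp: mono_ideal_def intro!: ideal.span_base)
      then have "Poly_Mapping.single 0 (coef p m) * mono_of m \<in> ideal_span (mono_of ` U)"
        by (rule ideal.span_scale)
      then show "Poly_Mapping.single m (coef p m) \<in> ideal_span (mono_of ` U)"
        by (simp add: mult_single)
    qed
    then show "p \<in> ideal_span (mono_of ` U)" using poly_sum_singles[of p] by simp
  qed
qed

definition restr :: "('v \<Rightarrow>\<^sub>0 nat) set \<Rightarrow> ('v, 'k::field) polys \<Rightarrow> ('v, 'k) polys" where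
  "restr A p = Abs_poly_mapping (\<lambda>m. if m \<in> A then coef p m else 0)"

lemma coef_restr: "coef (restr A p) m = (if m \<in> A then coef p m else 0)"
  unfolding restr_def
  by (subst lookup_Abs_poly_mapping) (auto intro: finite_subset[OF _ finite_keys[of p]] simp: in_keys_iff)

text \<open>If \<open>f\<close> is not in the ideal, remove its terms in \<open>U\<close> and keep those of least \<open>W\<close>-degree. A unique product
  of one of them with a term of \<open>g\<close> free of \<open>W\<close> survives in \<open>g * f\<close>.\<close>

lemma mono_ideal_primary:
  fixes f g :: "('v::finite, 'k::field) polys"
  assumes "upset U" and dep: "\<And>m n. (\<And>v. v \<in> W \<Longrightarrow> expo m v = expo n v) \<Longrightarrow> m \<in> U \<Longrightarrow> n \<in> U"
    and a0: "a0 \<in> Poly_Mapping.keys g" "deg_on W a0 = 0"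
    and gf: "g * f \<in> mono_ideal U"
  shows "f \<in> mono_ideal U"
proof (rule ccontr)
  assume "f \<notin> mono_ideal U"
  define f' where "f' = restr (- U) f"
  have cf': "coef f' m = (if m \<in> U then 0 else coef f m)" for m
    by (simp add: f'_def coef_restr)
  define K where "K = Poly_Mapping.keys f'"
  obtain m0 where "m0 \<notin> U" "coef f m0 \<noteq> 0" using \<open>f \<notin> mono_ideal U\<close> by (auto simp: mem_mono_ideal_iff)
  then have "m0 \<in> K" unfolding K_def by (simp add: in_keys_iff cf')
  moreover have "m \<notin> U" if "m \<in> K" for m
    using that cf'[of m] unfolding K_def by (auto simp: in_keys_iff split: if_splits)
  ultimately have K: "finite K" "K \<noteq> {}" "\<And>m. m \<in> K \<Longrightarrow> m \<notin> U"
    unfolding K_def by auto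
  have "f - f' \<in> mono_ideal U" by (simp add: mem_mono_ideal_iff lookup_minus cf')
  then have "g * f - g * (f - f') \<in> mono_ideal U"
    using gf is_ideal_mono_ideal[OF assms(1)] by (metis ideal.subspace_diff ideal.subspace_scale)
  then have gf': "g * f' \<in> mono_ideal U" by (simp add: algebra_simps)
  define k where "k = Min (deg_on W ` K)"
  define B where "B = {b \<in> K. deg_on W b = k}"
  define A where "A = {a \<in> Poly_Mapping.keys g. deg_on W a = 0}"
  have kmin: "k \<le> deg_on W b" if "b \<in> K" for b using that K unfolding k_def by simp
  have "k \<in> deg_on W ` K" using K unfolding k_def by (intro Min_in) auto
  then have B: "finite B" "B \<noteq> {}" using K unfolding B_def by auto
  have A: "finite A" "A \<noteq> {}" using a0 unfolding A_def by auto
  obtain a b where ab: "a \<in> A" "b \<in> B"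
    and u: "\<And>a' b'. a' \<in> A \<Longrightarrow> b' \<in> B \<Longrightarrow> a' + b' = a + b \<Longrightarrow> a' = a \<and> b' = b"
    using unique_product[OF A B] by metis
  have "coef (g * f') (a + b) = coef g a * coef f' b"
  proof (rule coef_mult_unique)
    fix a' b' assume *: "a' \<in> Poly_Mapping.keys g" "b' \<in> Poly_Mapping.keys f'" "a' + b' = a + b"
    have "deg_on W a' + deg_on W b' = k"
      using ab *(3) unfolding A_def B_def by (metis (mono_tags, lifting) add_0 deg_on_add mem_Collect_eq)
    then have "a' \<in> A" "b' \<in> B" using kmin[of b'] * unfolding A_def B_def K_def by auto
    then show "a' = a \<and> b' = b" using u * by blast
  qed
  also have "\<dots> \<noteq> 0" using ab unfolding A_def B_def K_def by (auto simp: in_keys_iff)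
  finally have "a + b \<in> U" using gf' by (auto simp: mem_mono_ideal_iff)
  \<comment> \<open>The factor \<open>a\<close> involves no variable of \<open>W\<close>, so
    \<open>a + b\<close> and \<open>b\<close> agree on \<open>W\<close> and \<open>dep\<close>
    carries membership in \<open>U\<close> over to \<open>b\<close>.\<close>
  moreover have "expo (a + b) v = expo b v" if "v \<in> W" for v
    using ab(1) that unfolding A_def deg_on_def by (simp add: lookup_add)
  ultimately have "b \<in> U" using dep[of "a + b" b] by blast
  then show False using ab K unfolding B_def by blast
qed

text \<open>Every monomial other than 1 is divisible by a variable. This lets membership in the
  graded maximal ideal, and with it minimality of a resolution, be tested on constant
  coefficients.\<close>

lemma irrelevant_ideal_eq: "irrelevant_ideal = {p :: ('v::finite, 'k::field) polys. coef p 0 = 0}"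
proof -
  have up: "upset (- {0 :: 'v \<Rightarrow>\<^sub>0 nat})"
    by (auto simp: upset_def poly_mapping_eq_iff fun_eq_iff lookup_add)
  have eq: "{p :: ('v, 'k) polys. coef p 0 = 0} = mono_ideal (- {0})"
    by (auto simp: mem_mono_ideal_iff)
  have "mono_of ` (- {0}) \<subseteq> ideal_span (range Var :: ('v, 'k) polys set)"
  proof
    fix p :: "('v, 'k) polys" assume "p \<in> mono_of ` (- {0})"
    then obtain m where m: "m \<noteq> 0" "p = mono_of m" by auto
    then obtain v where v: "0 < expo m v" by (metis gr0I lookup_zero poly_mapping_eqI)
    have "mono_of (m - uvec v) * Var v \<in> ideal_span (range Var :: ('v, 'k) polys set)"
      by (intro ideal.span_scale ideal.span_base) auto
    moreover have "mono_of (m - uvec v) * Var v = p"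
      using monom_diff_add[of "uvec v" m] uvec_le_iff[of v m] v m
      by (simp add: Var_def mult_single add.commute)
    ultimately show "p \<in> ideal_span (range Var)" by simp
  qed
  then have "mono_ideal (- {0}) \<subseteq> ideal_span (range Var :: ('v, 'k) polys set)"
    unfolding mono_ideal_eq_span[OF up] by (rule ideal.span_minimal) (rule ideal.subspace_span)
  moreover have "ideal_span (range Var :: ('v, 'k) polys set) \<subseteq> mono_ideal (- {0})"
  proof (rule ideal.span_minimal)
    have "uvec v \<noteq> 0" for v :: 'v by (metis lookup_single_eq lookup_zero one_neq_zero)
    then show "range Var \<subseteq> (mono_ideal (- {0}) :: ('v, 'k) polys set)"
      by (auto simp: Var_def intro!: single_in_mono_ideal)
  qed (rule is_ideal_mono_ideal[OF up])
  ultimately show ?thesis unfolding irrelevant_ideal_def eq by blast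
qed

section \<open>Homogeneous components\<close>

definition hcomp :: "int \<Rightarrow> ('v, 'k::field) polys \<Rightarrow> ('v, 'k) polys" where
  "hcomp d = restr {m. int (mon_degree m) = d}"

lemma coef_hcomp: "coef (hcomp d p) m = (if int (mon_degree m) = d then coef p m else 0)"
  by (simp add: hcomp_def coef_restr)

lemma homogeneous_iff: "homogeneous d p \<longleftrightarrow> (\<forall>m. coef p m \<noteq> 0 \<longrightarrow> int (mon_degree m) = d)"
  unfolding homogeneous_def Ball_def in_keys_iff ..

lemma homogeneous_hcomp: "homogeneous d (hcomp d p)"
  by (simp add: homogeneous_iff coef_hcomp)

lemma hcomp_homogeneous: "homogeneous d p \<Longrightarrow> hcomp d' p = (if d = d' then p else 0)"
  by (intro poly_mapping_eqI) (auto simp: homogeneous_iff coef_hcomp)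

lemma homogeneous_zero [simp]: "homogeneous d 0"
  by (simp add: homogeneous_def)

lemma homogeneous_one: "homogeneous 0 1"
  by (simp add: homogeneous_def mon_degree_zero)

lemma homogeneous_add: "homogeneous d p \<Longrightarrow> homogeneous d q \<Longrightarrow> homogeneous d (p + q)"
  unfolding homogeneous_iff lookup_add by (metis add.right_neutral)

lemma homogeneous_sum: "(\<And>a. a \<in> A \<Longrightarrow> homogeneous d (f a)) \<Longrightarrow> homogeneous d (sum f A)"
  by (induction A rule: infinite_finite_induct) (auto intro: homogeneous_add)

lemma homogeneous_mult:
  fixes p q :: "('v::finite, 'k::field) polys"
  assumes "homogeneous d p" "homogeneous e q" shows "homogeneous (d + e) (p * q)"
  unfolding homogeneous_def
proof
  fix m assume "m \<in> Poly_Mapping.keys (p * q)"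
  then obtain a b where "m = a + b" "a \<in> Poly_Mapping.keys p" "b \<in> Poly_Mapping.keys q"
    using keys_mult[of p q] by blast
  then show "int (mon_degree m) = d + e"
    using assms by (simp add: homogeneous_def mon_degree_add)
qed

lemma homogeneous_Var: "homogeneous 1 (Var v)"
  by (simp add: homogeneous_def Var_def mon_degree_uvec[simplified])

lemma hcomp_add: "hcomp d (p + q) = hcomp d p + hcomp d q"
  by (rule poly_mapping_eqI) (simp add: coef_hcomp lookup_add)

lemma hcomp_zero [simp]: "hcomp d 0 = 0"
  by (rule poly_mapping_eqI) (simp add: coef_hcomp)

lemma hcomp_sum: "hcomp d (sum f A) = (\<Sum>a\<in>A. hcomp d (f a))"
  by (induction A rule: infinite_finite_induct) (auto simp: hcomp_add)

lemma poly_eq_hcomp_sum: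
  fixes p :: "('v::finite, 'k::field) polys"
  obtains D where "finite D" "p = (\<Sum>d\<in>D. hcomp d p)"
proof
  show "finite ((int \<circ> mon_degree) ` Poly_Mapping.keys p)" by simp
  show "p = (\<Sum>d\<in>(int \<circ> mon_degree) ` Poly_Mapping.keys p. hcomp d p)"
  proof (rule poly_mapping_eqI)
    fix m
    show "coef p m = coef (\<Sum>d\<in>(int \<circ> mon_degree) ` Poly_Mapping.keys p. hcomp d p) m"
      unfolding coef_sum coef_hcomp by (subst sum.delta') (force simp: in_keys_iff)+
  qed
qed

lemma hcomp_mult_homogeneous:
  fixes p q :: "('v::finite, 'k::field) polys"
  assumes "homogeneous e p"
  shows "hcomp d (p * q) = p * hcomp (d - e) q"
proof -
  obtain D where D: "finite D" "q = (\<Sum>i\<in>D. hcomp i q)" using poly_eq_hcomp_sum by blast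
  have "hcomp d (p * q) = (\<Sum>i\<in>D. hcomp d (p * hcomp i q))"
    by (subst D(2)) (simp add: sum_distrib_left hcomp_sum)
  also have "\<dots> = (\<Sum>i\<in>D. p * hcomp (d - e) (hcomp i q))"
  proof (rule sum.cong)
    fix i
    have "homogeneous (e + i) (p * hcomp i q)" using assms homogeneous_hcomp by (rule homogeneous_mult)
    then show "hcomp d (p * hcomp i q) = p * hcomp (d - e) (hcomp i q)"
      using hcomp_homogeneous[OF homogeneous_hcomp[of i q], of "d - e"]
      by (auto simp: hcomp_homogeneous[of "e + i"])
  qed simp
  also have "\<dots> = p * hcomp (d - e) q"
    by (subst (2) D(2)) (simp add: sum_distrib_left hcomp_sum)
  finally show ?thesis .
qed

lemma homogeneous_nonzero_degree: "homogeneous d p \<Longrightarrow> d \<noteq> 0 \<Longrightarrow> coef p 0 = 0"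
  unfolding homogeneous_iff by (metis mon_degree_zero of_nat_0)

lemma coef_mult_zero: "coef (p * q) 0 = coef p 0 * coef q (0 :: 'v \<Rightarrow>\<^sub>0 nat)"
  using coef_mult_unique[of p q 0 0]
  by (simp add: poly_mapping_eq_iff fun_eq_iff lookup_add)

section \<open>The Koszul complex\<close>

text \<open>Koszul chains are functions on all subsets of the variables; a chain of homological degree \<open>p\<close> is one
  whose values on sets of cardinality \<open>p\<close> matter. The enumeration \<open>to_nat\<close> only serves to fix signs.\<close>

definition ksign :: "'v::finite \<Rightarrow> 'v set \<Rightarrow> 'a::comm_ring_1" where
  "ksign v \<sigma> = (- 1) ^ card {u \<in> \<sigma>. to_nat u < to_nat v}"

definition ind_vec :: "'v::finite set \<Rightarrow> 'v \<Rightarrow>\<^sub>0 nat" where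
  "ind_vec \<sigma> = (\<Sum>v\<in>\<sigma>. uvec v)"

text \<open>The Koszul differential read at one basis element. It sends e_\<tau> to the signed sum
  of the x_v e_(\<tau> - v), so its value at \<open>\<sigma>\<close> collects contributions from all
  sets \<open>insert v \<sigma>\<close>.\<close>

definition koszul :: "('v::finite set \<Rightarrow> ('v, 'k::field) polys) \<Rightarrow> 'v set \<Rightarrow> ('v, 'k) polys" where
  "koszul c \<sigma> = (\<Sum>v\<in>- \<sigma>. ksign v \<sigma> * (Var v * c (insert v \<sigma>)))"

text \<open>The component of a chain in the fine degree \<open>\<alpha>\<close>, where \<open>c \<sigma>\<close> is multiplied by the variables in \<open>\<sigma>\<close>.\<close>

definition mcomp :: "('v::finite set \<Rightarrow> ('v, 'k::field) polys) \<Rightarrow> ('v \<Rightarrow>\<^sub>0 nat) \<Rightarrow> 'v set \<Rightarrow> 'k" where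
  "mcomp c \<alpha> \<sigma> = (if \<forall>v\<in>\<sigma>. 0 < expo \<alpha> v then coef (c \<sigma>) (\<alpha> - ind_vec \<sigma>) else 0)"

text \<open>The contracting homotopy that in fine degree \<open>\<alpha>\<close> uses the variable \<open>ch \<alpha>\<close>; it is zero in fine degrees
  not involving that variable.\<close>

definition contract :: "(('v::finite \<Rightarrow>\<^sub>0 nat) \<Rightarrow> 'v) \<Rightarrow> ('v set \<Rightarrow> ('v, 'k::field) polys) \<Rightarrow> 'v set \<Rightarrow> ('v, 'k) polys" where
  "contract ch c \<sigma> = Abs_poly_mapping (\<lambda>m. if ch (m + ind_vec \<sigma>) \<in> \<sigma>
     then ksign (ch (m + ind_vec \<sigma>)) (\<sigma> - {ch (m + ind_vec \<sigma>)}) *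
       coef (c (\<sigma> - {ch (m + ind_vec \<sigma>)})) (m + uvec (ch (m + ind_vec \<sigma>)))
     else 0)"

lemma expo_ind_vec: "expo (ind_vec \<sigma>) v = (if v \<in> \<sigma> then 1 else 0)"
proof -
  have "expo (ind_vec \<sigma>) v = (\<Sum>u\<in>\<sigma>. if u = v then 1 else 0)"
    unfolding ind_vec_def lookup_sum by (intro sum.cong) (auto simp: lookup_single)
  then show ?thesis by simp
qed

lemma ind_vec_insert: "v \<notin> \<sigma> \<Longrightarrow> ind_vec (insert v \<sigma>) = ind_vec \<sigma> + uvec v"
  by (simp add: ind_vec_def add.commute)

lemma coef_sign_mult: "coef ((- 1) ^ n * p) m = (- 1) ^ n * coef p m"
  by (induction n) auto

lemma coef_ksign_mult: "coef (ksign v \<sigma> * p) m = ksign v \<sigma> * coef p m"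
  unfolding ksign_def by (rule coef_sign_mult)

lemma homogeneous_ksign_mult: "homogeneous d p \<Longrightarrow> homogeneous d (ksign v \<sigma> * p)"
  by (auto simp: homogeneous_iff coef_ksign_mult)

lemma ksign_sq [simp]: "ksign v \<sigma> * ksign v \<sigma> = 1"
  by (simp add: ksign_def flip: power_mult_distrib)

lemma ksign_sq' [simp]: "ksign v \<sigma> * (ksign v \<sigma> * x) = x"
  by (simp flip: mult.assoc)

lemma ksign_empty [simp]: "ksign v {} = 1"
  by (simp add: ksign_def)

lemma ksign_insert:
  assumes "u \<notin> \<sigma>"
  shows "ksign v (insert u \<sigma>) = (if to_nat u < to_nat v then - ksign v \<sigma> else ksign v \<sigma>)"
proof -
  have "{w \<in> insert u \<sigma>. to_nat w < to_nat v}
      = (if to_nat u < to_nat v then insert u {w \<in> \<sigma>. to_nat w < to_nat v}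
         else {w \<in> \<sigma>. to_nat w < to_nat v})"
    by auto
  then show ?thesis using assms by (simp add: ksign_def)
qed

text \<open>Exactly one of \<open>u\<close> and \<open>v\<close> precedes the other in the
  enumeration, so exactly one of the two insertions changes a sign. In this arrangement the rule
  cancels the cross terms of the contracting homotopy; the variant \<open>ksign_anticomm'\<close>
  yields that the differential squares to zero.\<close>

lemma ksign_anticomm:
  assumes "u \<noteq> v" "u \<notin> \<sigma>" "v \<notin> \<sigma>"
  shows "ksign u (insert v \<sigma>) * ksign v (insert u \<sigma>) = - (ksign u \<sigma> * ksign v \<sigma>)"
proof -
  have "to_nat u \<noteq> to_nat v" using assms(1) by simp
  then have "to_nat u < to_nat v \<or> to_nat v < to_nat u \<and> \<not> to_nat u < to_nat v" by linarith
  then show ?thesis using assms by (auto simp: ksign_insert)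
qed

lemma ksign_anticomm':
  assumes "u \<noteq> v" "u \<notin> \<sigma>" "v \<notin> \<sigma>"
  shows "ksign v \<sigma> * ksign u (insert v \<sigma>) = - (ksign u \<sigma> * ksign v (insert u \<sigma>))"
proof -
  have "to_nat u \<noteq> to_nat v" using assms(1) by simp
  then have "to_nat u < to_nat v \<or> to_nat v < to_nat u \<and> \<not> to_nat u < to_nat v" by linarith
  then show ?thesis using assms by (auto simp: ksign_insert)
qed

text \<open>Pairing \<open>F u v\<close> with \<open>F v u\<close> works in every characteristic,
  whereas exchanging the two summations would only show that twice the sum vanishes.\<close>

lemma sum_antisymmetric:
  fixes F :: "'v \<Rightarrow> 'v \<Rightarrow> 'a::ab_group_add"
  assumes "finite A" "\<And>u v. u \<in> A \<Longrightarrow> v \<in> A \<Longrightarrow> u \<noteq> v \<Longrightarrow> F u v = - F v u"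
  shows "(\<Sum>v\<in>A. \<Sum>u\<in>A - {v}. F v u) = 0"
  using assms
proof (induction A rule: finite_induct)
  case (insert a A)
  have "(\<Sum>u\<in>insert a A - {v}. F v u) = F v a + (\<Sum>u\<in>A - {v}. F v u)" if "v \<in> A" for v
  proof -
    have "insert a A - {v} = insert a (A - {v})" using insert.hyps that by auto
    then show ?thesis using insert.hyps by simp
  qed
  then have "(\<Sum>v\<in>insert a A. \<Sum>u\<in>insert a A - {v}. F v u)
     = (\<Sum>u\<in>A. F a u) + (\<Sum>v\<in>A. F v a + (\<Sum>u\<in>A - {v}. F v u))"
    using insert.hyps by (simp cong: sum.cong)
  also have "(\<Sum>v\<in>A. F v a + (\<Sum>u\<in>A - {v}. F v u)) = (\<Sum>v\<in>A. F v a)"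
    unfolding sum.distrib by (subst insert.IH) (auto intro: insert.prems simp del: sum.insert)
  also have "(\<Sum>u\<in>A. F a u) + (\<Sum>u\<in>A. F u a) = (\<Sum>u\<in>A. F a u + F u a)"
    by (simp add: sum.distrib)
  also have "\<dots> = 0"
  proof (rule sum.neutral, rule ballI)
    fix u assume "u \<in> A"
    then have "F a u = - F u a" using insert.prems[of a u] insert.hyps by blast
    then show "F a u + F u a = 0" by simp
  qed
  finally show ?case .
qed simp

lemma koszul_koszul: "koszul (koszul c) \<sigma> = 0"
proof -
  define F where "F v u = ksign v \<sigma> * ksign u (insert v \<sigma>) * (Var v * (Var u * c (insert u (insert v \<sigma>))))" for v u
  have "koszul (koszul c) \<sigma> = (\<Sum>v\<in>- \<sigma>. \<Sum>u\<in>- \<sigma> - {v}. F v u)"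
  proof -
    have 1: "a * (x * (b * (y * z))) = a * b * (x * (y * z))" for a b x y z :: "('a, 'b) polys"
      by (simp only: mult_ac)
    show ?thesis unfolding koszul_def sum_distrib_left F_def Compl_insert 1 ..
  qed
  also have "\<dots> = 0"
  proof (rule sum_antisymmetric)
    fix u v assume "u \<in> - \<sigma>" "v \<in> - \<sigma>" "u \<noteq> v"
    then have "ksign u \<sigma> * ksign v (insert u \<sigma>) = - (ksign v \<sigma> * ksign u (insert v \<sigma>) :: ('a, 'b) polys)"
      by (intro ksign_anticomm') auto
    then show "F u v = - F v u"
      unfolding F_def insert_commute[of u v] mult.left_commute[of "Var u" "Var v"] by simp
  qed simp
  finally show ?thesis .
qed

lemma koszul_diff: "koszul (\<lambda>\<tau>. c \<tau> - d \<tau>) \<sigma> = koszul c \<sigma> - koszul d \<sigma>"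
  by (simp add: koszul_def right_diff_distrib sum_subtractf)

lemma koszul_lincomb:
  fixes c :: "'i \<Rightarrow> 'v::finite set \<Rightarrow> ('v, 'k::field) polys"
  shows "koszul (\<lambda>\<tau>. \<Sum>j\<in>J. a j * c j \<tau>) \<sigma> = (\<Sum>j\<in>J. a j * koszul (c j) \<sigma>)"
proof -
  have 1: "a * (x * (b * z)) = b * (a * (x * z))" for a b x z :: "('v::finite, 'k::field) polys"
    by (simp only: mult_ac)
  show ?thesis unfolding koszul_def sum_distrib_left 1 by (rule sum.swap)
qed

lemma koszul_cong: "(\<And>\<tau>. card \<tau> = card \<sigma> + 1 \<Longrightarrow> c \<tau> = d \<tau>) \<Longrightarrow> koszul c \<sigma> = koszul d \<sigma>"
  unfolding koszul_def by (intro sum.cong) auto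

lemma homogeneous_koszul:
  assumes "\<And>\<tau>. card \<tau> = card \<sigma> + 1 \<Longrightarrow> homogeneous d (c \<tau>)"
  shows "homogeneous (d + 1) (koszul c \<sigma>)"
  unfolding koszul_def
proof (intro homogeneous_sum homogeneous_ksign_mult)
  fix v assume "v \<in> - \<sigma>"
  then have "homogeneous (1 + d) (Var v * c (insert v \<sigma>))"
    by (intro homogeneous_mult homogeneous_Var assms) simp
  then show "homogeneous (d + 1) (Var v * c (insert v \<sigma>))" by (simp add: add.commute)
qed

lemma coef_eq_mcomp: "coef (c \<sigma>) m = mcomp c (m + ind_vec \<sigma>) \<sigma>"
  by (simp add: mcomp_def lookup_add expo_ind_vec)

lemma mcomp_koszul:
  assumes "\<forall>v\<in>\<sigma>. 0 < expo \<alpha> v"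
  shows "mcomp (koszul c) \<alpha> \<sigma> = (\<Sum>v\<in>- \<sigma>. ksign v \<sigma> * mcomp c \<alpha> (insert v \<sigma>))"
proof -
  have "mcomp (koszul c) \<alpha> \<sigma> = (\<Sum>v\<in>- \<sigma>. ksign v \<sigma> * coef (Var v * c (insert v \<sigma>)) (\<alpha> - ind_vec \<sigma>))"
    using assms unfolding mcomp_def koszul_def coef_sum coef_ksign_mult by simp
  also have "\<dots> = (\<Sum>v\<in>- \<sigma>. ksign v \<sigma> * mcomp c \<alpha> (insert v \<sigma>))"
    using assms
    by (intro sum.cong) (auto simp: coef_Var_mult mcomp_def lookup_minus expo_ind_vec ind_vec_insert diff_diff_eq)
  finally show ?thesis .
qed

lemma coef_contract:
  "coef (contract ch c \<sigma>) m = (if ch (m + ind_vec \<sigma>) \<in> \<sigma>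
     then ksign (ch (m + ind_vec \<sigma>)) (\<sigma> - {ch (m + ind_vec \<sigma>)}) *
       coef (c (\<sigma> - {ch (m + ind_vec \<sigma>)})) (m + uvec (ch (m + ind_vec \<sigma>)))
     else 0)"
  unfolding contract_def
proof (subst lookup_Abs_poly_mapping)
  let ?f = "\<lambda>m. if ch (m + ind_vec \<sigma>) \<in> \<sigma>
     then ksign (ch (m + ind_vec \<sigma>)) (\<sigma> - {ch (m + ind_vec \<sigma>)}) *
       coef (c (\<sigma> - {ch (m + ind_vec \<sigma>)})) (m + uvec (ch (m + ind_vec \<sigma>)))
     else 0"
  \<comment> \<open>The chosen variable changes with \<open>m\<close> but always lies in the finite
    set \<open>\<sigma>\<close>, so finitely many shifted supports cover the support.\<close>
  have "{m. ?f m \<noteq> 0} \<subseteq> (\<Union>v\<in>\<sigma>. (\<lambda>m. m + uvec v) -` Poly_Mapping.keys (c (\<sigma> - {v})))"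
    by (auto simp: in_keys_iff)
  moreover have "finite \<dots>"
    by (intro finite_UN_I finite_vimageI) (auto simp: inj_on_def)
  ultimately show "finite {m. ?f m \<noteq> 0}" by (rule finite_subset)
qed simp

lemma mcomp_contract:
  assumes "\<forall>v\<in>\<sigma>. 0 < expo \<alpha> v"
  shows "mcomp (contract ch c) \<alpha> \<sigma> = (if ch \<alpha> \<in> \<sigma> then ksign (ch \<alpha>) (\<sigma> - {ch \<alpha>}) * mcomp c \<alpha> (\<sigma> - {ch \<alpha>}) else 0)"
proof -
  have 1: "\<alpha> - ind_vec \<sigma> + ind_vec \<sigma> = \<alpha>"
    using monom_diff_add[of "ind_vec \<sigma>" \<alpha>] assms by (simp add: expo_ind_vec add.commute Suc_le_eq)
  show ?thesis
  proof (cases "ch \<alpha> \<in> \<sigma>")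
    case True
    have "\<alpha> - ind_vec \<sigma> + uvec (ch \<alpha>) = \<alpha> - ind_vec (\<sigma> - {ch \<alpha>})"
      using assms True
      by (intro monom_eqI) (auto simp: lookup_add lookup_minus expo_ind_vec lookup_single when_def)
    then show ?thesis using assms True by (simp add: mcomp_def coef_contract 1)
  next
    case False
    then show ?thesis using assms by (simp add: mcomp_def coef_contract 1)
  qed
qed

lemma mcomp_contract_outside:
  assumes "\<not> 0 < expo \<alpha> (ch \<alpha>)"
  shows "mcomp (contract ch c) \<alpha> \<sigma> = 0"
proof (cases "\<forall>v\<in>\<sigma>. 0 < expo \<alpha> v")
  case True
  then show ?thesis using assms by (auto simp: mcomp_contract)
next
  case False
  show ?thesis unfolding mcomp_def if_not_P[OF False] ..
qed

text \<open>Wedging with e_v and dividing by x_v, for v = \<open>ch \<alpha>\<close>, is a homotopy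
  from the identity to zero. The choice of v may depend on the fine degree because
  \<open>koszul\<close> preserves it. If v is not in \<open>\<sigma>\<close>, only the summand of
  the differential that inserts v survives and returns the chain. If v lies in
  \<open>\<sigma>\<close>, the chain is returned by the summand of \<open>koszul c\<close> that
  restores v, and the other terms cancel by the sign rule.\<close>

lemma contract_homotopy:
  assumes \<sigma>: "\<forall>v\<in>\<sigma>. 0 < expo \<alpha> v" and v: "0 < expo \<alpha> (ch \<alpha>)"
  shows "mcomp (koszul (contract ch c)) \<alpha> \<sigma> + mcomp (contract ch (koszul c)) \<alpha> \<sigma> = mcomp c \<alpha> \<sigma>"
proof -
  let ?v = "ch \<alpha>"
  have 1: "mcomp (contract ch c) \<alpha> (insert u \<sigma>)
     = (if ?v \<in> insert u \<sigma> then ksign ?v (insert u \<sigma> - {?v}) * mcomp c \<alpha> (insert u \<sigma> - {?v}) else 0)" for u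
  proof (cases "0 < expo \<alpha> u")
    case True
    then show ?thesis using \<sigma> by (intro mcomp_contract) auto
  next
    case False
    then have "mcomp d \<alpha> \<tau> = 0" if "u \<in> \<tau>" for d :: "'a set \<Rightarrow> ('a, 'b) polys" and \<tau>
      using that by (auto simp: mcomp_def)
    moreover have "?v \<noteq> u" using v False by auto
    ultimately show ?thesis by simp
  qed
  show ?thesis
  proof (cases "?v \<in> \<sigma>")
    case True
    define \<tau> where "\<tau> = \<sigma> - {?v}"
    have \<tau>: "\<sigma> = insert ?v \<tau>" "?v \<notin> \<tau>" using True unfolding \<tau>_def by auto
    have "mcomp (koszul (contract ch c)) \<alpha> \<sigma>
        = (\<Sum>u\<in>- \<sigma>. ksign u \<sigma> * (ksign ?v (insert u \<tau>) * mcomp c \<alpha> (insert u \<tau>)))"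
      unfolding mcomp_koszul[OF \<sigma>] 1
    proof (intro sum.cong)
      fix u assume "u \<in> - \<sigma>"
      then have "insert u \<sigma> - {?v} = insert u \<tau>" unfolding \<tau>_def using True by auto
      then show "ksign u \<sigma> * (if ?v \<in> insert u \<sigma> then ksign ?v (insert u \<sigma> - {?v}) * mcomp c \<alpha> (insert u \<sigma> - {?v}) else 0)
        = ksign u \<sigma> * (ksign ?v (insert u \<tau>) * mcomp c \<alpha> (insert u \<tau>))" using True by simp
    qed simp
    also have "\<dots> = (\<Sum>u\<in>- \<sigma>. - (ksign ?v \<tau> * (ksign u \<tau> * mcomp c \<alpha> (insert u \<tau>))))"
    proof (intro sum.cong)
      fix u assume u: "u \<in> - \<sigma>"
      have "ksign u (insert ?v \<tau>) * ksign ?v (insert u \<tau>) = - (ksign u \<tau> * ksign ?v \<tau> :: 'b)"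
        using u \<tau> by (intro ksign_anticomm) auto
      then have H: "ksign u \<sigma> * ksign ?v (insert u \<tau>) = - (ksign u \<tau> * ksign ?v \<tau> :: 'b)"
        unfolding \<tau>(1)[symmetric] .
      show "ksign u \<sigma> * (ksign ?v (insert u \<tau>) * mcomp c \<alpha> (insert u \<tau>))
         = - (ksign ?v \<tau> * (ksign u \<tau> * mcomp c \<alpha> (insert u \<tau>)))"
        unfolding mult.assoc[symmetric] H by (simp only: mult_minus_left mult_minus_right mult.commute)
    qed simp
    finally have K: "mcomp (koszul (contract ch c)) \<alpha> \<sigma>
        = - (ksign ?v \<tau> * (\<Sum>u\<in>- \<sigma>. ksign u \<tau> * mcomp c \<alpha> (insert u \<tau>)))"
      by (simp add: sum_negf sum_distrib_left)
    have "- \<tau> = insert ?v (- \<sigma>)" using \<tau> by auto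
    moreover have "\<forall>v\<in>\<tau>. 0 < expo \<alpha> v" using \<sigma> unfolding \<tau>_def by blast
    ultimately have "mcomp (koszul c) \<alpha> \<tau>
        = ksign ?v \<tau> * mcomp c \<alpha> (insert ?v \<tau>) + (\<Sum>u\<in>- \<sigma>. ksign u \<tau> * mcomp c \<alpha> (insert u \<tau>))"
      using True by (simp add: mcomp_koszul)
    then have L: "mcomp (contract ch (koszul c)) \<alpha> \<sigma>
        = ksign ?v \<tau> * (ksign ?v \<tau> * mcomp c \<alpha> \<sigma> + (\<Sum>u\<in>- \<sigma>. ksign u \<tau> * mcomp c \<alpha> (insert u \<tau>)))"
      unfolding mcomp_contract[OF \<sigma>] if_P[OF True] \<tau>(1)[symmetric] unfolding \<tau>_def by simp
    show ?thesis unfolding K L distrib_left ksign_sq' by simp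
  next
    case False
    then have "mcomp (koszul (contract ch c)) \<alpha> \<sigma>
        = (\<Sum>u\<in>- \<sigma>. if u = ?v then ksign ?v \<sigma> * (ksign ?v \<sigma> * mcomp c \<alpha> \<sigma>) else 0)"
      unfolding mcomp_koszul[OF \<sigma>] 1 by (intro sum.cong) auto
    then show ?thesis using False \<sigma> by (simp add: mcomp_contract)
  qed
qed

lemma homogeneous_contract:
  assumes "\<And>\<tau>. card \<tau> + 1 = card \<sigma> \<Longrightarrow> homogeneous e (c \<tau>)"
  shows "homogeneous (e - 1) (contract ch c \<sigma>)"
  unfolding homogeneous_iff
proof (intro allI impI)
  fix m assume "coef (contract ch c \<sigma>) m \<noteq> 0"
  then obtain v where v: "v \<in> \<sigma>" "coef (c (\<sigma> - {v})) (m + uvec v) \<noteq> 0"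
    by (auto simp: coef_contract split: if_splits)
  then have "int (mon_degree (m + uvec v)) = e"
    using assms[of "\<sigma> - {v}"] unfolding homogeneous_iff by (metis card_Suc_Diff1 finite Suc_eq_plus1)
  then show "int (mon_degree m) = e - 1" by (simp add: mon_degree_add mon_degree_uvec[simplified])
qed

text \<open>The Koszul complex of the polynomial ring is exact in positive homological degree: a
  nonempty \<open>\<sigma>\<close> forces some variable into the fine degree, and any such variable
  serves for the contraction. The second conclusion keeps track of the internal degree, which
  dimension shifting relies on.\<close>

lemma koszul_acyclic:
  fixes c :: "'v::finite set \<Rightarrow> ('v, 'k::field) polys"
  assumes "1 \<le> p" and cyc: "\<And>\<sigma>. card \<sigma> + 1 = p \<Longrightarrow> koszul c \<sigma> = 0"
  obtains b where "\<And>\<sigma>. card \<sigma> = p \<Longrightarrow> c \<sigma> = koszul b \<sigma>"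
    "\<And>e \<sigma>. (\<And>\<tau>. card \<tau> = p \<Longrightarrow> homogeneous e (c \<tau>)) \<Longrightarrow> card \<sigma> = p + 1
       \<Longrightarrow> homogeneous (e - 1) (b \<sigma>)"
proof
  define ch where "ch \<alpha> = (SOME v. 0 < expo \<alpha> v)" for \<alpha> :: "'v \<Rightarrow>\<^sub>0 nat"
  show "c \<sigma> = koszul (contract ch c) \<sigma>" if \<sigma>: "card \<sigma> = p" for \<sigma>
  proof (rule poly_mapping_eqI)
    fix m
    define \<alpha> where "\<alpha> = m + ind_vec \<sigma>"
    have pos: "\<forall>v\<in>\<sigma>. 0 < expo \<alpha> v" by (simp add: \<alpha>_def lookup_add expo_ind_vec)
    obtain u where "u \<in> \<sigma>" using \<sigma> \<open>1 \<le> p\<close> by fastforce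
    then have "\<exists>v. 0 < expo \<alpha> v" using pos by blast
    then have ch: "0 < expo \<alpha> (ch \<alpha>)" unfolding ch_def by (rule someI_ex)
    have "koszul c (\<sigma> - {ch \<alpha>}) = 0" if "ch \<alpha> \<in> \<sigma>"
      by (rule cyc) (use card_Suc_Diff1[OF finite that] \<sigma> in simp)
    then have "mcomp (koszul c) \<alpha> (\<sigma> - {ch \<alpha>}) = 0" if "ch \<alpha> \<in> \<sigma>"
      using that by (simp add: mcomp_def)
    then have "mcomp (contract ch (koszul c)) \<alpha> \<sigma> = 0"
      by (simp add: mcomp_contract[OF pos])
    then show "coef (c \<sigma>) m = coef (koszul (contract ch c) \<sigma>) m"
      using contract_homotopy[OF pos, of ch c, OF ch] by (simp add: coef_eq_mcomp[of _ \<sigma>] \<alpha>_def)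
  qed
  show "homogeneous (e - 1) (contract ch c \<sigma>)"
    if "\<And>\<tau>. card \<tau> = p \<Longrightarrow> homogeneous e (c \<tau>)" "card \<sigma> = p + 1" for e \<sigma>
    by (rule homogeneous_contract) (use that in auto)
qed

lemma koszul_mem_ideal:
  assumes "is_ideal I" "\<And>\<tau>. card \<tau> = card \<sigma> + 1 \<Longrightarrow> c \<tau> \<in> I"
  shows "koszul c \<sigma> \<in> I"
  unfolding koszul_def
  by (intro ideal.subspace_sum[OF assms(1)] ideal.subspace_scale[OF assms(1)] assms(2)) auto

lemma koszul_singletons: "koszul c {} = (\<Sum>v\<in>UNIV. Var v * c {v})"
  by (simp add: koszul_def)

text \<open>The same homotopy in homological degree 0, applied to the chain with constant value
  \<open>p\<close>. The only fine degree without a variable is 0, where \<open>p\<close> has no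
  term.\<close>

lemma irrelevant_decomp:
  fixes p :: "('v::finite, 'k::field) polys"
  assumes "coef p 0 = 0" "homogeneous d p"
  obtains q where "p = (\<Sum>v\<in>UNIV. Var v * q v)" "\<And>v. homogeneous (d - 1) (q v)"
proof
  define ch where "ch \<alpha> = (SOME v. 0 < expo \<alpha> v)" for \<alpha> :: "'v \<Rightarrow>\<^sub>0 nat"
  define c where "c = (\<lambda>\<sigma> :: 'v set. p)"
  show "p = (\<Sum>v\<in>UNIV. Var v * contract ch c {v})"
  proof (rule poly_mapping_eqI)
    fix m
    have e: "mcomp d m {} = coef (d {}) m" for d :: "'v set \<Rightarrow> ('v, 'k) polys"
      by (simp add: mcomp_def ind_vec_def)
    have "mcomp (koszul (contract ch c)) m {} = coef p m"
    proof (cases "0 < expo m (ch m)")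
      case True
      have "mcomp (contract ch (koszul c)) m {} = 0" by (simp add: mcomp_contract)
      then have "mcomp (koszul (contract ch c)) m {} = mcomp c m {}"
        using contract_homotopy[of "{}" m ch c] True by simp
      then show ?thesis unfolding e[of c] by (simp add: c_def)
    next
      case False
      then have "expo m v = 0" for v unfolding ch_def by (metis not_gr_zero someI)
      then have "m = 0" by (intro monom_eqI) simp
      moreover have "mcomp (koszul (contract ch c)) m {} = 0"
        using False by (simp add: mcomp_koszul mcomp_contract_outside)
      ultimately show ?thesis using assms(1) by simp
    qed
    then have "coef (koszul (contract ch c) {}) m = coef p m" unfolding e .
    then show "coef p m = coef (\<Sum>v\<in>UNIV. Var v * contract ch c {v}) m"
      by (simp add: koszul_singletons)
  qed
  show "homogeneous (d - 1) (contract ch c {v})" for v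
    by (rule homogeneous_contract) (use assms in \<open>simp add: c_def\<close>)
qed

section \<open>Dimension shifting\<close>

text \<open>Elements of a free module of rank \<open>n\<close> are functions on \<open>nat\<close> of which only the first \<open>n\<close> values matter.\<close>

definition mat_app :: "(nat \<Rightarrow> nat \<Rightarrow> ('v::finite, 'k::field) polys) \<Rightarrow> nat \<Rightarrow> (nat \<Rightarrow> ('v, 'k) polys)
    \<Rightarrow> nat \<Rightarrow> ('v, 'k) polys" where
  "mat_app A m f i = (\<Sum>k<m. A i k * f k)"

definition graded_mat :: "int list \<Rightarrow> int list \<Rightarrow> (nat \<Rightarrow> nat \<Rightarrow> ('v::finite, 'k::field) polys) \<Rightarrow> bool" where
  "graded_mat as bs A \<longleftrightarrow> (\<forall>i<length as. \<forall>k<length bs. homogeneous (bs ! k - as ! i) (A i k))"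

definition mat_kernel :: "(nat \<Rightarrow> nat \<Rightarrow> ('v::finite, 'k::field) polys) \<Rightarrow> nat \<Rightarrow> nat
    \<Rightarrow> (nat \<Rightarrow> ('v, 'k) polys) set" where
  "mat_kernel A n m = {f. \<forall>i<n. mat_app A m f i = 0}"

text \<open>For the graded free module \<open>F\<close> with basis degrees \<open>as\<close> and a submodule \<open>Z\<close>, the Koszul homology of \<open>F/Z\<close>
  vanishes in homological degree \<open>p\<close> and internal degree \<open>j\<close>.\<close>

definition koszul_exact :: "int list \<Rightarrow> (nat \<Rightarrow> ('v::finite, 'k::field) polys) set \<Rightarrow> nat \<Rightarrow> int \<Rightarrow> bool" where
  "koszul_exact as Z p j \<longleftrightarrow> (\<forall>C :: nat \<Rightarrow> 'v set \<Rightarrow> ('v, 'k) polys.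
     (\<forall>i<length as. \<forall>\<sigma>. card \<sigma> = p \<longrightarrow> homogeneous (j - as ! i - int p) (C i \<sigma>)) \<longrightarrow>
     (\<forall>\<sigma>. card \<sigma> + 1 = p \<longrightarrow> (\<lambda>i. koszul (C i) \<sigma>) \<in> Z) \<longrightarrow>
     (\<exists>b. \<forall>\<sigma>. card \<sigma> = p \<longrightarrow> (\<lambda>i. C i \<sigma> - koszul (b i) \<sigma>) \<in> Z))"

lemma vanI:
  assumes "\<And>C :: nat \<Rightarrow> 'v set \<Rightarrow> ('v, 'k) polys.
     (\<And>i \<sigma>. i < length as \<Longrightarrow> card \<sigma> = p \<Longrightarrow> homogeneous (j - as ! i - int p) (C i \<sigma>)) \<Longrightarrow>
     (\<And>\<sigma>. card \<sigma> + 1 = p \<Longrightarrow> (\<lambda>i. koszul (C i) \<sigma>) \<in> Z) \<Longrightarrow>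
     \<exists>b. \<forall>\<sigma>. card \<sigma> = p \<longrightarrow> (\<lambda>i. C i \<sigma> - koszul (b i) \<sigma>) \<in> Z"
  shows "koszul_exact as (Z :: (nat \<Rightarrow> ('v::finite, 'k::field) polys) set) p j"
  unfolding koszul_exact_def using assms by blast

lemma vanD:
  fixes Z :: "(nat \<Rightarrow> ('v::finite, 'k::field) polys) set"
  assumes "koszul_exact as Z p j"
    and "\<And>i \<sigma>. i < length as \<Longrightarrow> card \<sigma> = p \<Longrightarrow> homogeneous (j - as ! i - int p) (C i \<sigma>)"
    and "\<And>\<sigma>. card \<sigma> + 1 = p \<Longrightarrow> (\<lambda>i. koszul (C i) \<sigma>) \<in> Z"
  shows "\<exists>b. \<forall>\<sigma>. card \<sigma> = p \<longrightarrow> (\<lambda>i. C i \<sigma> - koszul (b i) \<sigma>) \<in> Z"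
  using assms(1)[unfolded koszul_exact_def, rule_format, of C] assms(2,3) by blast

lemma mat_app_diff: "mat_app A m (\<lambda>k. f k - g k) i = mat_app A m f i - mat_app A m g i"
  by (simp add: mat_app_def right_diff_distrib sum_subtractf)

lemma mat_app_cong: "(\<And>k. k < m \<Longrightarrow> f k = g k) \<Longrightarrow> mat_app A m f i = mat_app A m g i"
  unfolding mat_app_def by (intro sum.cong) auto

lemma koszul_mat_app: "koszul (\<lambda>\<tau>. mat_app A m (\<lambda>k. C k \<tau>) i) \<sigma> = mat_app A m (\<lambda>k. koszul (C k) \<sigma>) i"
  unfolding mat_app_def by (rule koszul_lincomb)

lemma hcomp_mat_app:
  assumes "graded_mat as bs A" "i < length as"
  shows "hcomp (d - as ! i) (mat_app A (length bs) g i) = mat_app A (length bs) (\<lambda>k. hcomp (d - bs ! k) (g k)) i"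
  unfolding mat_app_def hcomp_sum
proof (intro sum.cong)
  fix k assume "k \<in> {..<length bs}"
  then have "homogeneous (bs ! k - as ! i) (A i k)" using assms unfolding graded_mat_def by simp
  from hcomp_mult_homogeneous[OF this, of "d - as ! i" "g k"]
  show "hcomp (d - as ! i) (A i k * g k) = A i k * hcomp (d - bs ! k) (g k)" by simp
qed simp

lemma homogeneous_mat_app:
  assumes "graded_mat as bs A" "i < length as" "\<And>k. k < length bs \<Longrightarrow> homogeneous (d - bs ! k) (f k)"
  shows "homogeneous (d - as ! i) (mat_app A (length bs) f i)"
  unfolding mat_app_def
proof (rule homogeneous_sum)
  fix k assume "k \<in> {..<length bs}"
  then have "homogeneous (bs ! k - as ! i + (d - bs ! k)) (A i k * f k)"
    using assms by (intro homogeneous_mult) (auto simp: graded_mat_def)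
  then show "homogeneous (d - as ! i) (A i k * f k)" by simp
qed

text \<open>\<open>Z\<close> is the image of \<open>A\<close>, that is, the source modulo the
  kernel. In the exact sequence 0 -> Z -> F -> F/Z -> 0 the module F is acyclic, so H_p of Z is
  H_(p+1) of F/Z for positive p. This half is a diagram chase: push a cycle into F, fill it there,
  correct the filling modulo \<open>Z\<close>, and lift what remains through
  \<open>A\<close>.\<close>

lemma koszul_exact_shift_down:
  fixes A :: "nat \<Rightarrow> nat \<Rightarrow> ('v::finite, 'k::field) polys"
  assumes A: "graded_mat as bs A" and p: "1 \<le> p"
    and Z: "\<And>f. f \<in> Z \<longleftrightarrow> (\<exists>g. \<forall>i<length as. f i = mat_app A (length bs) g i)"
    and koszul_exact: "koszul_exact as Z (p + 1) j"
  shows "koszul_exact bs (mat_kernel A (length as) (length bs)) p j"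
proof (rule vanI)
  let ?n = "length as" and ?m = "length bs"
  fix C :: "nat \<Rightarrow> 'v set \<Rightarrow> ('v, 'k) polys"
  assume hom: "\<And>k \<sigma>. k < length bs \<Longrightarrow> card \<sigma> = p \<Longrightarrow> homogeneous (j - bs ! k - int p) (C k \<sigma>)"
    and cyc: "\<And>\<sigma>. card \<sigma> + 1 = p \<Longrightarrow> (\<lambda>k. koszul (C k) \<sigma>) \<in> mat_kernel A ?n ?m"
  define D where "D i \<sigma> = mat_app A ?m (\<lambda>k. C k \<sigma>) i" for i \<sigma>
  have "\<exists>b. (\<forall>\<sigma>. card \<sigma> = p \<longrightarrow> D i \<sigma> = koszul b \<sigma>)
      \<and> (\<forall>\<sigma>. card \<sigma> = p + 1 \<longrightarrow> homogeneous (j - as ! i - int (p + 1)) (b \<sigma>))" if i: "i < ?n" for i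
  proof -
    have "koszul (D i) \<sigma> = 0" if "card \<sigma> + 1 = p" for \<sigma>
      using cyc[OF that] i unfolding D_def koszul_mat_app mat_kernel_def by blast
    then obtain b where b: "\<And>\<sigma>. card \<sigma> = p \<Longrightarrow> D i \<sigma> = koszul b \<sigma>"
      "\<And>e \<sigma>. (\<And>\<tau>. card \<tau> = p \<Longrightarrow> homogeneous e (D i \<tau>)) \<Longrightarrow> card \<sigma> = p + 1
       \<Longrightarrow> homogeneous (e - 1) (b \<sigma>)"
      using koszul_acyclic[OF p, of "D i"] by blast
    have h: "homogeneous (j - int p - as ! i) (D i \<tau>)" if "card \<tau> = p" for \<tau>
      unfolding D_def
      by (rule homogeneous_mat_app[OF A i]) (use hom[OF _ that] in \<open>simp add: algebra_simps\<close>)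
    have "homogeneous (j - as ! i - int (p + 1)) (b \<sigma>)" if "card \<sigma> = p + 1" for \<sigma>
      using b(2)[OF h that] by (simp add: algebra_simps)
    then show ?thesis using b(1) by blast
  qed
  then obtain C' where C': "\<And>i \<sigma>. i < ?n \<Longrightarrow> card \<sigma> = p \<Longrightarrow> D i \<sigma> = koszul (C' i) \<sigma>"
    "\<And>i \<sigma>. i < ?n \<Longrightarrow> card \<sigma> = p + 1 \<Longrightarrow> homogeneous (j - as ! i - int (p + 1)) (C' i \<sigma>)"
    by metis
  have "(\<lambda>i. koszul (C' i) \<sigma>) \<in> Z" if "card \<sigma> + 1 = p + 1" for \<sigma>
    unfolding Z using that C'(1)[of _ \<sigma>] by (intro exI[of _ "\<lambda>k. C k \<sigma>"]) (simp add: D_def)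
  from vanD[OF koszul_exact C'(2) this]
  obtain b where b: "\<And>\<sigma>. card \<sigma> = p + 1 \<Longrightarrow> (\<lambda>i. C' i \<sigma> - koszul (b i) \<sigma>) \<in> Z"
    by blast
  \<comment> \<open>The corrected filling lies in the image of \<open>A\<close>. Its preimages
    \<open>G \<sigma>\<close> form a chain whose boundary agrees with \<open>C\<close> modulo the
    kernel.\<close>
  define G where "G \<sigma> = (SOME g. \<forall>i<?n. C' i \<sigma> - koszul (b i) \<sigma> = mat_app A ?m g i)" for \<sigma>
  have G: "C' i \<sigma> - koszul (b i) \<sigma> = mat_app A ?m (G \<sigma>) i" if "card \<sigma> = p + 1" "i < ?n" for i \<sigma>
    using someI_ex[OF b[OF that(1), unfolded Z]] that(2) unfolding G_def by blast
  show "\<exists>b. \<forall>\<sigma>. card \<sigma> = p \<longrightarrow> (\<lambda>k. C k \<sigma> - koszul (b k) \<sigma>) \<in> mat_kernel A ?n ?m"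
  proof (intro exI[of _ "\<lambda>k \<tau>. G \<tau> k"] allI impI)
    fix \<sigma> :: "'v set" assume \<sigma>: "card \<sigma> = p"
    have "mat_app A ?m (\<lambda>k. C k \<sigma> - koszul (\<lambda>\<tau>. G \<tau> k) \<sigma>) i = 0" if i: "i < ?n" for i
    proof -
      have "mat_app A ?m (\<lambda>k. koszul (\<lambda>\<tau>. G \<tau> k) \<sigma>) i = koszul (\<lambda>\<tau>. mat_app A ?m (G \<tau>) i) \<sigma>"
        using koszul_mat_app[of A ?m "\<lambda>k \<tau>. G \<tau> k" i \<sigma>] by simp
      also have "\<dots> = koszul (\<lambda>\<tau>. C' i \<tau> - koszul (b i) \<tau>) \<sigma>"
        using G[OF _ i] \<sigma> by (intro koszul_cong) simp
      also have "\<dots> = D i \<sigma>" using C'(1)[OF i \<sigma>] by (simp add: koszul_diff koszul_koszul)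
      finally show ?thesis by (simp add: mat_app_diff D_def)
    qed
    then show "(\<lambda>k. C k \<sigma> - koszul (\<lambda>\<tau>. G \<tau> k) \<sigma>) \<in> mat_kernel A ?n ?m" unfolding mat_kernel_def by blast
  qed
qed

text \<open>The other half of the isomorphism: the boundary of a cycle modulo \<open>Z\<close> is
  lifted through \<open>A\<close> and filled there; subtracting the image of that filling leaves a
  true cycle of F, which is a boundary by acyclicity.\<close>

lemma koszul_exact_shift_up:
  fixes A :: "nat \<Rightarrow> nat \<Rightarrow> ('v::finite, 'k::field) polys"
  assumes A: "graded_mat as bs A" and p: "1 \<le> p"
    and Z: "\<And>f. f \<in> Z \<longleftrightarrow> (\<exists>g. \<forall>i<length as. f i = mat_app A (length bs) g i)"
    and koszul_exact: "koszul_exact bs (mat_kernel A (length as) (length bs)) p j"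
  shows "koszul_exact as Z (p + 1) j"
proof (rule vanI)
  let ?n = "length as" and ?m = "length bs"
  fix C :: "nat \<Rightarrow> 'v set \<Rightarrow> ('v, 'k) polys"
  assume hom: "\<And>i \<sigma>. i < ?n \<Longrightarrow> card \<sigma> = p + 1 \<Longrightarrow> homogeneous (j - as ! i - int (p + 1)) (C i \<sigma>)"
    and cyc: "\<And>\<sigma>. card \<sigma> + 1 = p + 1 \<Longrightarrow> (\<lambda>k. koszul (C k) \<sigma>) \<in> Z"
  define G where "G \<sigma> = (SOME g. \<forall>i<?n. koszul (C i) \<sigma> = mat_app A ?m g i)" for \<sigma>
  have G: "koszul (C i) \<sigma> = mat_app A ?m (G \<sigma>) i" if \<sigma>: "card \<sigma> = p" and i: "i < ?n" for i \<sigma>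
  proof -
    have "\<exists>g. \<forall>i<?n. koszul (C i) \<sigma> = mat_app A ?m g i" using cyc[of \<sigma>] \<sigma> unfolding Z by simp
    from someI_ex[OF this] show ?thesis using i unfolding G_def by blast
  qed
  \<comment> \<open>An arbitrary lift need not be homogeneous. Passing to a component is harmless
    because the boundary being lifted is homogeneous and \<open>A\<close> preserves degrees.\<close>
  define u where "u k \<sigma> = hcomp (j - int p - bs ! k) (G \<sigma> k)" for k \<sigma>
  have u: "koszul (C i) \<sigma> = mat_app A ?m (\<lambda>k. u k \<sigma>) i" if \<sigma>: "card \<sigma> = p" and i: "i < ?n" for i \<sigma>
  proof -
    have "homogeneous (j - as ! i - int (p + 1) + 1) (koszul (C i) \<sigma>)"
      by (rule homogeneous_koszul) (use hom[OF i] \<sigma> in simp)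
    then have "homogeneous (j - int p - as ! i) (koszul (C i) \<sigma>)" by (simp add: algebra_simps)
    then have "koszul (C i) \<sigma> = hcomp (j - int p - as ! i) (koszul (C i) \<sigma>)" by (simp add: hcomp_homogeneous)
    also have "\<dots> = mat_app A ?m (\<lambda>k. u k \<sigma>) i"
      unfolding G[OF \<sigma> i] u_def hcomp_mat_app[OF A i] ..
    finally show ?thesis .
  qed
  have cyc_u: "(\<lambda>k. koszul (u k) \<sigma>) \<in> mat_kernel A ?n ?m" if \<sigma>: "card \<sigma> + 1 = p" for \<sigma>
  proof -
    have "mat_app A ?m (\<lambda>k. koszul (u k) \<sigma>) i = 0" if i: "i < ?n" for i
    proof -
      have "mat_app A ?m (\<lambda>k. koszul (u k) \<sigma>) i = koszul (koszul (C i)) \<sigma>"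
        unfolding koszul_mat_app[symmetric] using u[OF _ i] \<sigma> by (intro koszul_cong) simp
      then show ?thesis by (simp add: koszul_koszul)
    qed
    then show ?thesis unfolding mat_kernel_def by blast
  qed
  have hom_u: "homogeneous (j - bs ! k - int p) (u k \<sigma>)" for k \<sigma>
    using homogeneous_hcomp[of "j - int p - bs ! k" "G \<sigma> k"] unfolding u_def by (simp add: algebra_simps)
  obtain b where b: "\<And>\<sigma>. card \<sigma> = p \<Longrightarrow> (\<lambda>k. u k \<sigma> - koszul (b k) \<sigma>) \<in> mat_kernel A ?n ?m"
    using vanD[OF koszul_exact hom_u cyc_u] by blast
  define e where "e i \<tau> = C i \<tau> - mat_app A ?m (\<lambda>k. b k \<tau>) i" for i \<tau>
  have "koszul (e i) \<sigma> = 0" if \<sigma>: "card \<sigma> + 1 = p + 1" and i: "i < ?n" for i \<sigma>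
  proof -
    have "card \<sigma> = p" using \<sigma> by simp
    then have "mat_app A ?m (\<lambda>k. u k \<sigma> - koszul (b k) \<sigma>) i = 0"
      using b[of \<sigma>] i unfolding mat_kernel_def by blast
    then show ?thesis unfolding e_def koszul_diff koszul_mat_app u[OF \<open>card \<sigma> = p\<close> i] mat_app_diff by simp
  qed
  then have "\<exists>b. \<forall>\<sigma>. card \<sigma> = p + 1 \<longrightarrow> e i \<sigma> = koszul b \<sigma>" if "i < ?n" for i
    using koszul_acyclic[of "p + 1" "e i"] that by (metis le_add2)
  then obtain b' where b': "\<And>i \<sigma>. i < ?n \<Longrightarrow> card \<sigma> = p + 1 \<Longrightarrow> e i \<sigma> = koszul (b' i) \<sigma>" by metis
  show "\<exists>b. \<forall>\<sigma>. card \<sigma> = p + 1 \<longrightarrow> (\<lambda>i. C i \<sigma> - koszul (b i) \<sigma>) \<in> Z"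
  proof (intro exI[of _ b'] allI impI)
    fix \<sigma> :: "'v set" assume \<sigma>: "card \<sigma> = p + 1"
    have "C i \<sigma> - koszul (b' i) \<sigma> = mat_app A ?m (\<lambda>k. b k \<sigma>) i" if "i < ?n" for i
      unfolding b'[OF that \<sigma>, symmetric] e_def by simp
    then show "(\<lambda>i. C i \<sigma> - koszul (b' i) \<sigma>) \<in> Z" unfolding Z by blast
  qed
qed

definition row_app :: "(nat \<Rightarrow> ('v::finite, 'k::field) polys) \<Rightarrow> nat \<Rightarrow> (nat \<Rightarrow> ('v, 'k) polys) \<Rightarrow> ('v, 'k) polys" where
  "row_app e n f = (\<Sum>k<n. e k * f k)"

lemma row_app_mat_app: "row_app e n f = mat_app (\<lambda>_. e) n f i"
  by (simp add: row_app_def mat_app_def)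

lemma row_app_diff: "row_app e n (\<lambda>k. f k - g k) = row_app e n f - row_app e n g"
  unfolding row_app_mat_app[of _ _ _ 0] by (rule mat_app_diff)

lemma koszul_row_app: "koszul (\<lambda>\<tau>. row_app e n (\<lambda>k. C k \<tau>)) \<sigma> = row_app e n (\<lambda>k. koszul (C k) \<sigma>)"
  unfolding row_app_mat_app[of _ _ _ 0] by (rule koszul_mat_app)

text \<open>The augmentation identifies F_0 modulo its kernel with S/I, so both have the same Koszul
  homology. Chains are carried back by chosen preimages \<open>G\<close>, which homogeneity of
  \<open>I\<close> allows to be cut down to the right degree.\<close>

lemma koszul_exact_augmentation:
  fixes I :: "('v::finite, 'k::field) polys set"
  assumes I: "is_ideal I" and Ih: "\<And>p d. p \<in> I \<Longrightarrow> hcomp d p \<in> I"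
    and e: "\<And>k. k < length as \<Longrightarrow> homogeneous (as ! k) (e k)"
    and surj: "\<And>p. \<exists>f. p - row_app e (length as) f \<in> I"
  shows "koszul_exact as {f. row_app e (length as) f \<in> I} p j \<longleftrightarrow> koszul_exact [0] {f. f 0 \<in> I} p j"
proof
  let ?n = "length as"
  have gm: "graded_mat [0] as (\<lambda>_. e)" using e by (simp add: graded_mat_def)
  define G where "G q = (SOME f. q - row_app e ?n f \<in> I)" for q
  have G: "q - row_app e ?n (G q) \<in> I" for q unfolding G_def by (rule someI_ex[OF surj])
  {
    assume koszul_exact: "koszul_exact as {f. row_app e (length as) f \<in> I} p j"
    show "koszul_exact [0] {f. f 0 \<in> I} p j"
    proof (rule vanI)
      fix C :: "nat \<Rightarrow> 'v set \<Rightarrow> ('v, 'k) polys"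
      assume hom: "\<And>i \<sigma>. i < length [0 :: int] \<Longrightarrow> card \<sigma> = p \<Longrightarrow> homogeneous (j - [0] ! i - int p) (C i \<sigma>)"
        and cyc: "\<And>\<sigma>. card \<sigma> + 1 = p \<Longrightarrow> (\<lambda>i. koszul (C i) \<sigma>) \<in> {f. f 0 \<in> I}"
      define u where "u k \<sigma> = hcomp (j - int p - as ! k) (G (C 0 \<sigma>) k)" for k \<sigma>
      have u: "C 0 \<sigma> - row_app e ?n (\<lambda>k. u k \<sigma>) \<in> I" if "card \<sigma> = p" for \<sigma>
      proof -
        have "hcomp (j - int p) (C 0 \<sigma> - row_app e ?n (G (C 0 \<sigma>))) \<in> I" by (intro Ih G)
        moreover have "hcomp (j - int p) (C 0 \<sigma>) = C 0 \<sigma>"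
          using hom[of 0 \<sigma>] that by (simp add: hcomp_homogeneous)
        moreover have "hcomp d (p - q) = hcomp d p - hcomp d q" for d and p q :: "('v, 'k) polys"
          by (rule poly_mapping_eqI) (simp add: coef_hcomp lookup_minus)
        moreover have "hcomp (j - int p) (row_app e ?n (G (C 0 \<sigma>))) = row_app e ?n (\<lambda>k. u k \<sigma>)"
          using hcomp_mat_app[OF gm, of 0 "j - int p" "G (C 0 \<sigma>)"] by (simp add: row_app_mat_app[of _ _ _ 0] u_def)
        ultimately show ?thesis by simp
      qed
      have cyc_u: "(\<lambda>k. koszul (u k) \<sigma>) \<in> {f. row_app e ?n f \<in> I}" if "card \<sigma> + 1 = p" for \<sigma>
      proof -
        have "koszul (\<lambda>\<tau>. C 0 \<tau> - row_app e ?n (\<lambda>k. u k \<tau>)) \<sigma> \<in> I"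
          using u that by (intro koszul_mem_ideal[OF I]) simp
        then have "koszul (C 0) \<sigma> - row_app e ?n (\<lambda>k. koszul (u k) \<sigma>) \<in> I"
          unfolding koszul_diff koszul_row_app .
        then have "koszul (C 0) \<sigma> - (koszul (C 0) \<sigma> - row_app e ?n (\<lambda>k. koszul (u k) \<sigma>)) \<in> I"
          by (rule ideal.subspace_diff[OF I, rotated]) (use cyc[OF that] in simp)
        then show ?thesis by simp
      qed
      have hom_u: "homogeneous (j - as ! k - int p) (u k \<sigma>)" for k \<sigma>
        using homogeneous_hcomp[of "j - int p - as ! k" "G (C 0 \<sigma>) k"] unfolding u_def by (simp add: algebra_simps)
      obtain b where b: "\<And>\<sigma>. card \<sigma> = p \<Longrightarrow> (\<lambda>k. u k \<sigma> - koszul (b k) \<sigma>) \<in> {f. row_app e ?n f \<in> I}"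
        using vanD[OF koszul_exact hom_u cyc_u] by blast
      show "\<exists>b. \<forall>\<sigma>. card \<sigma> = p \<longrightarrow> (\<lambda>i. C i \<sigma> - koszul (b i) \<sigma>) \<in> {f. f 0 \<in> I}"
      proof (intro exI[of _ "\<lambda>_ \<tau>. row_app e ?n (\<lambda>k. b k \<tau>)"] allI impI CollectI)
        fix \<sigma> :: "'v set" assume \<sigma>: "card \<sigma> = p"
        have "(C 0 \<sigma> - row_app e ?n (\<lambda>k. u k \<sigma>)) + row_app e ?n (\<lambda>k. u k \<sigma> - koszul (b k) \<sigma>) \<in> I"
          by (rule ideal.subspace_add[OF I u[OF \<sigma>]]) (use b[OF \<sigma>] in simp)
        then show "C 0 \<sigma> - koszul (\<lambda>\<tau>. row_app e ?n (\<lambda>k. b k \<tau>)) \<sigma> \<in> I"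
          by (simp add: row_app_diff koszul_row_app)
      qed
    qed
  next
    assume koszul_exact: "koszul_exact [0] {f. f 0 \<in> I} p j"
    show "koszul_exact as {f. row_app e (length as) f \<in> I} p j"
    proof (rule vanI)
      fix C :: "nat \<Rightarrow> 'v set \<Rightarrow> ('v, 'k) polys"
      assume hom: "\<And>i \<sigma>. i < ?n \<Longrightarrow> card \<sigma> = p \<Longrightarrow> homogeneous (j - as ! i - int p) (C i \<sigma>)"
        and cyc: "\<And>\<sigma>. card \<sigma> + 1 = p \<Longrightarrow> (\<lambda>i. koszul (C i) \<sigma>) \<in> {f. row_app e ?n f \<in> I}"
      define D where "D = (\<lambda>(i::nat) \<sigma>. row_app e ?n (\<lambda>k. C k \<sigma>))"
      have hom_D: "homogeneous (j - [0] ! i - int p) (D i \<sigma>)" if "i < length [0 :: int]" "card \<sigma> = p" for i \<sigma>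
      proof -
        have "homogeneous (j - int p - [0] ! 0) (D i \<sigma>)"
          unfolding D_def row_app_mat_app[of _ _ _ 0]
          by (rule homogeneous_mat_app[OF gm]) (use hom[OF _ that(2)] in \<open>auto simp: algebra_simps\<close>)
        then show ?thesis using that by simp
      qed
      have cyc_D: "(\<lambda>i. koszul (D i) \<sigma>) \<in> {f. f 0 \<in> I}" if "card \<sigma> + 1 = p" for \<sigma>
        using cyc[OF that] unfolding D_def koszul_row_app by simp
      obtain b where b: "\<And>\<sigma>. card \<sigma> = p \<Longrightarrow> (\<lambda>i. D i \<sigma> - koszul (b i) \<sigma>) \<in> {f. f 0 \<in> I}"
        using vanD[OF koszul_exact hom_D cyc_D] by blast
      show "\<exists>b. \<forall>\<sigma>. card \<sigma> = p \<longrightarrow> (\<lambda>i. C i \<sigma> - koszul (b i) \<sigma>) \<in> {f. row_app e ?n f \<in> I}"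
      proof (intro exI[of _ "\<lambda>k \<tau>. G (b 0 \<tau>) k"] allI impI CollectI)
        fix \<sigma> :: "'v set" assume \<sigma>: "card \<sigma> = p"
        have "koszul (\<lambda>\<tau>. b 0 \<tau> - row_app e ?n (\<lambda>k. G (b 0 \<tau>) k)) \<sigma> \<in> I"
          by (rule koszul_mem_ideal[OF I]) (rule G)
        then have "koszul (b 0) \<sigma> - row_app e ?n (\<lambda>k. koszul (\<lambda>\<tau>. G (b 0 \<tau>) k) \<sigma>) \<in> I"
          unfolding koszul_diff koszul_row_app .
        moreover have "row_app e ?n (\<lambda>k. C k \<sigma>) - koszul (b 0) \<sigma> \<in> I" using b[OF \<sigma>] unfolding D_def by simp
        ultimately have "(row_app e ?n (\<lambda>k. C k \<sigma>) - koszul (b 0) \<sigma>)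
            + (koszul (b 0) \<sigma> - row_app e ?n (\<lambda>k. koszul (\<lambda>\<tau>. G (b 0 \<tau>) k) \<sigma>)) \<in> I"
          by (rule ideal.subspace_add[OF I, rotated])
        then show "row_app e ?n (\<lambda>k. C k \<sigma> - koszul (\<lambda>\<tau>. G (b 0 \<tau>) k) \<sigma>) \<in> I"
          by (simp add: row_app_diff)
      qed
    qed
  }
qed

text \<open>The last clause makes membership independent of the values at indices from
  \<open>n\<close> on, which carry no meaning for a module of rank \<open>n\<close>.\<close>

definition submod :: "nat \<Rightarrow> (nat \<Rightarrow> ('v::finite, 'k::field) polys) set \<Rightarrow> bool" where
  "submod n Z \<longleftrightarrow> (\<lambda>_. 0) \<in> Z \<and> (\<forall>f\<in>Z. \<forall>g\<in>Z. (\<lambda>k. f k + g k) \<in> Z) \<and>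
     (\<forall>p. \<forall>f\<in>Z. (\<lambda>k. p * f k) \<in> Z) \<and> (\<forall>f\<in>Z. \<forall>g. (\<forall>k<n. f k = g k) \<longrightarrow> g \<in> Z)"

lemma submod_zero: "submod n Z \<Longrightarrow> (\<lambda>_. 0) \<in> Z"
  and submod_add: "submod n Z \<Longrightarrow> f \<in> Z \<Longrightarrow> g \<in> Z \<Longrightarrow> (\<lambda>k. f k + g k) \<in> Z"
  and submod_scale: "submod n Z \<Longrightarrow> f \<in> Z \<Longrightarrow> (\<lambda>k. p * f k) \<in> Z"
  by (simp_all add: submod_def)

lemma submod_cong: "submod n Z \<Longrightarrow> f \<in> Z \<Longrightarrow> (\<And>k. k < n \<Longrightarrow> f k = g k) \<Longrightarrow> g \<in> Z"
  unfolding submod_def by (elim conjE) (metis (no_types, lifting))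

lemma submod_sum:
  assumes "submod n Z" "\<And>i. i \<in> J \<Longrightarrow> f i \<in> Z"
  shows "(\<lambda>k. \<Sum>i\<in>J. f i k) \<in> Z"
  using assms(2)
proof (induction J rule: infinite_finite_induct)
  case (insert x F)
  have "(\<lambda>k. f x k + (\<Sum>i\<in>F. f i k)) \<in> Z"
    by (intro submod_add[OF assms(1)] insert) auto
  then show ?case using insert.hyps by simp
qed (simp_all add: submod_zero[OF assms(1)])

definition max_ideal_mult :: "nat \<Rightarrow> (nat \<Rightarrow> ('v::finite, 'k::field) polys) set \<Rightarrow> (nat \<Rightarrow> ('v, 'k) polys) set" where
  "max_ideal_mult n Z = {z. \<exists>g. (\<forall>v. g v \<in> Z) \<and> (\<forall>k<n. z k = (\<Sum>v\<in>UNIV. Var v * g v k))}"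

text \<open>With m the graded maximal ideal, H_1 of F/Z is the intersection of Z and mF modulo mZ,
  and \<open>Zm\<close> places Z inside mF. Vanishing in degree \<open>j\<close> therefore says that
  Z has no minimal generator of degree \<open>j\<close>. This connects Koszul homology with finite
  generation as well as with Betti numbers.\<close>

lemma koszul_exact_1_iff:
  fixes Z :: "(nat \<Rightarrow> ('v::finite, 'k::field) polys) set"
  assumes Z: "submod (length as) Z" and Zm: "\<forall>z\<in>Z. \<forall>k<length as. coef (z k) 0 = 0"
  shows "koszul_exact as Z 1 j \<longleftrightarrow> (\<forall>z\<in>Z. (\<forall>k<length as. homogeneous (j - as ! k) (z k)) \<longrightarrow> z \<in> max_ideal_mult (length as) Z)"
proof (intro iffI ballI impI)
  fix z assume koszul_exact: "koszul_exact as Z 1 j" and z: "z \<in> Z" and hom: "\<forall>k<length as. homogeneous (j - as ! k) (z k)"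
  have "\<exists>q. z k = (\<Sum>v\<in>UNIV. Var v * q v) \<and> (\<forall>v. homogeneous (j - as ! k - 1) (q v))" if "k < length as" for k
    using irrelevant_decomp[OF Zm[rule_format, OF z that]] hom that by metis
  then obtain q where q: "\<And>k. k < length as \<Longrightarrow> z k = (\<Sum>v\<in>UNIV. Var v * q k v)"
    "\<And>k v. k < length as \<Longrightarrow> homogeneous (j - as ! k - 1) (q k v)" by metis
  \<comment> \<open>Only the values on singletons matter, where \<open>the_elem\<close> returns the
    variable.\<close>
  define C where "C k \<sigma> = q k (the_elem \<sigma>)" for k and \<sigma> :: "'v set"
  have kC: "koszul (C k) {} = z k" if "k < length as" for k
    unfolding koszul_singletons C_def using q(1)[OF that] by simp
  have hom_C: "homogeneous (j - as ! k - int 1) (C k \<sigma>)" if "k < length as" for k and \<sigma> :: "'v set"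
    unfolding C_def using q(2)[OF that] by simp
  have cyc_C: "(\<lambda>k. koszul (C k) \<sigma>) \<in> Z" if "card \<sigma> + 1 = 1" for \<sigma>
  proof -
    have "z k = koszul (C k) \<sigma>" if "k < length as" for k using kC[OF that] \<open>card \<sigma> + 1 = 1\<close> by simp
    then show ?thesis by (rule submod_cong[OF Z z])
  qed
  obtain b where b: "\<And>\<sigma>. card \<sigma> = 1 \<Longrightarrow> (\<lambda>k. C k \<sigma> - koszul (b k) \<sigma>) \<in> Z"
    using vanD[OF koszul_exact hom_C cyc_C] by blast
  \<comment> \<open>Subtracting \<open>koszul (b k)\<close> leaves the boundary \<open>z\<close>
    unchanged but moves its coefficients into \<open>Z\<close>.\<close>
  have "z k = (\<Sum>v\<in>UNIV. Var v * (C k {v} - koszul (b k) {v}))" if "k < length as" for k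
  proof -
    have "(\<Sum>v\<in>UNIV. Var v * (C k {v} - koszul (b k) {v})) = koszul (\<lambda>\<sigma>. C k \<sigma> - koszul (b k) \<sigma>) {}"
      unfolding koszul_singletons ..
    also have "\<dots> = z k" unfolding koszul_diff koszul_koszul kC[OF that] by simp
    finally show ?thesis ..
  qed
  then show "z \<in> max_ideal_mult (length as) Z"
    unfolding max_ideal_mult_def using b by (intro CollectI exI[of _ "\<lambda>v k. C k {v} - koszul (b k) {v}"]) auto
next
  assume H: "\<forall>z\<in>Z. (\<forall>k<length as. homogeneous (j - as ! k) (z k)) \<longrightarrow> z \<in> max_ideal_mult (length as) Z"
  show "koszul_exact as Z 1 j"
  proof (rule vanI)
    fix C :: "nat \<Rightarrow> 'v set \<Rightarrow> ('v, 'k) polys"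
    assume hom: "\<And>i \<sigma>. i < length as \<Longrightarrow> card \<sigma> = 1 \<Longrightarrow> homogeneous (j - as ! i - int 1) (C i \<sigma>)"
      and cyc: "\<And>\<sigma>. card \<sigma> + 1 = 1 \<Longrightarrow> (\<lambda>i. koszul (C i) \<sigma>) \<in> Z"
    have hz: "homogeneous (j - as ! k) (koszul (C k) {})" if "k < length as" for k
      using homogeneous_koszul[of "{}" "j - as ! k - 1" "C k"] hom[OF that] by simp
    have "(\<lambda>k. koszul (C k) {}) \<in> Z" using cyc[of "{}"] by simp
    then have "(\<lambda>k. koszul (C k) {}) \<in> max_ideal_mult (length as) Z"
      by (rule H[rule_format]) (rule hz)
    then obtain g where g: "\<And>v. g v \<in> Z" "\<And>k. k < length as \<Longrightarrow> koszul (C k) {} = (\<Sum>v\<in>UNIV. Var v * g v k)"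
      unfolding max_ideal_mult_def by blast
    define D where "D k \<sigma> = C k \<sigma> - g (the_elem \<sigma>) k" for k \<sigma>
    have D0: "koszul (D k) \<sigma> = 0" if "card \<sigma> + 1 = 1" "k < length as" for k \<sigma>
    proof -
      have "\<sigma> = {}" using that(1) by simp
      moreover have "koszul (D k) {} = 0"
        unfolding D_def koszul_diff g(2)[OF that(2)] koszul_singletons[of "\<lambda>\<sigma>. g (the_elem \<sigma>) k"] by simp
      ultimately show ?thesis by simp
    qed
    have "\<exists>b. \<forall>\<sigma>. card \<sigma> = 1 \<longrightarrow> D k \<sigma> = koszul b \<sigma>" if "k < length as" for k
      by (rule koszul_acyclic[OF le_refl D0[OF _ that]]) auto
    then obtain b where b: "\<And>k \<sigma>. k < length as \<Longrightarrow> card \<sigma> = 1 \<Longrightarrow> D k \<sigma> = koszul (b k) \<sigma>" by metis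
    show "\<exists>b. \<forall>\<sigma>. card \<sigma> = 1 \<longrightarrow> (\<lambda>i. C i \<sigma> - koszul (b i) \<sigma>) \<in> Z"
    proof (intro exI[of _ b] allI impI)
      fix \<sigma> :: "'v set" assume \<sigma>: "card \<sigma> = 1"
      have "g (the_elem \<sigma>) k = C k \<sigma> - koszul (b k) \<sigma>" if "k < length as" for k
        unfolding b[OF that \<sigma>, symmetric] D_def by simp
      then show "(\<lambda>i. C i \<sigma> - koszul (b i) \<sigma>) \<in> Z"
        by (rule submod_cong[OF Z g(1)])
    qed
  qed
qed

section \<open>Existence of minimal resolutions\<close>

text \<open>As a rewrite rule it reassociates products to the left and loops with \<open>mult.assoc\<close>.\<close>

declare ideal.scale_scale [simp del]

definition graded_sub :: "int list \<Rightarrow> (nat \<Rightarrow> ('v::finite, 'k::field) polys) set \<Rightarrow> bool" where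
  "graded_sub as Z \<longleftrightarrow> (\<forall>f\<in>Z. \<forall>d. (\<lambda>k. hcomp (d - as ! k) (f k)) \<in> Z)"

text \<open>Values at the meaningless indices are fixed to 0; with free values there the space would
  not be finite-dimensional over the field.\<close>

definition graded_part :: "int list \<Rightarrow> (nat \<Rightarrow> ('v::finite, 'k::field) polys) set \<Rightarrow> int \<Rightarrow> (nat \<Rightarrow> ('v, 'k) polys) set" where
  "graded_part as Z j = {z \<in> Z. (\<forall>k<length as. homogeneous (j - as ! k) (z k)) \<and> (\<forall>k. length as \<le> k \<longrightarrow> z k = 0)}"

lemma finite_monomials: "finite {m :: 'v::finite \<Rightarrow>\<^sub>0 nat. int (mon_degree m) = d}"
proof (rule finite_imageD)
  have "expo m v \<le> nat d" if "int (mon_degree m) = d" for m :: "'v \<Rightarrow>\<^sub>0 nat" and v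
  proof -
    have "expo m v \<le> deg_on UNIV m" unfolding deg_on_def by (rule member_le_sum) auto
    then show ?thesis using that by (simp add: mon_degree_eq_deg_on flip: of_nat_le_iff)
  qed
  then have "expo ` {m :: 'v \<Rightarrow>\<^sub>0 nat. int (mon_degree m) = d} \<subseteq> UNIV \<rightarrow>\<^sub>E {..nat d}" by auto
  then show "finite (expo ` {m :: 'v \<Rightarrow>\<^sub>0 nat. int (mon_degree m) = d})"
    by (rule finite_subset) (simp add: finite_PiE)
  show "inj_on expo {m :: 'v \<Rightarrow>\<^sub>0 nat. int (mon_degree m) = d}"
    by (rule inj_onI, rule poly_mapping_eqI) simp
qed

text \<open>The coefficient field acts through constant polynomials. This gives access to bases and
  to the bound on the size of independent sets.\<close>

interpretation vs: vector_space "\<lambda>c (f :: nat \<Rightarrow> ('v, 'k::field) polys) k. Poly_Mapping.single 0 c * f k"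
proof
  fix a b :: 'k and x y :: "nat \<Rightarrow> ('v, 'k) polys"
  show "(\<lambda>k. Poly_Mapping.single 0 a * (x + y) k) = (\<lambda>k. Poly_Mapping.single 0 a * x k) + (\<lambda>k. Poly_Mapping.single 0 a * y k)"
    by (simp add: fun_eq_iff distrib_left)
  show "(\<lambda>k. Poly_Mapping.single 0 (a + b) * x k) = (\<lambda>k. Poly_Mapping.single 0 a * x k) + (\<lambda>k. Poly_Mapping.single 0 b * x k)"
    by (simp add: fun_eq_iff single_add distrib_right)
  show "(\<lambda>k. Poly_Mapping.single 0 a * (Poly_Mapping.single 0 b * x k)) = (\<lambda>k. Poly_Mapping.single 0 (a * b) * x k)"
    by (simp add: mult_single flip: mult.assoc)
  show "(\<lambda>k. Poly_Mapping.single 0 1 * x k) = x" by simp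
qed

declare vs.scale_scale [simp del]

lemma sum_apply: "(\<Sum>x\<in>A. f x) k = (\<Sum>x\<in>A. f x k :: 'a::comm_monoid_add)"
  by (induction A rule: infinite_finite_induct) auto

text \<open>The part lies in the span of finitely many vectors with a single monomial entry, so a
  maximal independent subset of it is finite. Unlike the monomial vectors, that subset consists of
  elements of the part itself.\<close>

lemma graded_part_finite_span:
  fixes Z :: "(nat \<Rightarrow> ('v::finite, 'k::field) polys) set"
  shows "\<exists>G. finite G \<and> G \<subseteq> graded_part as Z j \<and>
    (\<forall>z\<in>graded_part as Z j. \<exists>c. \<forall>k. z k = (\<Sum>g\<in>G. Poly_Mapping.single 0 (c g) * g k))"
proof -
  define T where "T = (\<Union>k<length as. (\<lambda>m i. if i = k then mono_of m else (0 :: ('v, 'k) polys)) ` {m. int (mon_degree m) = j - as ! k})"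
  have T: "finite T" unfolding T_def by (simp add: finite_monomials)
  have "graded_part as Z j \<subseteq> vs.span T"
  proof
    fix z assume z: "z \<in> graded_part as Z j"
    define y where "y k m = (\<lambda>i. Poly_Mapping.single 0 (coef (z k) m) * (if i = k then mono_of m else 0))" for k m
    have "(\<Sum>k<length as. \<Sum>m\<in>Poly_Mapping.keys (z k). y k m) \<in> vs.span T"
    proof (intro vs.span_sum)
      fix k m assume k: "k \<in> {..<length as}" "m \<in> Poly_Mapping.keys (z k)"
      then have "homogeneous (j - as ! k) (z k)" using z unfolding graded_part_def by simp
      then have "int (mon_degree m) = j - as ! k" using k unfolding homogeneous_def by simp
      then have "(\<lambda>i. if i = k then mono_of m else 0) \<in> T" using k unfolding T_def by blast
      then show "y k m \<in> vs.span T" unfolding y_def by (intro vs.span_scale vs.span_base)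
    qed
    moreover have "z = (\<Sum>k<length as. \<Sum>m\<in>Poly_Mapping.keys (z k). y k m)"
    proof
      fix i
      have "(\<Sum>k<length as. \<Sum>m\<in>Poly_Mapping.keys (z k). y k m) i
        = (\<Sum>k<length as. if k = i then z i else 0)"
        unfolding sum_apply
      proof (rule sum.cong)
        fix k
        have "(\<Sum>m\<in>Poly_Mapping.keys (z k). y k m i)
            = (if k = i then (\<Sum>m\<in>Poly_Mapping.keys (z i). Poly_Mapping.single m (coef (z i) m)) else 0)"
          by (simp add: y_def mult_single)
        then show "(\<Sum>m\<in>Poly_Mapping.keys (z k). y k m i) = (if k = i then z i else 0)"
          unfolding poly_sum_singles[symmetric] .
      qed simp
      also have "\<dots> = z i" using z by (auto simp: graded_part_def)
      finally show "z i = (\<Sum>k<length as. \<Sum>m\<in>Poly_Mapping.keys (z k). y k m) i" ..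
    qed
    ultimately show "z \<in> vs.span T" by simp
  qed
  moreover obtain G where G: "G \<subseteq> graded_part as Z j" "vs.independent G" "graded_part as Z j \<subseteq> vs.span G"
    using vs.maximal_independent_subset by blast
  ultimately have "finite G" using vs.independent_span_bound[OF T, of G] by blast
  moreover have "\<exists>c. \<forall>k. z k = (\<Sum>g\<in>G. Poly_Mapping.single 0 (c g) * g k)" if "z \<in> graded_part as Z j" for z
  proof -
    have "z \<in> range (\<lambda>u. \<Sum>v\<in>G. (\<lambda>k. Poly_Mapping.single 0 (u v) * v k))"
      using G(3) that vs.span_finite[OF \<open>finite G\<close>] by blast
    then show ?thesis by (auto simp: sum_apply)
  qed
  ultimately show ?thesis using G(1) by (intro exI[of _ G]) simp
qed

text \<open>Each generator is stored with its degree, since the vector alone need not determine it: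
  the zero vector is homogeneous of every degree.\<close>

definition gen_by :: "nat \<Rightarrow> (int \<times> (nat \<Rightarrow> ('v::finite, 'k::field) polys)) set \<Rightarrow> (nat \<Rightarrow> ('v, 'k) polys) \<Rightarrow> bool" where
  "gen_by n G z \<longleftrightarrow> (\<exists>c. \<forall>k<n. z k = (\<Sum>x\<in>G. c x * snd x k))"

lemma gen_by_sum:
  assumes "\<And>i. i \<in> J \<Longrightarrow> gen_by n G (f i)" "\<And>k. k < n \<Longrightarrow> z k = (\<Sum>i\<in>J. a i * f i k)"
  shows "gen_by n G z"
proof -
  have "\<forall>i. \<exists>c. i \<in> J \<longrightarrow> (\<forall>k<n. f i k = (\<Sum>x\<in>G. c x * snd x k))"
    using assms(1) unfolding gen_by_def by blast
  from choice[OF this]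
  obtain c where c: "\<And>i k. i \<in> J \<Longrightarrow> k < n \<Longrightarrow> f i k = (\<Sum>x\<in>G. c i x * snd x k)"
    by blast
  have "z k = (\<Sum>x\<in>G. (\<Sum>i\<in>J. a i * c i x) * snd x k)" if k: "k < n" for k
  proof -
    have "z k = (\<Sum>i\<in>J. \<Sum>x\<in>G. a i * c i x * snd x k)"
      unfolding assms(2)[OF k] using c[OF _ k] by (simp add: sum_distrib_left mult.assoc)
    also have "\<dots> = (\<Sum>x\<in>G. \<Sum>i\<in>J. a i * c i x * snd x k)" by (rule sum.swap)
    finally show ?thesis by (simp add: sum_distrib_right)
  qed
  then show ?thesis unfolding gen_by_def by (intro exI[of _ "\<lambda>x. \<Sum>i\<in>J. a i * c i x"]) simp
qed

lemma graded_part_proj: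
  fixes Z :: "(nat \<Rightarrow> ('v::finite, 'k::field) polys) set"
  assumes "submod (length as) Z" "graded_sub as Z" "f \<in> Z"
  shows "(\<lambda>k. if k < length as then hcomp (d - as ! k) (f k) else 0) \<in> graded_part as Z d"
proof -
  have "(\<lambda>k. hcomp (d - as ! k) (f k)) \<in> Z" using assms unfolding graded_sub_def by blast
  from submod_cong[OF assms(1) this] show ?thesis
    unfolding graded_part_def by (auto simp: homogeneous_hcomp)
qed

text \<open>Graded Nakayama: in degrees above \<open>B\<close> the module is contained in its product with the maximal ideal.\<close>

lemma generated_by_bounded_degrees:
  fixes Z :: "(nat \<Rightarrow> ('v::finite, 'k::field) polys) set"
  assumes Z: "submod (length as) Z" and h: "graded_sub as Z"
    and Zm: "\<forall>z\<in>Z. \<forall>k<length as. coef (z k) 0 = 0"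
    and koszul_exact: "\<And>j. B < j \<Longrightarrow> koszul_exact as Z 1 j"
  obtains G where "finite G" "\<And>x. x \<in> G \<Longrightarrow> snd x \<in> graded_part as Z (fst x)" "\<And>z. z \<in> Z \<Longrightarrow> gen_by (length as) G z"
proof -
  let ?n = "length as"
  have "\<forall>j. \<exists>G. finite G \<and> G \<subseteq> graded_part as Z j \<and>
      (\<forall>z\<in>graded_part as Z j. \<exists>c. \<forall>k. z k = (\<Sum>g\<in>G. Poly_Mapping.single 0 (c g) * g k))"
    by (rule allI, rule graded_part_finite_span)
  from choice[OF this] obtain g where g': "\<forall>j. finite (g j) \<and> g j \<subseteq> graded_part as Z j \<and>
      (\<forall>z\<in>graded_part as Z j. \<exists>c. \<forall>k. z k = (\<Sum>g\<in>g j. Poly_Mapping.single 0 (c g) * g k))" ..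
  have g: "finite (g j)" "g j \<subseteq> graded_part as Z j"
    "z \<in> graded_part as Z j \<Longrightarrow> \<exists>c. \<forall>k. z k = (\<Sum>x\<in>g j. Poly_Mapping.single 0 (c x) * x k)" for j z
    using g'[rule_format, of j] by simp_all
  \<comment> \<open>Below the least basis degree a graded part vanishes, so only the finitely many
    degrees from \<open>L\<close> to \<open>B\<close> contribute generators.\<close>
  define L where "L = (if as = [] then 0 else Min (set as))"
  have L: "L \<le> as ! k" if "k < ?n" for k
    using that unfolding L_def by auto
  define G where "G = (\<Union>j\<in>{L..B}. Pair j ` g j)"
  have G: "finite G" unfolding G_def using g(1) by simp
  have G': "snd x \<in> graded_part as Z (fst x)" if "x \<in> G" for x
    using that subsetD[OF g(2)] unfolding G_def by auto
  have zero: "gen_by ?n G z" if "\<And>k. k < ?n \<Longrightarrow> z k = 0" for z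
    unfolding gen_by_def using that by (intro exI[of _ "\<lambda>_. 0"]) simp
  have low: "gen_by ?n G z" if "z \<in> graded_part as Z j" "j < L" for z j
  proof (rule zero)
    fix k assume k: "k < ?n"
    then have "homogeneous (j - as ! k) (z k)" using that unfolding graded_part_def by blast
    moreover have "j - as ! k < 0" using L[OF k] that by simp
    ultimately have "coef (z k) m = 0" for m unfolding homogeneous_iff by (metis of_nat_less_0_iff)
    then show "z k = 0" by (intro poly_mapping_eqI) simp
  qed
  have mid: "gen_by ?n G z" if z: "z \<in> graded_part as Z j" and j: "L \<le> j" "j \<le> B" for z j
  proof -
    obtain c where c: "\<And>k. z k = (\<Sum>x\<in>g j. Poly_Mapping.single 0 (c x) * x k)" using g(3)[OF z] by blast
    have sub: "Pair j ` g j \<subseteq> G" using j unfolding G_def by auto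
    have "z k = (\<Sum>x\<in>G. (if x \<in> Pair j ` g j then Poly_Mapping.single 0 (c (snd x)) else 0) * snd x k)" for k
    proof -
      have "z k = (\<Sum>x\<in>Pair j ` g j. Poly_Mapping.single 0 (c (snd x)) * snd x k)"
        unfolding c by (subst sum.reindex) (auto simp: inj_on_def)
      also have "\<dots> = (\<Sum>x\<in>G. (if x \<in> Pair j ` g j then Poly_Mapping.single 0 (c (snd x)) else 0) * snd x k)"
        by (rule sum.mono_neutral_cong_left[OF G sub]) auto
      finally show ?thesis .
    qed
    then have "\<forall>k<?n. z k = (\<Sum>x\<in>G. (if x \<in> Pair j ` g j then Poly_Mapping.single 0 (c (snd x)) else 0) * snd x k)"
      by (intro allI impI)
    then show ?thesis unfolding gen_by_def
      by (rule exI[where x = "\<lambda>x. if x \<in> Pair j ` g j then Poly_Mapping.single 0 (c (snd x)) else 0"])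
  qed
  have all: "gen_by ?n G z" if "z \<in> graded_part as Z j" "nat (j - L) = i" for z j i
    using that
  proof (induction i arbitrary: z j rule: less_induct)
    case (less i)
    consider "j < L" | "L \<le> j" "j \<le> B" | "L \<le> j" "B < j" by linarith
    then show ?case
    proof cases
      case 3
      have "z \<in> max_ideal_mult ?n Z"
        using koszul_exact_1_iff[OF Z Zm] koszul_exact[OF 3(2)] less.prems(1) unfolding graded_part_def by blast
      then obtain y where y: "\<And>v. y v \<in> Z" "\<And>k. k < ?n \<Longrightarrow> z k = (\<Sum>v\<in>UNIV. Var v * y v k)"
        unfolding max_ideal_mult_def by blast
      define u where "u v k = (if k < ?n then hcomp (j - 1 - as ! k) (y v k) else 0)" for v k
      have u: "u v \<in> graded_part as Z (j - 1)" for v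
        using graded_part_proj[OF Z h y(1)[of v], of "j - 1"] unfolding u_def .
      have uz: "z k = (\<Sum>v\<in>UNIV. Var v * u v k)" if k: "k < ?n" for k
      proof -
        have "homogeneous (j - as ! k) (z k)" using less.prems(1) k unfolding graded_part_def by blast
        then have "z k = hcomp (j - as ! k) (z k)" by (simp add: hcomp_homogeneous)
        also have "\<dots> = (\<Sum>v\<in>UNIV. Var v * hcomp (j - as ! k - 1) (y v k))"
          unfolding y(2)[OF k] hcomp_sum by (simp add: hcomp_mult_homogeneous[OF homogeneous_Var])
        also have "j - as ! k - 1 = j - 1 - as ! k" by simp
        finally show ?thesis using k by (simp add: u_def)
      qed
      \<comment> \<open>For \<open>j = L\<close> the truncated measure does not decrease, but then
        degree \<open>j - 1\<close> lies below \<open>L\<close>.\<close>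
      have "gen_by ?n G (u v)" for v
      proof (cases "j = L")
        case True
        then show ?thesis using low[OF u[of v]] by simp
      next
        case False
        then have "nat (j - 1 - L) < i" using less.prems 3 by simp
        then show ?thesis using less.IH[OF _ u refl] by blast
      qed
      then show ?thesis using uz by (rule gen_by_sum)
    qed (use less.prems low mid in blast)+
  qed
  have "gen_by ?n G z" if z: "z \<in> Z" for z
  proof -
    define D where "D = (\<Union>k<?n. (\<lambda>m. int (mon_degree m) + as ! k) ` Poly_Mapping.keys (z k))"
    have D: "finite D" unfolding D_def by simp
    have dec: "z k = (\<Sum>d\<in>D. 1 * (if k < ?n then hcomp (d - as ! k) (z k) else 0))" if k: "k < ?n" for k
    proof (rule poly_mapping_eqI)
      fix m
      have "coef (\<Sum>d\<in>D. 1 * (if k < ?n then hcomp (d - as ! k) (z k) else 0)) m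
        = (\<Sum>d\<in>D. if d = int (mon_degree m) + as ! k then coef (z k) m else 0)"
        unfolding coef_sum using k by (intro sum.cong) (auto simp: coef_hcomp)
      also have "\<dots> = (if int (mon_degree m) + as ! k \<in> D then coef (z k) m else 0)"
        using D by simp
      also have "\<dots> = coef (z k) m"
        using k unfolding D_def by (force simp: in_keys_iff)
      finally show "coef (z k) m = coef (\<Sum>d\<in>D. 1 * (if k < ?n then hcomp (d - as ! k) (z k) else 0)) m" ..
    qed
    show ?thesis
      by (rule gen_by_sum[OF _ dec], rule all[OF graded_part_proj[OF Z h z] refl])
  qed
  then show ?thesis using that[OF G G'] by blast
qed

lemma submod_mat_kernel: "submod m (mat_kernel A n m)"
proof -
  have "mat_app A m (\<lambda>k. f k + g k) i = mat_app A m f i + mat_app A m g i" for f g i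
    by (simp add: mat_app_def distrib_left sum.distrib)
  moreover have "mat_app A m (\<lambda>k. p * f k) i = p * mat_app A m f i" for p f i
    by (simp only: mat_app_def sum_distrib_left mult.left_commute)
  moreover have "mat_app A m (\<lambda>k. 0) i = 0" for i by (simp add: mat_app_def)
  moreover have "mat_app A m f i = mat_app A m g i" if "\<forall>k<m. f k = g k" for f g i
    using that by (intro mat_app_cong) simp
  ultimately show ?thesis unfolding submod_def mat_kernel_def by simp metis
qed

lemma graded_sub_mat_kernel: "graded_mat as bs A \<Longrightarrow> graded_sub bs (mat_kernel A (length as) (length bs))"
  unfolding graded_sub_def mat_kernel_def by (simp flip: hcomp_mat_app)

text \<open>Generators of least number are minimal: a relation with a nonzero constant coefficient would make one of
  them redundant.\<close>

lemma minimal_cover: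
  fixes Z :: "(nat \<Rightarrow> ('v::finite, 'k::field) polys) set"
  assumes Z: "submod (length as) Z" and h: "graded_sub as Z"
    and Zm: "\<forall>z\<in>Z. \<forall>k<length as. coef (z k) 0 = 0"
    and koszul_exact: "\<And>j. B < j \<Longrightarrow> koszul_exact as Z 1 j"
  obtains bs A where "graded_mat as bs A"
    "\<And>f. f \<in> Z \<longleftrightarrow> (\<exists>g. \<forall>i<length as. f i = mat_app A (length bs) g i)"
    "\<forall>f\<in>mat_kernel A (length as) (length bs). \<forall>k<length bs. coef (f k) 0 = 0"
proof -
  let ?n = "length as"
  define P where "P G \<longleftrightarrow> finite G \<and> (\<forall>x\<in>G. snd x \<in> graded_part as Z (fst x)) \<and> (\<forall>z\<in>Z. gen_by ?n G z)" for G
  have "\<exists>G. P G"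
    unfolding P_def by (rule generated_by_bounded_degrees[OF Z h, of B]) (use Zm koszul_exact in blast)+
  then obtain G0 where "P G0" ..
  then obtain G where G: "P G" and min: "\<And>G'. P G' \<Longrightarrow> card G \<le> card G'"
    using arg_min_natI[of P G0 card] arg_min_nat_le[of P _ card] by metis
  have fin: "finite G" and GZ: "\<And>x. x \<in> G \<Longrightarrow> snd x \<in> graded_part as Z (fst x)"
    and gen: "\<And>z. z \<in> Z \<Longrightarrow> gen_by ?n G z" using G unfolding P_def by blast+
  obtain xs where xs: "set xs = G" "distinct xs" using finite_distinct_list[OF fin] by blast
  define bs where "bs = map fst xs"
  define A where "A i k = snd (xs ! k) i" for i k
  have bij: "bij_betw ((!) xs) {..<length bs} G"
    unfolding bs_def length_map using bij_betw_nth[OF xs(2) refl xs(1)[symmetric]] .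
  have mat_app: "mat_app A (length bs) g i = (\<Sum>k<length bs. g k * snd (xs ! k) i)" for g i
    unfolding mat_app_def A_def by (simp add: mult.commute)
  have gm: "graded_mat as bs A"
    unfolding graded_mat_def
  proof (intro allI impI)
    fix i k assume "i < ?n" "k < length bs"
    then show "homogeneous (bs ! k - as ! i) (A i k)"
      using GZ[of "xs ! k"] xs(1) unfolding graded_part_def A_def bs_def by auto
  qed
  have img: "f \<in> Z \<longleftrightarrow> (\<exists>g. \<forall>i<?n. f i = mat_app A (length bs) g i)" for f
  proof
    assume "f \<in> Z"
    then obtain c where c: "\<And>i. i < ?n \<Longrightarrow> f i = (\<Sum>x\<in>G. c x * snd x i)"
      using gen unfolding gen_by_def by blast
    have "f i = mat_app A (length bs) (\<lambda>k. c (xs ! k)) i" if "i < ?n" for i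
      unfolding mat_app c[OF that] by (rule sum.reindex_bij_betw[OF bij, symmetric])
    then show "\<exists>g. \<forall>i<?n. f i = mat_app A (length bs) g i" by blast
  next
    assume "\<exists>g. \<forall>i<?n. f i = mat_app A (length bs) g i"
    then obtain g where g: "\<And>i. i < ?n \<Longrightarrow> f i = mat_app A (length bs) g i" by blast
    have "(\<lambda>i. \<Sum>k<length bs. g k * snd (xs ! k) i) \<in> Z"
    proof (intro submod_sum[OF Z] submod_scale[OF Z])
      fix k assume "k \<in> {..<length bs}"
      then have "xs ! k \<in> G" using xs(1) unfolding bs_def by auto
      then show "snd (xs ! k) \<in> Z" using GZ unfolding graded_part_def by blast
    qed
    then show "f \<in> Z" by (rule submod_cong[OF Z]) (simp add: g mat_app)
  qed
  have ker: "coef (f k0) 0 = 0" if f: "f \<in> mat_kernel A ?n (length bs)" and k0: "k0 < length bs" for f k0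
  proof (rule ccontr)
    assume ne: "coef (f k0) 0 \<noteq> 0"
    define x0 where "x0 = xs ! k0"
    \<comment> \<open>The component of the relation in the degree of the generator
      \<open>x0\<close>: its coefficient at \<open>k0\<close> is exactly the nonzero constant, so
      the relation can be solved for \<open>x0\<close>.\<close>
    define u where "u k = hcomp (bs ! k0 - bs ! k) (f k)" for k
    have "u \<in> mat_kernel A ?n (length bs)"
      using graded_sub_mat_kernel[OF gm] f unfolding graded_sub_def u_def by blast
    then have u: "(\<Sum>k<length bs. u k * snd (xs ! k) i) = 0" if "i < ?n" for i
      using that unfolding mat_kernel_def mat_app by simp
    define \<kappa> where "\<kappa> = coef (f k0) 0"
    have uk0: "u k0 = Poly_Mapping.single 0 \<kappa>"
    proof (rule poly_mapping_eqI)
      fix m :: "'v \<Rightarrow>\<^sub>0 nat"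
      have "mon_degree m = 0 \<longleftrightarrow> m = 0"
        by (auto simp: mon_degree_eq_deg_on deg_on_def poly_mapping_eq_iff fun_eq_iff)
      then show "coef (u k0) m = coef (Poly_Mapping.single 0 \<kappa>) m"
        by (auto simp: u_def coef_hcomp \<kappa>_def lookup_single when_def)
    qed
    define c where "c x = - Poly_Mapping.single 0 (inverse \<kappa>) * u (inv_into {..<length bs} ((!) xs) x)" for x
    have x0: "x0 \<in> G" using k0 xs(1) unfolding x0_def bs_def by auto
    have rel: "snd x0 i = (\<Sum>x\<in>G - {x0}. c x * snd x i)" if i: "i < ?n" for i
    proof -
      have inv: "inv_into {..<length bs} ((!) xs) (xs ! k) = k" if "k < length bs" for k
        using bij that by (intro inv_into_f_f) (auto simp: bij_betw_def)
      have "(\<Sum>x\<in>G. c x * snd x i) = (\<Sum>k<length bs. c (xs ! k) * snd (xs ! k) i)"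
        by (rule sum.reindex_bij_betw[OF bij, symmetric])
      also have "\<dots> = (\<Sum>k<length bs. - Poly_Mapping.single 0 (inverse \<kappa>) * (u k * snd (xs ! k) i))"
        by (intro sum.cong) (auto simp: c_def inv mult.assoc)
      also have "\<dots> = 0" unfolding sum_distrib_left[symmetric] u[OF i] by simp
      finally have "(\<Sum>x\<in>G. c x * snd x i) = 0" .
      then have "c x0 * snd x0 i + (\<Sum>x\<in>G - {x0}. c x * snd x i) = 0"
        using sum.remove[OF fin x0, of "\<lambda>x. c x * snd x i"] by simp
      moreover have "c x0 = - 1"
        using ne by (simp add: c_def x0_def inv[OF k0] uk0 mult_single \<kappa>_def)
      ultimately show ?thesis by (simp add: add_eq_0_iff)
    qed
    have sub: "gen_by ?n (G - {x0}) (snd x)" if "x \<in> G" for x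
    proof (cases "x = x0")
      case True
      then show ?thesis unfolding gen_by_def using rel by blast
    next
      case False
      have "(\<Sum>y\<in>G - {x0}. (if y = x then 1 else 0) * snd y k) = (\<Sum>y\<in>G - {x0}. if y = x then snd x k else 0)" for k
        by (intro sum.cong) auto
      then have "\<forall>k<?n. snd x k = (\<Sum>y\<in>G - {x0}. (if y = x then 1 else 0) * snd y k)"
        using fin that False by simp
      then show ?thesis unfolding gen_by_def by (rule exI[where x = "\<lambda>y. if y = x then 1 else 0"])
    qed
    have "gen_by ?n (G - {x0}) z" if z: "z \<in> Z" for z
    proof -
      obtain c where c: "\<And>i. i < ?n \<Longrightarrow> z i = (\<Sum>x\<in>G. c x * snd x i)"
        using gen[OF z] unfolding gen_by_def by blast
      show ?thesis by (rule gen_by_sum[OF sub c])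
    qed
    then have "P (G - {x0})" using fin GZ unfolding P_def by blast
    then have "card G \<le> card (G - {x0})" by (rule min)
    then show False using x0 fin by (metis card_Diff1_less leD)
  qed
  show ?thesis by (rule that[OF gm img]) (use ker in blast)
qed

text \<open>Minimal graded free resolutions with index functions in place of matrices and vectors,
  minimality being read off constant coefficients; \<open>minimal_resolution_iff\<close> is the
  translation.\<close>

definition min_res :: "('v::finite, 'k::field) polys set \<Rightarrow> (nat \<Rightarrow> int list)
    \<Rightarrow> (nat \<Rightarrow> nat \<Rightarrow> nat \<Rightarrow> ('v, 'k) polys) \<Rightarrow> (nat \<Rightarrow> ('v, 'k) polys) \<Rightarrow> bool" where
  "min_res I a d e \<longleftrightarrow>
     (\<forall>k<length (a 0). homogeneous (a 0 ! k) (e k)) \<and>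
     (\<forall>i. graded_mat (a i) (a (Suc i)) (d i)) \<and>
     (\<forall>p. \<exists>f. p - row_app e (length (a 0)) f \<in> I) \<and>
     (\<forall>f. row_app e (length (a 0)) f \<in> I \<longleftrightarrow>
        (\<exists>g. \<forall>k<length (a 0). f k = mat_app (d 0) (length (a 1)) g k)) \<and>
     (\<forall>i f. f \<in> mat_kernel (d i) (length (a i)) (length (a (Suc i))) \<longleftrightarrow>
        (\<exists>g. \<forall>k<length (a (Suc i)). f k = mat_app (d (Suc i)) (length (a (Suc (Suc i)))) g k)) \<and>
     (\<forall>i. \<forall>r<length (a i). \<forall>c<length (a (Suc i)). coef (d i r c) 0 = 0)"

text \<open>Vanishing of Koszul homology in large degrees takes the place of the Hilbert basis
  theorem: it bounds the generator degrees of a syzygy module, and by dimension shifting it passes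
  on to the next one, so the covers can be iterated by dependent choice.\<close>

lemma min_res_exists:
  fixes I :: "('v::finite, 'k::field) polys set"
  assumes I: "is_ideal I" and Ih: "\<And>p d. p \<in> I \<Longrightarrow> hcomp d p \<in> I" and Im: "\<And>p. p \<in> I \<Longrightarrow> coef p 0 = 0"
    and koszul_exact: "\<And>p. 1 \<le> p \<Longrightarrow> \<exists>B. \<forall>j>B. koszul_exact [0] {f. f 0 \<in> I} p j"
  shows "\<exists>a d e. min_res I a d e"
proof -
  \<comment> \<open>A state is a free module with the submodule still to be covered. The Koszul
    clause ranges over all positive \<open>p\<close> because each step uses one up: homological
    degree \<open>p + 1\<close> here becomes \<open>p\<close> for the next syzygies.\<close>
  define stok :: "int list \<times> (nat \<Rightarrow> ('v, 'k) polys) set \<Rightarrow> bool" where "stok = (\<lambda>(as, Z). submod (length as) Z \<and> graded_sub as Z \<and>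
    (\<forall>z\<in>Z. \<forall>k<length as. coef (z k) 0 = 0) \<and> (\<forall>p\<ge>1. \<exists>B. \<forall>j>B. koszul_exact as Z p j))"
  define R :: "int list \<times> (nat \<Rightarrow> ('v, 'k) polys) set \<Rightarrow> int list \<times> (nat \<Rightarrow> ('v, 'k) polys) set
      \<Rightarrow> (nat \<Rightarrow> nat \<Rightarrow> ('v, 'k) polys) \<Rightarrow> bool"
    where "R = (\<lambda>(as, Z) (bs, Z') A. graded_mat as bs A \<and>
    (\<forall>f. f \<in> Z \<longleftrightarrow> (\<exists>g. \<forall>i<length as. f i = mat_app A (length bs) g i)) \<and> Z' = mat_kernel A (length as) (length bs))"
  have start: "stok ([0], {f. f 0 \<in> I})"
  proof -
    have "submod 1 {f. f 0 \<in> I}"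
      unfolding submod_def using ideal.subspace_0[OF I] ideal.subspace_add[OF I] ideal.subspace_scale[OF I] by auto
    then show ?thesis unfolding stok_def graded_sub_def using Ih Im koszul_exact by auto
  qed
  have step: "\<exists>t. stok t \<and> (\<exists>A. R s t A)" if s: "stok s" for s
  proof -
    obtain as Z where sZ: "s = (as, Z)" by fastforce
    have Z: "submod (length as) Z" "graded_sub as Z" "\<forall>z\<in>Z. \<forall>k<length as. coef (z k) 0 = 0"
      and vz: "\<And>p. 1 \<le> p \<Longrightarrow> \<exists>B. \<forall>j>B. koszul_exact as Z p j"
      using s unfolding sZ stok_def by auto
    obtain B where B: "\<And>j. B < j \<Longrightarrow> koszul_exact as Z 1 j" using vz[of 1] by auto
    obtain bs A where A: "graded_mat as bs A"
      and img: "\<And>f. f \<in> Z \<longleftrightarrow> (\<exists>g. \<forall>i<length as. f i = mat_app A (length bs) g i)"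
      and ker: "\<forall>f\<in>mat_kernel A (length as) (length bs). \<forall>k<length bs. coef (f k) 0 = 0"
      by (rule minimal_cover[OF Z, of B], erule B, rule that)
    let ?K = "mat_kernel A (length as) (length bs)"
    have "\<exists>B. \<forall>j>B. koszul_exact bs ?K p j" if p: "1 \<le> p" for p
    proof -
      obtain B where "\<forall>j>B. koszul_exact as Z (p + 1) j" using vz[of "p + 1"] by auto
      then show ?thesis using koszul_exact_shift_down[OF A p img] by blast
    qed
    then have "stok (bs, ?K)"
      unfolding stok_def using submod_mat_kernel graded_sub_mat_kernel[OF A] ker by auto
    moreover have "R s (bs, ?K) A" unfolding R_def sZ using A img by simp
    ultimately show ?thesis by blast
  qed
  obtain s where s: "s 0 = ([0], {f. f 0 \<in> I})" "\<And>i. stok (s i)" "\<And>i. \<exists>A. R (s i) (s (Suc i)) A"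
  proof -
    have "\<exists>f. \<forall>n. (stok (f n) \<and> (n = 0 \<longrightarrow> f n = ([0], {f. f 0 \<in> I}))) \<and> (\<exists>A. R (f n) (f (Suc n)) A)"
      by (rule dependent_nat_choice) (use start step in \<open>blast+\<close>)
    then show ?thesis using that by blast
  qed
  then obtain d where d: "\<And>i. R (s i) (s (Suc i)) (d i)" by metis
  define a where "a i = fst (s i)" for i
  define Z where "Z i = snd (s i)" for i
  have sa: "s i = (a i, Z i)" for i unfolding a_def Z_def by simp
  have a0: "a 0 = [0]" and Z0: "Z 0 = {f. f 0 \<in> I}" using s(1) unfolding a_def Z_def by simp_all
  have d1: "graded_mat (a i) (a (Suc i)) (d i)"
    and d2: "\<And>f. f \<in> Z i \<longleftrightarrow> (\<exists>g. \<forall>k<length (a i). f k = mat_app (d i) (length (a (Suc i))) g k)"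
    and d3: "Z (Suc i) = mat_kernel (d i) (length (a i)) (length (a (Suc i)))" for i
    using d[of i] unfolding R_def sa by auto
  \<comment> \<open>Column \<open>c\<close> is the image of a basis vector, hence an element of
    \<open>Z i\<close>, whose entries have no constant term by the invariant.\<close>
  have min: "coef (d i r c) 0 = 0" if "r < length (a i)" "c < length (a (Suc i))" for i r c
  proof -
    have "d i r' c = mat_app (d i) (length (a (Suc i))) (\<lambda>k. if k = c then 1 else 0) r'" for r'
      unfolding mat_app_def using that(2) by (simp add: if_distrib cong: if_cong)
    then have "(\<lambda>r. d i r c) \<in> Z i" unfolding d2 by blast
    then show ?thesis using s(2)[of i] that(1) unfolding stok_def sa by auto
  qed
  have "min_res I a d (\<lambda>_. 1)"
    unfolding min_res_def
  proof (intro conjI allI impI)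
    show "homogeneous (a 0 ! k) (1 :: ('v, 'k) polys)" if "k < length (a 0)" for k
      using that unfolding a0 by (simp add: homogeneous_one)
    show "\<exists>f. p - row_app (\<lambda>_. 1) (length (a 0)) f \<in> I" for p
      unfolding a0 row_app_def using ideal.subspace_0[OF I] by (intro exI[of _ "\<lambda>_. p"]) simp
    show "row_app (\<lambda>_. 1) (length (a 0)) f \<in> I \<longleftrightarrow> (\<exists>g. \<forall>k<length (a 0). f k = mat_app (d 0) (length (a 1)) g k)" for f
      using d2[of f 0] unfolding Z0 by (simp add: a0 row_app_def)
    show "f \<in> mat_kernel (d i) (length (a i)) (length (a (Suc i))) \<longleftrightarrow>
      (\<exists>g. \<forall>k<length (a (Suc i)). f k = mat_app (d (Suc i)) (length (a (Suc (Suc i)))) g k)" for i f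
      unfolding d3[symmetric] by (rule d2)
  qed (use d1 min in auto)
  then show ?thesis by blast
qed

section \<open>Betti numbers and regularity\<close>

lemma mult_mat_vec_mat_app:
  assumes "A \<in> carrier_mat n m" "v \<in> carrier_vec m" "i < n"
  shows "(A *\<^sub>v v) $ i = mat_app (\<lambda>r c. A $$ (r, c)) m (\<lambda>k. v $ k) i"
  using assms by (simp add: mat_app_def scalar_prod_def lessThan_atLeast0)

lemma scalar_prod_row_app:
  assumes "v \<in> carrier_vec n"
  shows "e \<bullet> v = row_app (\<lambda>k. e $ k) n (\<lambda>k. v $ k)"
  using assms by (simp add: row_app_def scalar_prod_def lessThan_atLeast0)

lemma vec_eq_mult_mat_vec_iff:
  assumes "A \<in> carrier_mat n m"
  shows "(\<exists>u\<in>carrier_vec m. vec n f = A *\<^sub>v u) \<longleftrightarrow> (\<exists>g. \<forall>k<n. f k = mat_app (\<lambda>r c. A $$ (r, c)) m g k)"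
proof
  assume "\<exists>u\<in>carrier_vec m. vec n f = A *\<^sub>v u"
  then obtain u where u: "u \<in> carrier_vec m" "vec n f = A *\<^sub>v u" by blast
  have "f k = mat_app (\<lambda>r c. A $$ (r, c)) m (\<lambda>k. u $ k) k" if "k < n" for k
  proof -
    have "f k = vec n f $ k" using that by simp
    then show ?thesis unfolding u(2) using mult_mat_vec_mat_app[OF assms u(1) that] by simp
  qed
  then show "\<exists>g. \<forall>k<n. f k = mat_app (\<lambda>r c. A $$ (r, c)) m g k" by blast
next
  assume "\<exists>g. \<forall>k<n. f k = mat_app (\<lambda>r c. A $$ (r, c)) m g k"
  then obtain g where g: "\<And>k. k < n \<Longrightarrow> f k = mat_app (\<lambda>r c. A $$ (r, c)) m g k" by blast
  have "vec n f = A *\<^sub>v vec m g"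
  proof (rule eq_vecI)
    fix k assume "k < dim_vec (A *\<^sub>v vec m g)"
    then have k: "k < n" using assms by simp
    have "(A *\<^sub>v vec m g) $ k = mat_app (\<lambda>r c. A $$ (r, c)) m (\<lambda>k. vec m g $ k) k"
      using mult_mat_vec_mat_app[OF assms vec_carrier k] .
    also have "\<dots> = mat_app (\<lambda>r c. A $$ (r, c)) m g k" by (rule mat_app_cong) simp
    finally show "vec n f $ k = (A *\<^sub>v vec m g) $ k" using g[OF k] k by simp
  qed (use assms in simp)
  then show "\<exists>u\<in>carrier_vec m. vec n f = A *\<^sub>v u" using vec_carrier by blast
qed

lemma mult_mat_vec_eq_0_iff:
  assumes "A \<in> carrier_mat n m"
  shows "A *\<^sub>v vec m f = 0\<^sub>v n \<longleftrightarrow> f \<in> mat_kernel (\<lambda>r c. A $$ (r, c)) n m"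
proof -
  have "(A *\<^sub>v vec m f) $ i = mat_app (\<lambda>r c. A $$ (r, c)) m f i" if "i < n" for i
    unfolding mult_mat_vec_mat_app[OF assms vec_carrier that] by (rule mat_app_cong) simp
  moreover have "A *\<^sub>v vec m f = 0\<^sub>v n \<longleftrightarrow> (\<forall>i<n. (A *\<^sub>v vec m f) $ i = 0)"
  proof
    assume "\<forall>i<n. (A *\<^sub>v vec m f) $ i = 0"
    then show "A *\<^sub>v vec m f = 0\<^sub>v n" using assms by (intro eq_vecI) auto
  qed simp
  ultimately show ?thesis unfolding mat_kernel_def by auto
qed

lemma ball_carrier_vec_iff:
  fixes P :: "'a vec \<Rightarrow> bool"
  shows "(\<forall>v\<in>carrier_vec n. P v) \<longleftrightarrow> (\<forall>f. P (vec n f))"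
proof
  assume H: "\<forall>f. P (vec n f)"
  show "\<forall>v\<in>carrier_vec n. P v"
  proof
    fix v :: "'a vec" assume v: "v \<in> carrier_vec n"
    have "v = vec n (\<lambda>k. v $ k)" by (rule eq_vecI) (use v in auto)
    then show "P v" using H by metis
  qed
qed (simp add: vec_carrier)

lemma bex_carrier_vec_iff: "(\<exists>v\<in>carrier_vec n. P v) \<longleftrightarrow> (\<exists>f. P (vec n f))"
  using ball_carrier_vec_iff[of n "\<lambda>v. \<not> P v"] by blast

lemma row_app_vec: "row_app e n (\<lambda>k. vec n f $ k) = row_app e n f"
  unfolding row_app_mat_app[of _ _ _ 0] by (rule mat_app_cong) simp

lemma minimal_resolution_iff:
  fixes I :: "('v::finite, 'k::field) polys set"
  assumes E: "E \<in> carrier_vec (length (a 0))"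
    and D: "\<And>i. D i \<in> carrier_mat (length (a i)) (length (a (Suc i)))"
  shows "minimal_graded_free_resolution I a D E \<longleftrightarrow> min_res I a (\<lambda>i r c. D i $$ (r, c)) (\<lambda>k. E $ k)"
proof -
  have el: "elements_mat (D i) \<subseteq> irrelevant_ideal \<longleftrightarrow>
      (\<forall>r<length (a i). \<forall>c<length (a (Suc i)). coef (D i $$ (r, c)) 0 = 0)" for i
  proof -
    have "elements_mat (D i) = {D i $$ (r, c) | r c. r < length (a i) \<and> c < length (a (Suc i))}"
      using D[of i] by (auto dest!: elements_matD intro!: elements_matI) blast
    then show ?thesis unfolding irrelevant_ideal_eq by auto
  qed
  have 1: "e \<bullet> vec n f = row_app (\<lambda>k. e $ k) n f" for e :: "('v, 'k) polys vec" and n f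
    by (simp add: scalar_prod_row_app[OF vec_carrier] row_app_vec)
  show ?thesis
    unfolding minimal_graded_free_resolution_def graded_free_resolution_def min_res_def graded_matrix_def graded_mat_def
      ball_carrier_vec_iff bex_carrier_vec_iff[of "length (a 0)"] el 1
      vec_eq_mult_mat_vec_iff[OF D] vec_eq_mult_mat_vec_iff[OF D[of 0, folded One_nat_def]] mult_mat_vec_eq_0_iff[OF D]
    using E D by auto
qed

text \<open>Indexed so that number \<open>q\<close> is a submodule of F_q: the kernel of the map
  leaving F_q, which is the augmentation for \<open>q = 0\<close>, and by exactness the image of
  \<open>d q\<close>.\<close>

definition syzygies :: "('v::finite, 'k::field) polys set \<Rightarrow> (nat \<Rightarrow> int list)
    \<Rightarrow> (nat \<Rightarrow> nat \<Rightarrow> nat \<Rightarrow> ('v, 'k) polys) \<Rightarrow> (nat \<Rightarrow> ('v, 'k) polys) \<Rightarrow> nat \<Rightarrow> (nat \<Rightarrow> ('v, 'k) polys) set" where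
  "syzygies I a d e q = (case q of 0 \<Rightarrow> {f. row_app e (length (a 0)) f \<in> I}
     | Suc i \<Rightarrow> mat_kernel (d i) (length (a i)) (length (a (Suc i))))"

lemma min_res_syzygies:
  assumes "min_res I a d e"
  shows "f \<in> syzygies I a d e q \<longleftrightarrow> (\<exists>g. \<forall>k<length (a q). f k = mat_app (d q) (length (a (Suc q))) g k)"
proof (cases q)
  case 0
  then show ?thesis using assms unfolding min_res_def syzygies_def by simp
next
  case (Suc i)
  then show ?thesis using assms unfolding min_res_def syzygies_def by simp
qed

lemma min_res_graded_mat: "min_res I a d e \<Longrightarrow> graded_mat (a i) (a (Suc i)) (d i)"
  and min_res_min: "min_res I a d e \<Longrightarrow> r < length (a i) \<Longrightarrow> c < length (a (Suc i)) \<Longrightarrow> coef (d i r c) 0 = 0"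
  and min_res_hom: "min_res I a d e \<Longrightarrow> k < length (a 0) \<Longrightarrow> homogeneous (a 0 ! k) (e k)"
  and min_res_surj: "min_res I a d e \<Longrightarrow> \<exists>f. p - row_app e (length (a 0)) f \<in> I"
  by (simp_all add: min_res_def)

lemma syzygies_min:
  assumes m: "min_res I a d e"
  shows "\<forall>z\<in>syzygies I a d e q. \<forall>k<length (a q). coef (z k) 0 = 0"
proof (intro ballI allI impI)
  fix z k assume "z \<in> syzygies I a d e q" and k: "k < length (a q)"
  then obtain g where "z k = mat_app (d q) (length (a (Suc q))) g k"
    unfolding min_res_syzygies[OF m] by blast
  then show "coef (z k) 0 = 0"
    unfolding mat_app_def coef_sum by (simp add: coef_mult_zero coef_sum min_res_min[OF m k])
qed

lemma submod_syzygies: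
  assumes I: "is_ideal I" shows "submod (length (a q)) (syzygies I a d e q)"
proof (cases q)
  case 0
  have "row_app e n (\<lambda>k. f k + g k) = row_app e n f + row_app e n g" for n f g
    by (simp add: row_app_def distrib_left sum.distrib)
  moreover have "row_app e n (\<lambda>k. p * f k) = p * row_app e n f" for n p f
    by (simp only: row_app_def sum_distrib_left mult.left_commute)
  moreover have "row_app e n (\<lambda>k. 0) = 0" for n by (simp add: row_app_def)
  moreover have "row_app e n f = row_app e n g" if "\<forall>k<n. f k = g k" for n f g
    using that unfolding row_app_def by (intro sum.cong) auto
  moreover note ideal.subspace_0[OF I] ideal.subspace_add[OF I] ideal.subspace_scale[OF I]
  ultimately show ?thesis
    unfolding submod_def syzygies_def 0 nat.case mem_Collect_eq
    by (intro conjI ballI allI impI) (simp_all only: mem_Collect_eq)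
next
  case (Suc i)
  then show ?thesis unfolding syzygies_def by (simp add: submod_mat_kernel)
qed

text \<open>Each step along the resolution trades one syzygy for one homological degree, so the
  induction needs \<open>p\<close> arbitrary. For \<open>p = 1\<close> the left side describes the
  generators of F_(q+1).\<close>

lemma koszul_exact_syzygies:
  fixes I :: "('v::finite, 'k::field) polys set"
  assumes m: "min_res I a d e" and I: "is_ideal I" and Ih: "\<And>p d. p \<in> I \<Longrightarrow> hcomp d p \<in> I" and p: "1 \<le> p"
  shows "koszul_exact (a q) (syzygies I a d e q) p j \<longleftrightarrow> koszul_exact [0] {f. f 0 \<in> I} (p + q) j"
  using p
proof (induction q arbitrary: p)
  case 0
  show ?case
    using koszul_exact_augmentation[OF I Ih min_res_hom[OF m] min_res_surj[OF m]] unfolding syzygies_def by simp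
next
  case (Suc q)
  have "koszul_exact (a (Suc q)) (syzygies I a d e (Suc q)) p j \<longleftrightarrow> koszul_exact (a q) (syzygies I a d e q) (p + 1) j"
    using koszul_exact_shift_down[OF min_res_graded_mat[OF m] Suc.prems min_res_syzygies[OF m], of q j]
      koszul_exact_shift_up[OF min_res_graded_mat[OF m] Suc.prems min_res_syzygies[OF m], of q j]
    unfolding syzygies_def[of I a d e "Suc q"] by auto
  then show ?case using Suc.IH[of "p + 1"] by simp
qed

lemma mat_app_sum_Var:
  "mat_app A m (\<lambda>x. \<Sum>v\<in>UNIV. Var v * h v x) k = (\<Sum>v\<in>UNIV. Var v * mat_app A m (h v) k)"
  unfolding mat_app_def sum_distrib_left by (subst sum.swap) (simp only: mult.left_commute)

text \<open>By H_1 of F_q modulo its syzygies, the right side says that the syzygies have a minimal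
  generator of degree \<open>j\<close>. A column of \<open>d q\<close> is one: otherwise its basis
  vector minus a combination with coefficients in the maximal ideal would be a syzygy with constant
  coefficient 1. Conversely, if \<open>j\<close> is not a basis degree, the coefficients expressing
  an element of degree \<open>j\<close> in the columns have nonzero degree, hence no constant
  term.\<close>

lemma betti_iff_koszul_exact:
  fixes I :: "('v::finite, 'k::field) polys set"
  assumes m: "min_res I a d e" and I: "is_ideal I" and Ih: "\<And>p d. p \<in> I \<Longrightarrow> hcomp d p \<in> I"
  shows "j \<in> set (a (Suc q)) \<longleftrightarrow> \<not> koszul_exact [0] {f. f 0 \<in> I} (Suc q) j"
proof -
  let ?n = "length (a q)" and ?m = "length (a (Suc q))" and ?Z = "syzygies I a d e q"
  note Z = min_res_syzygies[OF m, of _ q]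
  have koszul_exact: "koszul_exact [0] {f. f 0 \<in> I} (Suc q) j \<longleftrightarrow>
      (\<forall>z\<in>?Z. (\<forall>k<?n. homogeneous (j - a q ! k) (z k)) \<longrightarrow> z \<in> max_ideal_mult ?n ?Z)"
    using koszul_exact_syzygies[OF m I Ih, of 1 q j] koszul_exact_1_iff[OF submod_syzygies[OF I] syzygies_min[OF m], of q j] by simp
  show ?thesis
  proof
    assume "j \<in> set (a (Suc q))"
    then obtain c where c: "c < ?m" "a (Suc q) ! c = j" by (metis in_set_conv_nth)
    define z where "z = (\<lambda>k. d q k c)"
    define \<delta> :: "nat \<Rightarrow> ('v, 'k) polys" where "\<delta> = (\<lambda>x. if x = c then 1 else 0)"
    have z: "z k = mat_app (d q) ?m \<delta> k" for k
      unfolding z_def mat_app_def \<delta>_def using c by (simp add: if_distrib cong: if_cong)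
    then have "z \<in> ?Z" unfolding Z by blast
    moreover have "homogeneous (j - a q ! k) (z k)" if "k < ?n" for k
      using min_res_graded_mat[OF m, of q] that c unfolding graded_mat_def z_def by auto
    moreover have "z \<notin> max_ideal_mult ?n ?Z"
    proof
      assume "z \<in> max_ideal_mult ?n ?Z"
      then obtain g where g: "\<And>v. g v \<in> ?Z" "\<And>k. k < ?n \<Longrightarrow> z k = (\<Sum>v\<in>UNIV. Var v * g v k)"
        unfolding max_ideal_mult_def by blast
      have "\<forall>v. \<exists>h. \<forall>k<?n. g v k = mat_app (d q) ?m h k" using g(1) unfolding Z by blast
      from choice[OF this] obtain h where h: "\<forall>v. \<forall>k<?n. g v k = mat_app (d q) ?m (h v) k" ..
      define u where "u = (\<lambda>x. \<delta> x - (\<Sum>v\<in>UNIV. Var v * h v x))"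
      have "mat_app (d q) ?m u k = 0" if k: "k < ?n" for k
        unfolding u_def mat_app_diff mat_app_sum_Var z[symmetric] g(2)[OF k] using h k by simp
      then have "u \<in> syzygies I a d e (Suc q)" unfolding syzygies_def mat_kernel_def by simp
      then have "coef (u c) 0 = 0" using syzygies_min[OF m, of "Suc q"] c(1) by blast
      then show False by (simp add: u_def \<delta>_def lookup_minus coef_sum coef_Var_mult)
    qed
    ultimately show "\<not> koszul_exact [0] {f. f 0 \<in> I} (Suc q) j" unfolding koszul_exact by blast
  next
    assume "\<not> koszul_exact [0] {f. f 0 \<in> I} (Suc q) j"
    then obtain z where z: "z \<in> ?Z" "\<forall>k<?n. homogeneous (j - a q ! k) (z k)" "z \<notin> max_ideal_mult ?n ?Z"
      unfolding koszul_exact by blast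
    show "j \<in> set (a (Suc q))"
    proof (rule ccontr)
      assume j: "j \<notin> set (a (Suc q))"
      obtain g where g: "\<And>k. k < ?n \<Longrightarrow> z k = mat_app (d q) ?m g k" using z(1) unfolding Z by blast
      define g' where "g' x = hcomp (j - a (Suc q) ! x) (g x)" for x
      have zg: "z k = mat_app (d q) ?m g' k" if k: "k < ?n" for k
      proof -
        have "z k = hcomp (j - a q ! k) (z k)"
          using hcomp_homogeneous[OF z(2)[rule_format, OF k], of "j - a q ! k"] by simp
        also have "\<dots> = mat_app (d q) ?m g' k"
          unfolding g[OF k] g'_def by (rule hcomp_mat_app[OF min_res_graded_mat[OF m] k])
        finally show ?thesis .
      qed
      have "\<exists>h. g' x = (\<Sum>v\<in>UNIV. Var v * h v)" if "x < ?m" for x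
      proof -
        have "j - a (Suc q) ! x \<noteq> 0" using j that by auto
        then have "coef (g' x) 0 = 0"
          unfolding g'_def by (intro homogeneous_nonzero_degree[OF homogeneous_hcomp])
        then show ?thesis using irrelevant_decomp[OF _ homogeneous_hcomp, of "j - a (Suc q) ! x" "g x"]
          unfolding g'_def by metis
      qed
      then have "\<forall>x. \<exists>h. x < ?m \<longrightarrow> g' x = (\<Sum>v\<in>UNIV. Var v * h v)" by blast
      from choice[OF this] obtain h where h: "\<forall>x. x < ?m \<longrightarrow> g' x = (\<Sum>v\<in>UNIV. Var v * h x v)" ..
      have "z k = (\<Sum>v\<in>UNIV. Var v * mat_app (d q) ?m (\<lambda>x. h x v) k)" if k: "k < ?n" for k
        unfolding zg[OF k] mat_app_sum_Var[symmetric] using h by (intro mat_app_cong) simp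
      moreover have "(\<lambda>k. mat_app (d q) ?m (\<lambda>x. h x v) k) \<in> ?Z" for v unfolding Z by blast
      ultimately have "z \<in> max_ideal_mult ?n ?Z" unfolding max_ideal_mult_def
        by (intro CollectI exI[of _ "\<lambda>v k. mat_app (d q) ?m (\<lambda>x. h x v) k"]) simp
      then show False using z(3) by simp
    qed
  qed
qed

text \<open>Betti degrees are compared with Koszul homology only in positive homological degree, so
  F_0 is treated by hand. If basis element \<open>c\<close> had nonzero degree, its image
  \<open>e c\<close> would have no constant term. With \<open>f\<close> a preimage of 1, the basis
  vector at \<open>c\<close> minus \<open>e c * f\<close> maps into \<open>I\<close> but has
  constant coefficient 1 at \<open>c\<close>, against minimality.\<close>

lemma generator_degree_0:
  fixes I :: "('v::finite, 'k::field) polys set"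
  assumes m: "min_res I a d e" and I: "is_ideal I"
  shows "j \<in> set (a 0) \<Longrightarrow> j = 0"
proof (rule ccontr)
  let ?n = "length (a 0)"
  assume "j \<in> set (a 0)" and j: "j \<noteq> 0"
  then obtain c where c: "c < ?n" "a 0 ! c = j" by (metis in_set_conv_nth)
  obtain f where f: "1 - row_app e ?n f \<in> I" using min_res_surj[OF m] by blast
  define u where "u = (\<lambda>k. (if k = c then 1 else 0) - e c * f k)"
  have "row_app e ?n u = e c - e c * row_app e ?n f"
  proof -
    have "row_app e ?n (\<lambda>k. if k = c then 1 else 0) = e c"
      unfolding row_app_def using c by (simp add: if_distrib cong: if_cong)
    moreover have "row_app e ?n (\<lambda>k. e c * f k) = e c * row_app e ?n f"
      by (simp only: row_app_def sum_distrib_left mult.left_commute)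
    ultimately show ?thesis unfolding u_def row_app_diff by simp
  qed
  also have "\<dots> = e c * (1 - row_app e ?n f)" by (simp add: right_diff_distrib)
  also have "\<dots> \<in> I" using f by (rule ideal.subspace_scale[OF I])
  finally have "u \<in> syzygies I a d e 0" unfolding syzygies_def by simp
  then have "coef (u c) 0 = 0" using syzygies_min[OF m, of 0] c(1) by blast
  moreover have "coef (e c) 0 = 0" using min_res_hom[OF m c(1)] j c(2) by (intro homogeneous_nonzero_degree) auto
  ultimately show False by (simp add: u_def lookup_minus coef_mult_zero)
qed

text \<open>\<open>upper\<close> bounds all positive homological degrees, and it also supplies the
  degree bounds from which a minimal resolution is built. The condition \<open>0 \<le> r\<close>
  covers F_0, whose generators have degree 0.\<close>

lemma reg_quot_eqI:
  fixes I :: "('v::finite, 'k::field) polys set"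
  assumes I: "is_ideal I" and Ih: "\<And>p d. p \<in> I \<Longrightarrow> hcomp d p \<in> I" and Im: "\<And>p. p \<in> I \<Longrightarrow> coef p 0 = 0"
    and upper: "\<And>p j. 1 \<le> p \<Longrightarrow> r < j - int p \<Longrightarrow> koszul_exact [0] {f. f 0 \<in> I} p j"
    and lower: "1 \<le> p0" "\<not> koszul_exact [0] {f. f 0 \<in> I} p0 (r + int p0)" and r: "0 \<le> r"
  shows "reg_quot I = r"
proof -
  have "\<exists>B. \<forall>j>B. koszul_exact [0] {f. f 0 \<in> I} p j" if "1 \<le> p" for p
    using upper[OF that] by (intro exI[of _ "r + int p"]) simp
  then obtain a d e where m: "min_res I a d e" using min_res_exists[OF I Ih Im] by blast
  define D where "D i = mat (length (a i)) (length (a (Suc i))) (\<lambda>(r, c). d i r c)" for i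
  define E where "E = vec (length (a 0)) e"
  have "min_res I a (\<lambda>i r c. D i $$ (r, c)) (\<lambda>k. E $ k)"
  proof -
    have 1: "mat_app (\<lambda>r c. D i $$ (r, c)) (length (a (Suc i))) f k = mat_app (d i) (length (a (Suc i))) f k"
      if "k < length (a i)" for i f k
      unfolding mat_app_def D_def using that by (intro sum.cong) auto
    have 2: "row_app (\<lambda>k. E $ k) (length (a 0)) f = row_app e (length (a 0)) f" for f
      unfolding row_app_def E_def by (intro sum.cong) auto
    have 3: "mat_kernel (\<lambda>r c. D i $$ (r, c)) (length (a i)) (length (a (Suc i))) = mat_kernel (d i) (length (a i)) (length (a (Suc i)))" for i
      unfolding mat_kernel_def using 1 by auto
    have 4: "(\<forall>k<length (a i). f k = mat_app (\<lambda>r c. D i $$ (r, c)) (length (a (Suc i))) g k)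
       \<longleftrightarrow> (\<forall>k<length (a i). f k = mat_app (d i) (length (a (Suc i))) g k)" for i f g
      using 1 by simp
    show ?thesis
      using m unfolding min_res_def 2 3 4 4[of 0, unfolded One_nat_def[symmetric]]
      by (simp add: graded_mat_def D_def E_def)
  qed
  then have "minimal_graded_free_resolution I a D E"
    by (subst minimal_resolution_iff) (auto simp: D_def E_def)
  then have "\<exists>a d e. minimal_graded_free_resolution I a d e" by blast
  \<comment> \<open>From here on the resolution is the chosen one, of which nothing but minimality
    is known; the constructed one guarantees that the choice has a candidate.\<close>
  then have "\<exists>d e. minimal_graded_free_resolution I (min_res_degrees I) d e"
    unfolding min_res_degrees_def by (rule someI_ex)
  then obtain D' E' where D': "minimal_graded_free_resolution I (min_res_degrees I) D' E'" by blast
  define A where "A = min_res_degrees I"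
  have "min_res I A (\<lambda>i r c. D' i $$ (r, c)) (\<lambda>k. E' $ k)"
  proof (subst minimal_resolution_iff[symmetric])
    show "minimal_graded_free_resolution I A D' E'" using D' unfolding A_def .
  qed (use D' in \<open>auto simp: A_def minimal_graded_free_resolution_def graded_free_resolution_def graded_matrix_def\<close>)
  note m' = this
  have koszul_exact: "j \<in> set (A p) \<longleftrightarrow> \<not> koszul_exact [0] {f. f 0 \<in> I} p j" if "1 \<le> p" for p j
    using betti_iff_koszul_exact[OF m' I Ih, of j "p - 1"] that by simp
  have A0: "j = 0" if "j \<in> set (A 0)" for j using generator_degree_0[OF m' I that] .
  let ?N = "card (UNIV :: 'v set)"
  \<comment> \<open>No set has more elements than there are variables, so there are no Koszul chains
    beyond this homological degree. Hence the maximum is over a finite set.\<close>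
  have triv: "koszul_exact [0] {f. f 0 \<in> I} p j" if "?N < p" for p j
  proof (rule vanI)
    have "card \<sigma> \<noteq> p" for \<sigma> :: "'v set" using card_mono[of UNIV \<sigma>] that by auto
    then show "\<exists>b. \<forall>\<sigma>. card \<sigma> = p \<longrightarrow> (\<lambda>i. C i \<sigma> - koszul (b i) \<sigma>) \<in> {f. f 0 \<in> I}" for C :: "nat \<Rightarrow> 'v set \<Rightarrow> ('v, 'k) polys"
      by blast
  qed
  have betti: "graded_betti I i j \<noteq> 0 \<longleftrightarrow> j \<in> set (A i)" for i j
    unfolding graded_betti_def A_def by (simp add: count_list_0_iff)
  let ?R = "{j - int i | i j. j \<in> set (A i)}"
  have le: "x \<le> r" if x: "x \<in> ?R" for x
  proof -
    obtain i j where ij: "x = j - int i" "j \<in> set (A i)" using x by blast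
    show ?thesis
    proof (cases "i = 0")
      case True
      then show ?thesis using ij A0[of j] r by simp
    next
      case False
      then show ?thesis using koszul_exact[of i j] upper[of i j] ij by force
    qed
  qed
  have "?R \<subseteq> (\<Union>i\<in>{..?N}. (\<lambda>j. j - int i) ` set (A i))"
  proof
    fix x assume "x \<in> ?R"
    then obtain i j where ij: "x = j - int i" "j \<in> set (A i)" by blast
    have "i \<le> ?N"
    proof (rule ccontr)
      assume "\<not> i \<le> ?N"
      then show False using triv[of i j] koszul_exact[of i j] ij(2) by simp
    qed
    then show "x \<in> (\<Union>i\<in>{..?N}. (\<lambda>j. j - int i) ` set (A i))" using ij by blast
  qed
  then have "finite ?R" by (rule finite_subset) simp
  moreover have "r \<in> ?R"
  proof -
    have "r + int p0 \<in> set (A p0)" using koszul_exact[OF lower(1)] lower(2) by blast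
    then show ?thesis by force
  qed
  ultimately show ?thesis
    unfolding reg_quot_def betti using le by (intro Max_eqI) auto
qed

section \<open>Symbolic powers and depth\<close>

lemma is_ideal_one_UNIV: "is_ideal P \<Longrightarrow> 1 \<in> P \<Longrightarrow> P = UNIV"
  using ideal.subspace_scale[of P 1] by auto

lemma loc_contraction_superset:
  assumes "is_prime_ideal P" shows "J \<subseteq> loc_contraction P J"
proof
  fix f assume f: "f \<in> J"
  have "1 \<notin> P" using assms is_ideal_one_UNIV unfolding is_prime_ideal_def by blast
  moreover have "loc_eq P f 1 f 1" unfolding loc_eq_def using \<open>1 \<notin> P\<close> by (intro exI[of _ 1]) simp
  ultimately show "f \<in> loc_contraction P J" unfolding loc_contraction_def using f by blast
qed

lemma loc_contraction_primary:
  assumes P: "is_prime_ideal P" and J: "is_ideal J"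
    and prim: "\<And>g f. g \<notin> P \<Longrightarrow> g * f \<in> J \<Longrightarrow> f \<in> J"
  shows "loc_contraction P J \<subseteq> J"
proof
  fix f assume "f \<in> loc_contraction P J"
  then obtain a s u where *: "a \<in> J" "s \<notin> P" "u \<notin> P" "u * (f * s - a * 1) = 0"
    unfolding loc_contraction_def loc_eq_def by blast
  have "u * s \<notin> P" using P * unfolding is_prime_ideal_def by blast
  moreover have "(u * s) * f = u * a" using *(4) by (simp add: right_diff_distrib mult_ac)
  then have "(u * s) * f \<in> J" using ideal.subspace_scale[OF J *(1), of u] by simp
  ultimately show "f \<in> J" by (rule prim)
qed

lemma loc_contraction_mono: "J \<subseteq> K \<Longrightarrow> loc_contraction P J \<subseteq> loc_contraction P K"
  unfolding loc_contraction_def by blast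

lemma is_ideal_irrelevant: "is_ideal irrelevant_ideal"
  unfolding irrelevant_ideal_def by (rule ideal.subspace_span)

text \<open>\<open>g\<close> is a nonzero socle element of S/(A + B), \<open>f\<close> a regular
  sequence of length one, and \<open>\<alpha>\<close>, \<open>\<beta>\<close> transfer regularity
  from \<open>A \<inter> B\<close> to \<open>A\<close> and to \<open>B\<close>. For a regular
  sequence f1, f2 write f_i g = a_i + b_i. Then f2 b1 lies in (f1) + (A \<inter> B), so b1 = h f1
  modulo \<open>A \<inter> B\<close> for some h. Hence g - h lies in \<open>A\<close> and h in
  \<open>B\<close>, which puts \<open>g\<close> into A + B.\<close>

lemma depth_quot_eq_1:
  fixes A B :: "('v::finite, 'k::field) polys set"
  assumes A: "is_ideal A" and B: "is_ideal B"
    and Am: "A \<subseteq> irrelevant_ideal"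
    and g1: "\<And>a b. a \<in> A \<Longrightarrow> b \<in> B \<Longrightarrow> g \<noteq> a + b"
    and g2: "\<And>p. p \<in> irrelevant_ideal \<Longrightarrow> \<exists>a\<in>A. \<exists>b\<in>B. p * g = a + b"
    and \<beta>: "\<beta> \<in> B" "\<And>h. \<beta> * h \<in> A \<Longrightarrow> h \<in> A"
    and \<alpha>: "\<alpha> \<in> A" "\<And>h. \<alpha> * h \<in> B \<Longrightarrow> h \<in> B"
    and f: "f \<in> irrelevant_ideal" "\<And>h. f * h \<in> A \<Longrightarrow> h \<in> A" "\<And>h. f * h \<in> B \<Longrightarrow> h \<in> B"
  shows "depth_quot (A \<inter> B) = 1"
proof -
  let ?Q = "A \<inter> B"
  have Q: "is_ideal ?Q" by (rule ideal.subspace_inter[OF A B])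
  have sp: "ideal_span ?Q = ?Q" using Q by simp
  let ?L = "{length fs | fs. regular_sequence ?Q fs \<and> set fs \<subseteq> irrelevant_ideal}"
  have "regular_sequence ?Q [f]"
  proof -
    have "ideal_span (?Q \<union> {f}) \<subseteq> irrelevant_ideal"
      by (rule ideal.span_minimal[OF _ is_ideal_irrelevant]) (use Am f in auto)
    moreover have "(1 :: ('v, 'k) polys) \<notin> irrelevant_ideal" by (simp add: irrelevant_ideal_eq)
    ultimately have "ideal_span (?Q \<union> {f}) \<noteq> UNIV" by blast
    moreover have "h \<in> ideal_span ?Q" if "f * h \<in> ideal_span ?Q" for h
      using that f(2,3) unfolding sp by blast
    ultimately show ?thesis unfolding regular_sequence_def by simp
  qed
  then have "length [f] \<in> ?L" using f by (intro CollectI exI[of _ "[f]"]) simp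
  then have one: "1 \<in> ?L" by simp
  have le: "length fs \<le> 1" if fs: "regular_sequence ?Q fs" "set fs \<subseteq> irrelevant_ideal" for fs
  proof (rule ccontr)
    assume "\<not> length fs \<le> 1"
    then have len: "1 < length fs" by simp
    define f1 f2 where "f1 = fs ! 0" and "f2 = fs ! 1"
    have len0: "0 < length fs" by (rule le_less_trans[OF zero_le_one len])
    have fm: "f1 \<in> irrelevant_ideal" "f2 \<in> irrelevant_ideal"
      unfolding f1_def f2_def using nth_mem[OF len0] nth_mem[OF len] fs(2) by blast+
    have r1: "h \<in> ?Q" if "f1 * h \<in> ?Q" for h
    proof -
      show ?thesis using len0 fs(1) that sp unfolding regular_sequence_def f1_def by (metis Un_empty_right list.set(1) take0)
    qed
    have "set (take 1 fs) = {f1}" using len unfolding f1_def by (cases fs) auto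
    then have r2: "h \<in> ideal_span (insert f1 ?Q)" if "f2 * h \<in> ideal_span (insert f1 ?Q)" for h
      using fs(1) len that unfolding regular_sequence_def f2_def by (metis Un_insert_right Un_empty_right)
    \<comment> \<open>Multiplying by \<open>\<beta>\<close> moves the element into \<open>B\<close>
      and, by the second property of \<open>\<beta>\<close>, loses nothing modulo \<open>A\<close>;
      so regularity modulo the intersection applies.\<close>
    have f1A: "h \<in> A" if h: "f1 * h \<in> A" for h
    proof -
      have "f1 * (\<beta> * h) = \<beta> * (f1 * h)" by (rule mult.left_commute)
      also have "\<dots> \<in> A" by (rule ideal.subspace_scale[OF A h])
      finally have "f1 * (\<beta> * h) \<in> A" .
      moreover have eq: "f1 * (\<beta> * h) = (f1 * h) * \<beta>" by (simp only: mult_ac)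
      have "f1 * (\<beta> * h) \<in> B" unfolding eq by (rule ideal.subspace_scale[OF B \<beta>(1)])
      ultimately show ?thesis using r1 \<beta>(2) by blast
    qed
    have f1B: "h \<in> B" if h: "f1 * h \<in> B" for h
    proof -
      have "f1 * (\<alpha> * h) = \<alpha> * (f1 * h)" by (rule mult.left_commute)
      also have "\<dots> \<in> B" by (rule ideal.subspace_scale[OF B h])
      finally have "f1 * (\<alpha> * h) \<in> B" .
      moreover have eq: "f1 * (\<alpha> * h) = (f1 * h) * \<alpha>" by (simp only: mult_ac)
      have "f1 * (\<alpha> * h) \<in> A" unfolding eq by (rule ideal.subspace_scale[OF A \<alpha>(1)])
      ultimately show ?thesis using r1 \<alpha>(2) by blast
    qed
    obtain a1 b1 where 1: "a1 \<in> A" "b1 \<in> B" "f1 * g = a1 + b1" using g2[OF fm(1)] by blast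
    obtain a2 b2 where 2: "a2 \<in> A" "b2 \<in> B" "f2 * g = a2 + b2" using g2[OF fm(2)] by blast
    have b1: "b1 = f1 * g - a1" and b2: "b2 = f2 * g - a2" using 1 2 by simp_all
    \<comment> \<open>Eliminating \<open>f1 * f2 * g\<close> writes one element both through
      \<open>b1\<close>, \<open>b2\<close> and through \<open>a1\<close>, \<open>a2\<close>, hence
      in both ideals.\<close>
    have "f2 * b1 - f1 * b2 = f1 * a2 - f2 * a1" unfolding b1 b2 by (simp add: algebra_simps)
    moreover have "f1 * a2 - f2 * a1 \<in> A" using 1 2 A by (intro ideal.subspace_diff ideal.subspace_scale)
    moreover have "f2 * b1 - f1 * b2 \<in> B" using 1 2 B by (intro ideal.subspace_diff ideal.subspace_scale)
    ultimately have "f2 * b1 - f1 * b2 \<in> ?Q" by simp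
    then have "f2 * b1 - b2 * f1 \<in> ideal_span ?Q" unfolding sp by (simp add: mult.commute)
    then have "f2 * b1 \<in> ideal_span (insert f1 ?Q)" unfolding ideal.span_breakdown_eq by blast
    then have "b1 \<in> ideal_span (insert f1 ?Q)" by (rule r2)
    then obtain h where "b1 - h * f1 \<in> ?Q" unfolding ideal.span_breakdown_eq sp by blast
    then have hA: "b1 - h * f1 \<in> A" and hB: "b1 - h * f1 \<in> B" by auto
    have "f1 * (g - h) = a1 + (b1 - h * f1)" using 1(3) by (simp add: algebra_simps)
    then have "f1 * (g - h) \<in> A" using ideal.subspace_add[OF A 1(1) hA] by simp
    then have "g - h \<in> A" by (rule f1A)
    moreover have "f1 * h = b1 - (b1 - h * f1)" by (simp add: mult.commute)
    then have "f1 * h \<in> B" by (rule ssubst) (rule ideal.subspace_diff[OF B 1(2) hB])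
    then have "h \<in> B" by (rule f1B)
    ultimately show False using g1[of "g - h" h] by simp
  qed
  have "?L \<subseteq> {..1}" using le by auto
  then have "finite ?L" by (rule finite_subset) simp
  then show ?thesis unfolding depth_quot_def using one le by (intro Max_eqI) auto
qed

section \<open>The join of two sets of isolated vertices\<close>

lemma coef_koszul:
  "coef (koszul c \<sigma>) m = (\<Sum>u\<in>- \<sigma>. ksign u \<sigma> * (if 0 < expo m u then coef (c (insert u \<sigma>)) (m - uvec u) else 0))"
  unfolding koszul_def coef_sum coef_ksign_mult coef_Var_mult ..

lemma coef_contract_homotopy:
  assumes "0 < expo (m + ind_vec \<sigma>) (ch (m + ind_vec \<sigma>))"
  shows "coef (koszul (contract ch c) \<sigma>) m + coef (contract ch (koszul c) \<sigma>) m = coef (c \<sigma>) m"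
  unfolding coef_eq_mcomp[of _ \<sigma>] using assms by (intro contract_homotopy) (auto simp: lookup_add expo_ind_vec)

lemma coef_koszul_contract_outside:
  assumes "\<not> 0 < expo (m + ind_vec \<sigma>) (ch (m + ind_vec \<sigma>))"
  shows "coef (koszul (contract ch c) \<sigma>) m = 0"
proof -
  have "\<forall>v\<in>\<sigma>. 0 < expo (m + ind_vec \<sigma>) v" by (simp add: lookup_add expo_ind_vec)
  then show ?thesis unfolding coef_eq_mcomp[of _ \<sigma>] by (simp add: mcomp_koszul mcomp_contract_outside[where ch = ch, OF assms])
qed

lemma mon_degree_split: "mon_degree m = deg_on X m + deg_on (- X) (m :: 'v::finite \<Rightarrow>\<^sub>0 nat)"
proof -
  have "mon_degree m = sum (expo m) (X \<union> - X)" unfolding mon_degree_eq_deg_on deg_on_def by simp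
  then show ?thesis unfolding deg_on_def by (subst (asm) sum.union_disjoint) auto
qed

text \<open>By \<open>dep\<close> the variables of \<open>X\<close> are invisible to
  \<open>U1\<close>, so the part of a cycle outside \<open>U1\<close> can be contracted along them.
  Discarding the terms in \<open>U1\<close> can spoil the cycle condition only through terms of
  degree at most \<open>r1 + r2 + 1\<close>, and the hypothesis on \<open>d\<close> excludes
  these.\<close>

lemma contract_restricted_chain:
  fixes C :: "'v::finite set \<Rightarrow> ('v, 'k::field) polys" and r1 r2 :: nat
  assumes X: "X \<noteq> {}" and up: "upset U1"
    and dep: "\<And>m n. (\<And>v. v \<notin> X \<Longrightarrow> expo m v = expo n v) \<Longrightarrow> m \<in> U1 \<Longrightarrow> n \<in> U1"
    and b1: "\<And>m. m \<notin> U1 \<Longrightarrow> deg_on (- X) m \<le> r1" and b2: "\<And>m. m \<notin> U2 \<Longrightarrow> deg_on X m \<le> r2"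
    and p: "1 \<le> p" and hom: "\<And>\<sigma>. card \<sigma> = p \<Longrightarrow> homogeneous d (C \<sigma>)" and d: "int r1 + int r2 + 1 < d"
    and cyc: "\<And>\<sigma>. card \<sigma> + 1 = p \<Longrightarrow> koszul C \<sigma> \<in> mono_ideal (U1 \<inter> U2)"
  obtains b where "\<And>\<sigma> m. card \<sigma> = p \<Longrightarrow> m \<notin> U1 \<inter> U2 \<Longrightarrow>
      coef (koszul b \<sigma>) m = (if m \<in> U1 then 0 else coef (C \<sigma>) m)"
proof
  \<comment> \<open>Only variables of \<open>X\<close> are chosen, so that a contraction does not
    change membership in \<open>U1\<close>; the fallback for fine degrees without them is an
    arbitrary element of \<open>X\<close>.\<close>
  define ch where "ch \<alpha> = (if \<exists>v\<in>X. 0 < expo \<alpha> v then SOME v. v \<in> X \<and> 0 < expo \<alpha> v else SOME v. v \<in> X)"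
    for \<alpha> :: "'v \<Rightarrow>\<^sub>0 nat"
  define E where "E \<sigma> = restr (- U1) (C \<sigma>)" for \<sigma>
  have E: "coef (E \<sigma>) m = (if m \<in> U1 then 0 else coef (C \<sigma>) m)" for \<sigma> m
    by (simp add: E_def coef_restr)
  have chX: "ch \<alpha> \<in> X" for \<alpha>
    unfolding ch_def using someI_ex[of "\<lambda>v. v \<in> X \<and> 0 < expo \<alpha> v"] some_in_eq[of X] X by auto
  have ch0: "expo \<alpha> v = 0" if "\<not> 0 < expo \<alpha> (ch \<alpha>)" "v \<in> X" for \<alpha> v
  proof (rule ccontr)
    assume "expo \<alpha> v \<noteq> 0"
    then have e: "\<exists>v. v \<in> X \<and> 0 < expo \<alpha> v" using that(2) by auto
    then have "ch \<alpha> = (SOME v. v \<in> X \<and> 0 < expo \<alpha> v)" unfolding ch_def by (simp add: Bex_def)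
    then have "0 < expo \<alpha> (ch \<alpha>)" using someI_ex[OF e] by simp
    then show False using that(1) by simp
  qed
  have degE: "int (mon_degree m) = d" "m \<notin> U1" if "coef (E \<sigma>) m \<noteq> 0" "card \<sigma> = p" for \<sigma> m
    using that hom[OF that(2)] unfolding homogeneous_iff by (auto simp: E split: if_splits)
  fix \<sigma> :: "'v set" and m assume \<sigma>: "card \<sigma> = p" and m: "m \<notin> U1 \<inter> U2"
  let ?\<alpha> = "m + ind_vec \<sigma>" and ?x = "ch (m + ind_vec \<sigma>)"
  have "coef (koszul (contract ch E) \<sigma>) m = coef (E \<sigma>) m"
  proof (cases "0 < expo ?\<alpha> ?x")
    case False
    have "coef (E \<sigma>) m = 0"
    proof (rule ccontr)
      assume ne: "coef (E \<sigma>) m \<noteq> 0"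
      have "deg_on X m = 0" unfolding deg_on_def using ch0[OF False] by (simp add: lookup_add)
      moreover have "deg_on (- X) m \<le> r1" using degE(2)[OF ne \<sigma>] b1 by blast
      ultimately have "mon_degree m \<le> r1" unfolding mon_degree_split[of m X] by simp
      then show False using degE(1)[OF ne \<sigma>] d by simp
    qed
    then show ?thesis using coef_koszul_contract_outside[where ch = ch, OF False] by simp
  next
    case True
    have "coef (contract ch (koszul E) \<sigma>) m = 0"
    proof (cases "?x \<in> \<sigma>")
      case x: True
      define \<tau> where "\<tau> = \<sigma> - {?x}"
      define m' where "m' = m + uvec ?x"
      have \<tau>: "card \<tau> + 1 = p" unfolding \<tau>_def using card_Suc_Diff1[OF finite x] \<sigma> by simp
      have ins: "card (insert u \<tau>) = p" if "u \<notin> \<tau>" for u using \<tau> that by simp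
      have "coef (koszul E \<tau>) m' = 0"
      proof (cases "m \<in> U1")
        case False
        have m'1: "m' \<notin> U1"
        proof
          assume "m' \<in> U1"
          then have "m \<in> U1"
            by (rule dep[rotated]) (use chX[of ?\<alpha>] in \<open>auto simp: m'_def lookup_add lookup_single when_def\<close>)
          then show False using False by simp
        qed
        have "m' - uvec u \<notin> U1" if "0 < expo m' u" for u
        proof
          assume "m' - uvec u \<in> U1"
          then have "(m' - uvec u) + uvec u \<in> U1" using up unfolding upset_def by blast
          moreover have "(m' - uvec u) + uvec u = m'"
            using monom_diff_add[of "uvec u" m'] that uvec_le_iff[of u m'] by (simp add: add.commute)
          ultimately show False using m'1 by simp
        qed
        \<comment> \<open>All monomials entering this coefficient lie outside \<open>U1\<close>,
          where \<open>E\<close> agrees with \<open>C\<close>.\<close>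
        then have "coef (koszul E \<tau>) m' = coef (koszul C \<tau>) m'"
          unfolding coef_koszul by (intro sum.cong) (auto simp: E)
        also have "\<dots> = 0" using cyc[OF \<tau>] m'1 unfolding mem_mono_ideal_iff by blast
        finally show ?thesis .
      next
        case mU1: True
        then have mU2: "m \<notin> U2" using m by blast
        have "coef (E (insert u \<tau>)) (m' - uvec u) = 0" if u: "u \<notin> \<tau>" for u
        proof (rule ccontr)
          assume ne: "coef (E (insert u \<tau>)) (m' - uvec u) \<noteq> 0"
          \<comment> \<open>Origin of the 1 in the bound: the contraction has added one variable of
            \<open>X\<close> to a monomial outside \<open>U2\<close>.\<close>
          have "deg_on X (m' - uvec u) \<le> deg_on X m'"
            unfolding deg_on_def by (intro sum_mono) (simp add: lookup_minus)
          also have "\<dots> \<le> deg_on X m + 1" unfolding m'_def deg_on_add deg_on_uvec[OF finite] by simp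
          also have "\<dots> \<le> r2 + 1" using b2[OF mU2] by simp
          finally have "deg_on X (m' - uvec u) \<le> r2 + 1" .
          moreover have "deg_on (- X) (m' - uvec u) \<le> r1" by (intro b1 degE(2)[OF ne] ins u)
          ultimately have "mon_degree (m' - uvec u) \<le> r1 + r2 + 1" unfolding mon_degree_split[of _ X] by simp
          then show False using degE(1)[OF ne ins[OF u]] d by simp
        qed
        then show ?thesis unfolding coef_koszul by (intro sum.neutral) auto
      qed
      then show ?thesis unfolding coef_contract using x by (simp add: \<tau>_def m'_def)
    qed (simp add: coef_contract)
    then show ?thesis using coef_contract_homotopy[where ch = ch and c = E, OF True] by simp
  qed
  then show "coef (koszul (contract ch E) \<sigma>) m = (if m \<in> U1 then 0 else coef (C \<sigma>) m)" unfolding E .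
qed

section \<open>Powers, symbolic powers, depth and regularity for the join\<close>

locale join_weights =
  fixes X Y :: "'v::finite set" and w :: "'v \<Rightarrow> nat"
  assumes X: "X \<noteq> {}" and Y: "Y \<noteq> {}" and disj: "X \<inter> Y = {}" and cover: "X \<union> Y = UNIV"
    and w: "\<And>y. y \<in> Y \<Longrightarrow> 1 \<le> w y"
begin

text \<open>The largest s for which the monomial lies in the s-th power of the ideal of all y^w(y):
  each \<open>y\<close> contributes its complete blocks of length \<open>w y\<close>. Thus
  \<open>UX t\<close> and \<open>UY t\<close> are the monomials of the t-th powers of (x) and
  (y^w).\<close>

definition weight_deg :: "('v \<Rightarrow>\<^sub>0 nat) \<Rightarrow> nat" where
  "weight_deg m = (\<Sum>y\<in>Y. expo m y div w y)"

definition UX :: "nat \<Rightarrow> ('v \<Rightarrow>\<^sub>0 nat) set" where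
  "UX t = {m. t \<le> deg_on X m}"

definition UY :: "nat \<Rightarrow> ('v \<Rightarrow>\<^sub>0 nat) set" where
  "UY t = {m. t \<le> weight_deg m}"

lemma compl_X: "- X = Y" and compl_Y: "- Y = X"
  using disj cover by auto

lemma weight_deg_add: "weight_deg m + weight_deg n \<le> weight_deg (m + n)"
  unfolding weight_deg_def sum.distrib[symmetric] by (intro sum_mono) (simp add: lookup_add, metis div_add1_eq le_add1)

lemma upset_UX: "upset (UX t)"
  by (auto simp: upset_def UX_def deg_on_add)

lemma upset_UY: "upset (UY t)"
  unfolding upset_def UY_def
proof (intro allI impI CollectI)
  fix m n assume "m \<in> {m. t \<le> weight_deg m}"
  then show "t \<le> weight_deg (m + n)" using weight_deg_add[of m n] by simp
qed

lemma upset_UXY: "upset (UX t \<inter> UY t)"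
  using upset_UX upset_UY unfolding upset_def by blast

lemma UX_dep: "(\<And>v. v \<in> X \<Longrightarrow> expo m v = expo n v) \<Longrightarrow> m \<in> UX t \<Longrightarrow> n \<in> UX t"
  unfolding UX_def deg_on_def by simp

lemma UY_dep: "(\<And>v. v \<in> Y \<Longrightarrow> expo m v = expo n v) \<Longrightarrow> m \<in> UY t \<Longrightarrow> n \<in> UY t"
  unfolding UY_def weight_deg_def by simp

definition edge_monom :: "'v \<Rightarrow> 'v \<Rightarrow> 'v \<Rightarrow>\<^sub>0 nat" where
  "edge_monom x y = uvec x + Poly_Mapping.single y (w y)"

lemma deg_X_add_edge:
  assumes "x \<in> X" "y \<in> Y" shows "deg_on X (n + edge_monom x y) = deg_on X n + 1"
proof -
  have "deg_on X (Poly_Mapping.single y (w y)) = 0"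
    unfolding deg_on_def using assms disj by (intro sum.neutral) (auto simp: lookup_single when_def)
  then show ?thesis using assms by (simp add: edge_monom_def deg_on_add deg_on_uvec[simplified])
qed

lemma weight_deg_add_edge:
  assumes "x \<in> X" "y \<in> Y" shows "weight_deg (n + edge_monom x y) = weight_deg n + 1"
proof -
  have "expo (n + edge_monom x y) v div w v = expo n v div w v + (if v = y then 1 else 0)" if "v \<in> Y" for v
  proof -
    have "x \<noteq> v" using assms that disj by auto
    then show ?thesis using w[OF that] by (auto simp: edge_monom_def lookup_add lookup_single when_def)
  qed
  then have "weight_deg (n + edge_monom x y) = (\<Sum>v\<in>Y. expo n v div w v + (if v = y then 1 else 0))"
    unfolding weight_deg_def by simp
  then show ?thesis using assms by (simp add: weight_deg_def sum.distrib)
qed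

text \<open>Removing an edge monomial lowers both degrees by exactly one, so the two conditions can
  be met one factor at a time. This is why the powers of \<open>I\<close> are intersections.\<close>

lemma split_edge:
  assumes "m \<in> UX (Suc t) \<inter> UY (Suc t)"
  obtains x y n where "x \<in> X" "y \<in> Y" "m = n + edge_monom x y" "n \<in> UX t \<inter> UY t"
proof -
  have "deg_on X m \<noteq> 0" "weight_deg m \<noteq> 0" using assms unfolding UX_def UY_def by auto
  then obtain x y where x: "x \<in> X" "expo m x \<noteq> 0" and y: "y \<in> Y" "expo m y div w y \<noteq> 0"
    unfolding deg_on_def weight_deg_def by (meson sum.neutral)
  have "w y \<le> expo m y" using y(2) by (metis div_less not_le)
  moreover have "x \<noteq> y" using x y disj by auto
  ultimately have "edge_monom x y + (m - edge_monom x y) = m"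
    using x by (intro monom_diff_add) (auto simp: edge_monom_def lookup_add lookup_single when_def)
  then have m: "m = (m - edge_monom x y) + edge_monom x y" by (simp add: add.commute)
  have "m - edge_monom x y \<in> UX t \<inter> UY t"
    using assms deg_X_add_edge[OF x(1) y(1), of "m - edge_monom x y"] weight_deg_add_edge[OF x(1) y(1), of "m - edge_monom x y"]
    unfolding m[symmetric] UX_def UY_def by simp
  then show ?thesis using that x(1) y(1) m by blast
qed

lemma edge_span:
  "ideal_span {Var x * Var y ^ w y | x y. x \<in> X \<and> y \<in> Y} = (mono_ideal (UX 1 \<inter> UY 1) :: ('v, 'k::field) polys set)"
proof -
  have pow: "(Var y :: ('v, 'k) polys) ^ n = mono_of (Poly_Mapping.single y n)" for y n
    by (induction n) (simp_all add: Var_def mult_single single_add[symmetric])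
  have eq: "Var x * Var y ^ w y = (mono_of (edge_monom x y) :: ('v, 'k) polys)" for x y
    unfolding pow by (simp add: Var_def mult_single edge_monom_def)
  have "edge_monom x y \<in> UX 1 \<inter> UY 1" if "x \<in> X" "y \<in> Y" for x y
    using deg_X_add_edge[OF that, of 0] weight_deg_add_edge[OF that, of 0] by (simp add: UX_def UY_def)
  then have "ideal_span {Var x * Var y ^ w y | x y. x \<in> X \<and> y \<in> Y} \<subseteq> (mono_ideal (UX 1 \<inter> UY 1) :: ('v, 'k) polys set)"
    unfolding eq by (intro ideal.span_minimal is_ideal_mono_ideal upset_UXY) (auto intro!: single_in_mono_ideal)
  moreover have "mono_of ` (UX 1 \<inter> UY 1) \<subseteq> (ideal_span {Var x * Var y ^ w y | x y. x \<in> X \<and> y \<in> Y} :: ('v, 'k) polys set)"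
  proof
    fix p :: "('v, 'k) polys" assume "p \<in> mono_of ` (UX 1 \<inter> UY 1)"
    then obtain m where m: "m \<in> UX (Suc 0) \<inter> UY (Suc 0)" "p = mono_of m" by auto
    obtain x y n where xy: "x \<in> X" "y \<in> Y" "m = n + edge_monom x y" using split_edge[OF m(1)] by metis
    have "mono_of n * (Var x * Var y ^ w y) \<in> (ideal_span {Var x * Var y ^ w y | x y. x \<in> X \<and> y \<in> Y} :: ('v, 'k) polys set)"
      using xy by (intro ideal.span_scale ideal.span_base) blast
    moreover have "mono_of n * (Var x * Var y ^ w y) = p"
      unfolding eq m(2) xy(3) by (simp add: mult_single)
    ultimately show "p \<in> ideal_span {Var x * Var y ^ w y | x y. x \<in> X \<and> y \<in> Y}" by simp
  qed
  ultimately show ?thesis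
    unfolding mono_ideal_eq_span[OF upset_UXY] using ideal.span_minimal[OF _ ideal.subspace_span] by blast
qed

lemma ideal_power_eq: "ideal_power (mono_ideal (UX 1 \<inter> UY 1)) t = (mono_ideal (UX t \<inter> UY t) :: ('v, 'k::field) polys set)"
proof (induction t)
  case 0
  show ?case by (simp add: UX_def UY_def mono_ideal_def)
next
  case (Suc t)
  let ?G = "{a * b | a b. a \<in> mono_ideal (UX 1 \<inter> UY 1) \<and> b \<in> (mono_ideal (UX t \<inter> UY t) :: ('v, 'k) polys set)}"
  have "?G \<subseteq> mono_ideal (UX (Suc t) \<inter> UY (Suc t))"
  proof
    fix p assume "p \<in> ?G"
    then obtain a b where ab: "p = a * b" "a \<in> mono_ideal (UX 1 \<inter> UY 1)" "b \<in> mono_ideal (UX t \<inter> UY t)" by blast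
    show "p \<in> mono_ideal (UX (Suc t) \<inter> UY (Suc t))"
      unfolding mono_ideal_def
    proof (intro CollectI subsetI)
      fix m assume "m \<in> Poly_Mapping.keys p"
      then have "m \<in> {m1 + m2 | m1 m2. m1 \<in> Poly_Mapping.keys a \<and> m2 \<in> Poly_Mapping.keys b}"
        unfolding ab(1) by (rule subsetD[OF keys_mult])
      then obtain m1 m2 where m: "m = m1 + m2" "m1 \<in> Poly_Mapping.keys a" "m2 \<in> Poly_Mapping.keys b"
        by blast
      then have "m1 \<in> UX 1 \<inter> UY 1" "m2 \<in> UX t \<inter> UY t" using ab unfolding mono_ideal_def by auto
      then show "m \<in> UX (Suc t) \<inter> UY (Suc t)"
        using weight_deg_add[of m1 m2] unfolding m(1) UX_def UY_def by (auto simp: deg_on_add)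
    qed
  qed
  then have "ideal_span ?G \<subseteq> mono_ideal (UX (Suc t) \<inter> UY (Suc t))"
    by (intro ideal.span_minimal is_ideal_mono_ideal upset_UXY)
  moreover have "mono_of ` (UX (Suc t) \<inter> UY (Suc t)) \<subseteq> ideal_span ?G"
  proof
    fix p :: "('v, 'k) polys" assume "p \<in> mono_of ` (UX (Suc t) \<inter> UY (Suc t))"
    then obtain m where m: "m \<in> UX (Suc t) \<inter> UY (Suc t)" "p = mono_of m" by auto
    obtain x y n where xy: "x \<in> X" "y \<in> Y" "m = n + edge_monom x y" "n \<in> UX t \<inter> UY t"
      using split_edge[OF m(1)] by metis
    have "edge_monom x y \<in> UX 1 \<inter> UY 1"
      using deg_X_add_edge[OF xy(1,2), of 0] weight_deg_add_edge[OF xy(1,2), of 0] by (simp add: UX_def UY_def)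
    then have "mono_of (edge_monom x y) * mono_of n \<in> ?G" using xy(4) single_in_mono_ideal by blast
    moreover have "mono_of (edge_monom x y) * mono_of n = p"
      unfolding m(2) xy(3) by (simp add: mult_single add.commute)
    ultimately show "p \<in> ideal_span ?G" using ideal.span_base[of p ?G] by simp
  qed
  then have "mono_ideal (UX (Suc t) \<inter> UY (Suc t)) \<subseteq> ideal_span ?G"
    unfolding mono_ideal_eq_span[OF upset_UXY] by (rule ideal.span_minimal[OF _ ideal.subspace_span])
  ultimately show ?case unfolding ideal_power.simps ideal_mult_def Suc.IH by blast
qed

lemma primary_X:
  fixes g f :: "('v, 'k::field) polys"
  assumes "a \<in> Poly_Mapping.keys g" "deg_on X a = 0" "g * f \<in> mono_ideal (UX t)" shows "f \<in> mono_ideal (UX t)"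
  by (rule mono_ideal_primary[OF upset_UX UX_dep assms])

lemma primary_Y:
  fixes g f :: "('v, 'k::field) polys"
  assumes "a \<in> Poly_Mapping.keys g" "deg_on Y a = 0" "g * f \<in> mono_ideal (UY t)" shows "f \<in> mono_ideal (UY t)"
  by (rule mono_ideal_primary[OF upset_UY UY_dep assms])

end

lemma is_prime_mono_ideal:
  fixes W :: "'v::finite set"
  shows "is_prime_ideal (mono_ideal {m. 1 \<le> deg_on W m} :: ('v, 'k::field) polys set)"
proof -
  let ?U = "{m. 1 \<le> deg_on W m}"
  have up: "upset ?U" by (auto simp: upset_def deg_on_add)
  have "(1 :: ('v, 'k) polys) \<notin> mono_ideal ?U" by (simp add: mono_ideal_def deg_on_def)
  moreover have "b \<in> mono_ideal ?U" if ab: "a * b \<in> mono_ideal ?U" "a \<notin> mono_ideal ?U" for a b :: "('v, 'k) polys"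
  proof -
    obtain m where m: "m \<in> Poly_Mapping.keys a" "deg_on W m = 0" using ab(2) unfolding mono_ideal_def by force
    show ?thesis
      by (rule mono_ideal_primary[OF up _ m ab(1)]) (simp add: deg_on_def)
  qed
  ultimately show ?thesis unfolding is_prime_ideal_def using is_ideal_mono_ideal[OF up] by blast
qed

lemma mult_mono_mem_mono_ideal_iff:
  "g * mono_of b \<in> mono_ideal U \<longleftrightarrow> (\<forall>a. coef g a \<noteq> 0 \<longrightarrow> a + b \<in> U)"
proof -
  have 1: "coef (mono_of b * g) (b + a) = coef g a" for a
    by (simp add: coef_mult_single lookup_add)
  show ?thesis
    unfolding mult.commute[of g]
  proof
    assume H: "mono_of b * g \<in> mono_ideal U"
    show "\<forall>a. coef g a \<noteq> 0 \<longrightarrow> a + b \<in> U"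
    proof (intro allI impI)
      fix a assume "coef g a \<noteq> 0"
      then have "coef (mono_of b * g) (b + a) \<noteq> 0" unfolding 1 .
      then have "b + a \<in> U" using H unfolding mem_mono_ideal_iff by blast
      then show "a + b \<in> U" by (simp add: add.commute)
    qed
  next
    assume H: "\<forall>a. coef g a \<noteq> 0 \<longrightarrow> a + b \<in> U"
    show "mono_of b * g \<in> mono_ideal U"
      unfolding mem_mono_ideal_iff
    proof (intro allI impI)
      fix m assume m: "m \<notin> U"
      show "coef (mono_of b * g) m = 0"
      proof (cases "\<forall>v. expo b v \<le> expo m v")
        case True
        then have "b + (m - b) = m" by (intro monom_diff_add) blast
        then have "(m - b) + b \<notin> U" using m by (simp add: add.commute)
        then have "coef g (m - b) = 0" using H by blast
        then show ?thesis by (simp add: coef_mult_single)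
      next
        case False
        show ?thesis unfolding coef_mult_single if_not_P[OF False] ..
      qed
    qed
  qed
qed

context join_weights
begin

lemma expo_Abs: "expo (Abs_poly_mapping f) = (f :: 'v \<Rightarrow> nat)"
  by (rule lookup_Abs_poly_mapping) simp

text \<open>The witness is y^w(y) for any \<open>y\<close>: it already supplies a complete block, so
  exactly a variable of \<open>X\<close> is missing.\<close>

lemma prime_X_associated:
  "(mono_ideal {m. 1 \<le> deg_on X m} :: ('v, 'k::field) polys set) \<in> associated_primes (mono_ideal (UX 1 \<inter> UY 1))"
proof -
  obtain y where y: "y \<in> Y" using Y by blast
  let ?b = "Poly_Mapping.single y (w y)"
  have dX: "deg_on X (a + ?b) = deg_on X a" for a
    unfolding deg_on_def using y disj by (intro sum.cong) (auto simp: lookup_add lookup_single when_def)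
  have H: "a + ?b \<in> UX 1 \<inter> UY 1 \<longleftrightarrow> 1 \<le> deg_on X a" for a
  proof -
    have "1 \<le> (\<Sum>v\<in>{y}. expo (a + ?b) v div w v)" using w[OF y] by (simp add: lookup_add)
    also have "\<dots> \<le> weight_deg (a + ?b)" unfolding weight_deg_def using y by (intro sum_mono2) auto
    finally show ?thesis using dX[of a] by (simp add: UX_def UY_def)
  qed
  have "mono_ideal {m. 1 \<le> deg_on X m} = {g :: ('v, 'k) polys. g * mono_of ?b \<in> mono_ideal (UX 1 \<inter> UY 1)}"
    unfolding mult_mono_mem_mono_ideal_iff H by (auto simp: mono_ideal_def in_keys_iff)
  then show ?thesis unfolding associated_primes_def using is_prime_mono_ideal by blast
qed

lemma prime_Y_associated:
  "(mono_ideal {m. 1 \<le> deg_on Y m} :: ('v, 'k::field) polys set) \<in> associated_primes (mono_ideal (UX 1 \<inter> UY 1))"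
proof -
  obtain x where x: "x \<in> X" using X by blast
  \<comment> \<open>All exponents on \<open>Y\<close> are one short of a block, so any further
    variable of \<open>Y\<close> completes one; a single variable of \<open>X\<close> meets the
    other condition.\<close>
  define b where "b = Abs_poly_mapping (\<lambda>v. if v \<in> Y then w v - 1 else if v = x then 1 else 0 :: nat)"
  have exb: "expo b v = (if v \<in> Y then w v - 1 else if v = x then 1 else 0)" for v
    unfolding b_def expo_Abs ..
  have H: "a + b \<in> UX 1 \<inter> UY 1 \<longleftrightarrow> 1 \<le> deg_on Y a" for a
  proof -
    have xY: "x \<notin> Y" using x disj by blast
    have "1 \<le> (\<Sum>v\<in>{x}. expo (a + b) v)" using xY by (simp add: lookup_add exb)
    also have "\<dots> \<le> deg_on X (a + b)" unfolding deg_on_def using x by (intro sum_mono2) auto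
    finally have 1: "a + b \<in> UX 1" by (simp add: UX_def)
    have "expo (a + b) y div w y = 0 \<longleftrightarrow> expo a y = 0" if y: "y \<in> Y" for y
      using w[OF y] y by (auto simp: lookup_add exb div_eq_0_iff)
    then have "weight_deg (a + b) = 0 \<longleftrightarrow> deg_on Y a = 0" unfolding weight_deg_def deg_on_def by simp
    then show ?thesis using 1 by (auto simp: UY_def)
  qed
  have "mono_ideal {m. 1 \<le> deg_on Y m} = {g :: ('v, 'k) polys. g * mono_of b \<in> mono_ideal (UX 1 \<inter> UY 1)}"
    unfolding mult_mono_mem_mono_ideal_iff H by (auto simp: mono_ideal_def in_keys_iff)
  then show ?thesis unfolding associated_primes_def using is_prime_mono_ideal by blast
qed

text \<open>The two associated primes already force an element of the symbolic power into both
  primary components, and the opposite inclusion holds at every prime; so no list of all associated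
  primes enters.\<close>

lemma symbolic_power_eq:
  "symbolic_power (mono_ideal (UX 1 \<inter> UY 1)) t = (mono_ideal (UX t \<inter> UY t) :: ('v, 'k::field) polys set)"
proof
  let ?I = "mono_ideal (UX 1 \<inter> UY 1) :: ('v, 'k) polys set"
  let ?PX = "mono_ideal {m. 1 \<le> deg_on X m} :: ('v, 'k) polys set"
  let ?PY = "mono_ideal {m. 1 \<le> deg_on Y m} :: ('v, 'k) polys set"
  have key: "\<exists>a\<in>Poly_Mapping.keys g. deg_on W a = 0" if "g \<notin> mono_ideal {m. 1 \<le> deg_on W m}" for g :: "('v, 'k) polys" and W
    using that unfolding mono_ideal_def by force
  have "loc_contraction ?PX (mono_ideal (UX t)) \<subseteq> mono_ideal (UX t)"
    by (rule loc_contraction_primary[OF is_prime_mono_ideal is_ideal_mono_ideal[OF upset_UX]])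
      (use key primary_X in blast)
  moreover have "loc_contraction ?PY (mono_ideal (UY t)) \<subseteq> mono_ideal (UY t)"
    by (rule loc_contraction_primary[OF is_prime_mono_ideal is_ideal_mono_ideal[OF upset_UY]])
      (use key primary_Y in blast)
  moreover have "symbolic_power ?I t \<subseteq> loc_contraction ?PX (mono_ideal (UX t \<inter> UY t))"
    "symbolic_power ?I t \<subseteq> loc_contraction ?PY (mono_ideal (UX t \<inter> UY t))"
    unfolding symbolic_power_def ideal_power_eq using prime_X_associated prime_Y_associated by blast+
  ultimately show "symbolic_power ?I t \<subseteq> mono_ideal (UX t \<inter> UY t)"
    using loc_contraction_mono[of "mono_ideal (UX t \<inter> UY t)" "mono_ideal (UX t)" ?PX]
      loc_contraction_mono[of "mono_ideal (UX t \<inter> UY t)" "mono_ideal (UY t)" ?PY]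
    unfolding mono_ideal_Int by blast
  show "mono_ideal (UX t \<inter> UY t) \<subseteq> symbolic_power ?I t"
    unfolding symbolic_power_def ideal_power_eq
    using loc_contraction_superset by (auto simp: associated_primes_def)
qed

text \<open>Outside both \<open>UX t\<close> and \<open>UY t\<close>, but multiplication by any variable leads into one of them.\<close>

definition socle_monom :: "'v \<Rightarrow> 'v \<Rightarrow> nat \<Rightarrow> 'v \<Rightarrow>\<^sub>0 nat" where
  "socle_monom x y t = Abs_poly_mapping (\<lambda>v. if v \<in> Y then (if v = y then (t - 1) * w v else 0) + (w v - 1)
     else if v = x then t - 1 else 0)"

lemma expo_socle:
  "expo (socle_monom x y t) v = (if v \<in> Y then (if v = y then (t - 1) * w v else 0) + (w v - 1)
     else if v = x then t - 1 else 0)"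
  unfolding socle_monom_def expo_Abs ..

lemma deg_X_socle:
  assumes "x \<in> X" shows "deg_on X (socle_monom x y t) = t - 1"
proof -
  have "deg_on X (socle_monom x y t) = (\<Sum>v\<in>X. if v = x then t - 1 else 0)"
    unfolding deg_on_def using disj by (intro sum.cong) (auto simp: expo_socle)
  then show ?thesis using assms by simp
qed

lemma deg_Y_socle:
  assumes "y \<in> Y" shows "deg_on Y (socle_monom x y t) = (t - 1) * w y + (\<Sum>v\<in>Y. w v - 1)"
proof -
  have "deg_on Y (socle_monom x y t) = (\<Sum>v\<in>Y. (if v = y then (t - 1) * w y else 0) + (w v - 1))"
    unfolding deg_on_def by (intro sum.cong) (auto simp: expo_socle)
  then show ?thesis using assms by (simp add: sum.distrib)
qed

lemma expo_socle_Y: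
  "v \<in> Y \<Longrightarrow> expo (socle_monom x y t) v = (if v = y then t - 1 else 0) * w v + (w v - 1)"
  by (simp add: expo_socle)

lemma div_block: "1 \<le> c \<Longrightarrow> (k * c + (c - 1)) div c = (k :: nat)"
  by (rule div_nat_eqI) (auto simp: algebra_simps)

lemma weight_deg_socle:
  assumes y: "y \<in> Y" shows "weight_deg (socle_monom x y t) = t - 1"
proof -
  have "weight_deg (socle_monom x y t) = (\<Sum>v\<in>Y. if v = y then t - 1 else 0)"
    unfolding weight_deg_def
  proof (intro sum.cong refl)
    fix v assume v: "v \<in> Y"
    show "expo (socle_monom x y t) v div w v = (if v = y then t - 1 else 0)"
      unfolding expo_socle_Y[OF v] by (rule div_block[OF w[OF v]])
  qed
  then show ?thesis using y by simp
qed

text \<open>Every exponent on \<open>Y\<close> is one short of a multiple of its weight, so a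
  further variable completes a block.\<close>

lemma weight_deg_socle_Suc:
  assumes y: "y \<in> Y" and u: "u \<in> Y" and t: "1 \<le> t"
  shows "t \<le> weight_deg (socle_monom x y t + uvec u)"
proof -
  have "weight_deg (socle_monom x y t + uvec u) = (\<Sum>v\<in>Y. (if v = y then t - 1 else 0) + (if v = u then 1 else 0))"
    unfolding weight_deg_def
  proof (intro sum.cong refl)
    fix v assume v: "v \<in> Y"
    define k where "k = (if v = y then t - 1 else 0)"
    show "expo (socle_monom x y t + uvec u) v div w v = (if v = y then t - 1 else 0) + (if v = u then 1 else 0)"
      unfolding lookup_add expo_socle_Y[OF v] k_def[symmetric]
    proof (cases "v = u")
      case True
      have "k * w v + (w v - 1) + 1 = (k + 1) * w v" using w[OF v] by simp
      then show "(k * w v + (w v - 1) + expo (uvec u) v) div w v = k + (if v = u then 1 else 0)"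
        using True w[OF v] by simp
    next
      case False
      then show "(k * w v + (w v - 1) + expo (uvec u) v) div w v = k + (if v = u then 1 else 0)"
        using div_block[OF w[OF v], of k] by (simp add: lookup_single)
    qed
  qed
  then show ?thesis using y u t by (simp add: sum.distrib)
qed

text \<open>\<open>x + y\<close> has a term free of \<open>X\<close> and a term free of
  \<open>Y\<close>, which makes it regular modulo both primary ideals. The powers of
  \<open>x\<close> and \<open>y\<close> used as \<open>\<alpha>\<close> and \<open>\<beta>\<close>
  lie in one ideal and avoid the variables of the other.\<close>

lemma depth_quot_join:
  assumes t: "1 \<le> t"
  shows "depth_quot (mono_ideal (UX t \<inter> UY t) :: ('v, 'k::field) polys set) = 1"
proof -
  obtain x y where x: "x \<in> X" and y: "y \<in> Y" using X Y by blast
  have xy: "x \<noteq> y" "x \<notin> Y" "y \<notin> X" using x y disj by auto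
  let ?A = "mono_ideal (UX t) :: ('v, 'k) polys set" and ?B = "mono_ideal (UY t) :: ('v, 'k) polys set"
  let ?m = "socle_monom x y t"
  let ?f = "Var x + Var y :: ('v, 'k) polys"
  have cf: "coef ?f m = (1 when uvec x = m) + (1 when uvec y = m)" for m
    by (simp add: Var_def lookup_add lookup_single)
  have ne: "uvec x \<noteq> uvec y" using xy(1) by (metis inj_single lookup_single_eq lookup_single_not_eq one_neq_zero)
  have kx: "uvec x \<in> Poly_Mapping.keys ?f" and ky: "uvec y \<in> Poly_Mapping.keys ?f"
    unfolding in_keys_iff cf using ne by auto
  have dx: "deg_on Y (uvec x) = 0" and dy: "deg_on X (uvec y) = 0"
    unfolding deg_on_uvec[OF finite] using xy by simp_all
  have m: "?m \<notin> UX t" "?m \<notin> UY t"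
    using deg_X_socle[OF x, of y t] weight_deg_socle[OF y, of x t] t by (auto simp: UX_def UY_def)
  have grow: "a + ?m \<in> UX t \<union> UY t" if "a \<noteq> 0" for a
  proof -
    obtain u where u: "0 < expo a u" using \<open>a \<noteq> 0\<close> by (metis gr0I lookup_zero poly_mapping_eqI)
    have "uvec u + (a - uvec u) = a" using u uvec_le_iff[of u a] by (intro monom_diff_add) blast
    then have a: "a + ?m = (?m + uvec u) + (a - uvec u)" by (metis add.assoc add.commute)
    have "?m + uvec u \<in> UX t \<or> ?m + uvec u \<in> UY t"
    proof (cases "u \<in> X")
      case True
      then have "deg_on X (?m + uvec u) = t - 1 + 1"
        using deg_X_socle[OF x, of y t] by (simp only: deg_on_add deg_on_uvec[OF finite] if_True)
      then show ?thesis using t by (simp add: UX_def)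
    next
      case False
      then have "u \<in> Y" using cover by auto
      then show ?thesis using weight_deg_socle_Suc[OF y _ t] by (simp add: UY_def)
    qed
    then show ?thesis unfolding a using upset_UX upset_UY unfolding upset_def by blast
  qed
  have "depth_quot (?A \<inter> ?B) = 1"
  proof (rule depth_quot_eq_1[where g = "mono_of ?m" and f = ?f and \<alpha> = "mono_of (Poly_Mapping.single x t)"
        and \<beta> = "mono_of (Poly_Mapping.single y (t * w y))"])
    show "?A \<subseteq> irrelevant_ideal"
      unfolding irrelevant_ideal_eq using t by (auto simp: mem_mono_ideal_iff UX_def deg_on_def)
    show "mono_of ?m \<noteq> a + b" if "a \<in> ?A" "b \<in> ?B" for a b
    proof
      assume "mono_of ?m = a + b"
      then have "coef a ?m + coef b ?m = 1" by (metis lookup_add lookup_single_eq)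
      then show False using that m by (simp add: mem_mono_ideal_iff)
    qed
    show "\<exists>a\<in>?A. \<exists>b\<in>?B. p * mono_of ?m = a + b" if p: "p \<in> irrelevant_ideal" for p
    proof -
      let ?q = "p * mono_of ?m"
      have q: "?q \<in> mono_ideal (UX t \<union> UY t)"
        unfolding mult_mono_mem_mono_ideal_iff
      proof (intro allI impI)
        fix a assume "coef p a \<noteq> 0"
        then have "a \<noteq> 0" using p unfolding irrelevant_ideal_eq by auto
        then show "a + ?m \<in> UX t \<union> UY t" by (rule grow)
      qed
      have "restr (UX t) ?q \<in> ?A" by (simp add: mem_mono_ideal_iff coef_restr)
      moreover have "restr (- UX t) ?q \<in> ?B" using q by (auto simp: mem_mono_ideal_iff coef_restr)
      moreover have "?q = restr (UX t) ?q + restr (- UX t) ?q"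
        by (rule poly_mapping_eqI) (simp add: lookup_add coef_restr)
      ultimately show ?thesis by blast
    qed
    have "t \<le> weight_deg (Poly_Mapping.single y (t * w y))"
    proof -
      have "weight_deg (Poly_Mapping.single y (t * w y)) = (\<Sum>v\<in>Y. if v = y then t else 0)"
        unfolding weight_deg_def using w[OF y] by (intro sum.cong) (auto simp: lookup_single when_def)
      then show ?thesis using y by simp
    qed
    then show "mono_of (Poly_Mapping.single y (t * w y)) \<in> ?B" by (intro single_in_mono_ideal) (simp add: UY_def)
    show "h \<in> ?A" if "mono_of (Poly_Mapping.single y (t * w y)) * h \<in> ?A" for h
      by (rule primary_X[OF _ _ that])
        (use xy in \<open>auto simp: deg_on_def lookup_single when_def intro!: sum.neutral\<close>)
    have "deg_on X (Poly_Mapping.single x t) = (\<Sum>v\<in>X. if v = x then t else 0)"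
      unfolding deg_on_def by (intro sum.cong) (auto simp: lookup_single when_def)
    then show "mono_of (Poly_Mapping.single x t) \<in> ?A" using x by (intro single_in_mono_ideal) (simp add: UX_def)
    show "h \<in> ?B" if "mono_of (Poly_Mapping.single x t) * h \<in> ?B" for h
      by (rule primary_Y[OF _ _ that])
        (use xy in \<open>auto simp: deg_on_def lookup_single when_def intro!: sum.neutral\<close>)
    show "?f \<in> irrelevant_ideal"
      unfolding irrelevant_ideal_def by (intro ideal.span_add ideal.span_base) auto
    show "h \<in> ?A" if "?f * h \<in> ?A" for h by (rule primary_X[OF ky dy that])
    show "h \<in> ?B" if "?f * h \<in> ?B" for h by (rule primary_Y[OF kx dx that])
  qed (intro is_ideal_mono_ideal upset_UX upset_UY)+
  then show ?thesis by (simp add: mono_ideal_Int)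
qed

section \<open>Both bounds for the regularity\<close>

lemma deg_Y_le:
  assumes t: "1 \<le> t" and W: "\<And>y. y \<in> Y \<Longrightarrow> w y \<le> W" and m: "m \<notin> UY t"
  shows "deg_on Y m \<le> (t - 1) * W + (\<Sum>v\<in>Y. w v - 1)"
proof -
  \<comment> \<open>Division with remainder: a complete block costs at most \<open>W\<close>, a
    remainder at most \<open>w v - 1\<close>. The socle monomial has all remainders of this
    size.\<close>
  have "expo m v \<le> W * (expo m v div w v) + (w v - 1)" if v: "v \<in> Y" for v
  proof -
    have "expo m v = w v * (expo m v div w v) + expo m v mod w v" by simp
    also have "\<dots> \<le> W * (expo m v div w v) + (w v - 1)"
    proof (rule add_mono)
      have "expo m v mod w v < w v" using w[OF v] by (intro mod_less_divisor) simp
      then show "expo m v mod w v \<le> w v - 1" by simp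
    qed (intro mult_right_mono W v, simp)
    finally show ?thesis .
  qed
  then have "deg_on Y m \<le> (\<Sum>v\<in>Y. W * (expo m v div w v) + (w v - 1))"
    unfolding deg_on_def by (rule sum_mono)
  also have "\<dots> = W * weight_deg m + (\<Sum>v\<in>Y. w v - 1)"
    by (simp only: sum.distrib sum_distrib_left weight_deg_def)
  also have "W * weight_deg m \<le> W * (t - 1)" using m t unfolding UY_def by (intro mult_left_mono) auto
  finally show ?thesis by (simp add: mult.commute)
qed

text \<open>The bound is the sum of the largest degrees outside \<open>UX t\<close> on
  \<open>X\<close> and outside \<open>UY t\<close> on \<open>Y\<close>, plus 1. Contracting along
  \<open>X\<close> reproduces the part of the cycle outside \<open>UY t\<close>, contracting along
  \<open>Y\<close> the part outside \<open>UX t\<close>. In the degree of the cycle no monomial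
  avoids both sets, so the two fillings add up to one of the whole cycle.\<close>

lemma koszul_exact_upper:
  assumes t: "1 \<le> t" and W: "\<And>y. y \<in> Y \<Longrightarrow> w y \<le> W" and p: "1 \<le> p"
    and j: "int ((t - 1) * W + (\<Sum>v\<in>Y. w v - 1) + t) < j - int p"
  shows "koszul_exact [0] {f. f 0 \<in> (mono_ideal (UX t \<inter> UY t) :: ('v, 'k::field) polys set)} p j"
proof (rule vanI)
  let ?\<rho> = "(t - 1) * W + (\<Sum>v\<in>Y. w v - 1)"
  fix C :: "nat \<Rightarrow> 'v set \<Rightarrow> ('v, 'k) polys"
  assume hom': "\<And>i \<sigma>. i < length [0 :: int] \<Longrightarrow> card \<sigma> = p \<Longrightarrow> homogeneous (j - [0] ! i - int p) (C i \<sigma>)"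
    and cyc': "\<And>\<sigma>. card \<sigma> + 1 = p \<Longrightarrow> (\<lambda>i. koszul (C i) \<sigma>) \<in> {f. f 0 \<in> mono_ideal (UX t \<inter> UY t)}"
  have hom: "homogeneous (j - int p) (C 0 \<sigma>)" if "card \<sigma> = p" for \<sigma>
    using hom'[of 0, OF _ that] by simp
  have cyc: "koszul (C 0) \<sigma> \<in> mono_ideal (UX t \<inter> UY t)" if "card \<sigma> + 1 = p" for \<sigma>
    using cyc'[OF that] by simp
  have bX: "deg_on X m \<le> t - 1" if "m \<notin> UX t" for m using that unfolding UX_def by simp
  have bY: "deg_on Y m \<le> ?\<rho>" if "m \<notin> UY t" for m using deg_Y_le[OF t W that] .
  obtain b1 where b1: "\<And>\<sigma> m. card \<sigma> = p \<Longrightarrow> m \<notin> UY t \<inter> UX t \<Longrightarrow>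
      coef (koszul b1 \<sigma>) m = (if m \<in> UY t then 0 else coef (C 0 \<sigma>) m)"
  proof (rule contract_restricted_chain[OF X upset_UY[of t] _ _ bX p hom])
    show "n \<in> UY t" if "\<And>v. v \<notin> X \<Longrightarrow> expo m v = expo n v" "m \<in> UY t" for m n
      by (rule UY_dep[OF _ that(2)]) (use that(1) disj in blast)
    show "deg_on (- X) m \<le> ?\<rho>" if "m \<notin> UY t" for m using bY[OF that] unfolding compl_X .
    show "int ?\<rho> + int (t - 1) + 1 < j - int p" using j t by (simp add: of_nat_diff)
    show "koszul (C 0) \<sigma> \<in> mono_ideal (UY t \<inter> UX t)" if "card \<sigma> + 1 = p" for \<sigma>
      using cyc[OF that] by (simp add: Int_commute)
  qed auto
  obtain b2 where b2: "\<And>\<sigma> m. card \<sigma> = p \<Longrightarrow> m \<notin> UX t \<inter> UY t \<Longrightarrow>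
      coef (koszul b2 \<sigma>) m = (if m \<in> UX t then 0 else coef (C 0 \<sigma>) m)"
  proof (rule contract_restricted_chain[OF Y upset_UX[of t] _ _ bY p hom])
    show "n \<in> UX t" if "\<And>v. v \<notin> Y \<Longrightarrow> expo m v = expo n v" "m \<in> UX t" for m n
      by (rule UX_dep[OF _ that(2)]) (use that(1) disj in blast)
    show "deg_on (- Y) m \<le> t - 1" if "m \<notin> UX t" for m using bX[OF that] unfolding compl_Y .
    show "int (t - 1) + int ?\<rho> + 1 < j - int p" using j t by (simp add: of_nat_diff)
  qed (use cyc in auto)
  show "\<exists>b. \<forall>\<sigma>. card \<sigma> = p \<longrightarrow> (\<lambda>i. C i \<sigma> - koszul (b i) \<sigma>) \<in> {f. f 0 \<in> mono_ideal (UX t \<inter> UY t)}"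
  proof (intro exI[of _ "\<lambda>_ \<tau>. b1 \<tau> + b2 \<tau>"] allI impI CollectI)
    fix \<sigma> :: "'v set" assume \<sigma>: "card \<sigma> = p"
    have "koszul (\<lambda>\<tau>. b1 \<tau> + b2 \<tau>) \<sigma> = koszul b1 \<sigma> + koszul b2 \<sigma>"
      by (simp add: koszul_def distrib_left sum.distrib)
    moreover have "coef (C 0 \<sigma>) m = coef (koszul b1 \<sigma>) m + coef (koszul b2 \<sigma>) m" if m: "m \<notin> UX t \<inter> UY t" for m
    proof (cases "m \<in> UX t \<or> m \<in> UY t")
      case True
      have "m \<notin> UY t \<inter> UX t" using m by blast
      then show ?thesis using True m b1[OF \<sigma>, of m] b2[OF \<sigma>, of m] by auto
    next
      case False
      have "mon_degree m \<le> (t - 1) + ?\<rho>"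
        unfolding mon_degree_split[of m X] compl_X using bX[of m] bY[of m] False by auto
      then have "int (mon_degree m) \<noteq> j - int p" using j by linarith
      then have "coef (C 0 \<sigma>) m = 0" using hom[OF \<sigma>] unfolding homogeneous_iff by blast
      then show ?thesis using False b1[OF \<sigma>, of m] b2[OF \<sigma>, of m] by simp
    qed
    ultimately show "C 0 \<sigma> - koszul (\<lambda>\<tau>. b1 \<tau> + b2 \<tau>) \<sigma> \<in> mono_ideal (UX t \<inter> UY t)"
      unfolding mem_mono_ideal_iff by (simp add: lookup_minus lookup_add)
  qed
qed

text \<open>With m the socle monomial, the chain x m e_Y is the image of the socle class m e_(Y + x)
  under the connecting map. It is a cycle because x m lies in \<open>A\<close> and y' m in
  \<open>B\<close> for every y' in \<open>Y\<close>. A filling would have to contain m at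
  \<open>insert x Y\<close>; its boundary then also contains y m at the set without
  \<open>y\<close>, a term outside \<open>A\<close> that nothing cancels.\<close>

lemma koszul_exact_lower:
  assumes t: "1 \<le> t" and y: "y \<in> Y"
  shows "\<not> koszul_exact [0] {f. f 0 \<in> (mono_ideal (UX t \<inter> UY t) :: ('v, 'k::field) polys set)} (card Y)
      (int ((t - 1) * w y + (\<Sum>v\<in>Y. w v - 1) + t) + int (card Y))"
proof
  obtain x where x: "x \<in> X" using X by blast
  have xY: "x \<notin> Y" using x disj by blast
  let ?m = "socle_monom x y t" and ?p = "card Y"
  let ?n = "?m + uvec x"
  let ?j = "int ((t - 1) * w y + (\<Sum>v\<in>Y. w v - 1) + t) + int ?p"
  have p: "1 \<le> ?p" using Y by (simp add: Suc_le_eq card_gt_0_iff)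
  assume koszul_exact: "koszul_exact [0] {f. f 0 \<in> (mono_ideal (UX t \<inter> UY t) :: ('v, 'k) polys set)} ?p ?j"
  define C where "C = (\<lambda>(i :: nat) \<sigma>. if \<sigma> = Y then (mono_of ?n :: ('v, 'k) polys) else 0)"
  have degX: "deg_on X ?n = t"
    using deg_X_socle[OF x, of y t] t x by (simp only: deg_on_add deg_on_uvec[OF finite] if_True)
  have "deg_on Y (uvec x) = 0" using xY unfolding deg_on_uvec[OF finite] by simp
  then have degY: "deg_on Y ?n = (t - 1) * w y + (\<Sum>v\<in>Y. w v - 1)"
    unfolding deg_on_add deg_Y_socle[OF y] by simp
  have "weight_deg ?n = weight_deg ?m"
    unfolding weight_deg_def using xY by (intro sum.cong) (auto simp: lookup_add lookup_single when_def)
  then have nUY: "?n \<notin> UY t" using weight_deg_socle[OF y, of x t] t by (simp add: UY_def)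
  have hom: "homogeneous (?j - [0] ! i - int ?p) (C i \<sigma>)" if "i < length [0 :: int]" "card \<sigma> = ?p" for i \<sigma>
  proof -
    have "int (mon_degree ?n) = ?j - int ?p"
      unfolding mon_degree_split[of ?n X] compl_X degX degY by simp
    then show ?thesis using that unfolding C_def homogeneous_def by simp
  qed
  have cyc: "(\<lambda>i. koszul (C i) \<sigma>) \<in> {f. f 0 \<in> mono_ideal (UX t \<inter> UY t)}" if \<sigma>: "card \<sigma> + 1 = ?p" for \<sigma>
  proof -
    have H: "Var u * C 0 (insert u \<sigma>) \<in> mono_ideal (UX t \<inter> UY t)" for u
    proof (cases "insert u \<sigma> = Y")
      case True
      then have u: "u \<in> Y" by blast
      have "t \<le> weight_deg (?m + uvec u)" by (rule weight_deg_socle_Suc[OF y u t])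
      also have "\<dots> \<le> weight_deg ((?m + uvec u) + uvec x)" using weight_deg_add by (rule order_trans[OF le_add1])
      also have "(?m + uvec u) + uvec x = uvec u + ?n" by (simp only: add_ac)
      finally have "uvec u + ?n \<in> UY t" by (simp add: UY_def)
      moreover have "uvec u + ?n \<in> UX t" unfolding UX_def mem_Collect_eq deg_on_add[of X "uvec u"] degX by simp
      ultimately have "mono_of (uvec u + ?n) \<in> (mono_ideal (UX t \<inter> UY t) :: ('v, 'k) polys set)"
        by (intro single_in_mono_ideal) blast
      moreover have "Var u * C 0 (insert u \<sigma>) = mono_of (uvec u + ?n)"
        unfolding C_def Var_def using True by (simp add: mult_single)
      ultimately show ?thesis by simp
    next
      case False
      then show ?thesis using ideal.subspace_0[OF is_ideal_mono_ideal[OF upset_UXY]] by (simp add: C_def)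
    qed
    have "koszul (C 0) \<sigma> \<in> mono_ideal (UX t \<inter> UY t)"
      unfolding koszul_def
      by (rule ideal.subspace_sum[OF is_ideal_mono_ideal[OF upset_UXY]],
          rule ideal.subspace_scale[OF is_ideal_mono_ideal[OF upset_UXY] H])
    then show ?thesis by simp
  qed
  obtain b where b': "\<forall>\<sigma>. card \<sigma> = ?p \<longrightarrow> (\<lambda>i. C i \<sigma> - koszul (b i) \<sigma>) \<in> {f. f 0 \<in> mono_ideal (UX t \<inter> UY t)}"
    using vanD[OF koszul_exact hom cyc] by blast
  have b: "coef (C 0 \<sigma>) m = coef (koszul (b 0) \<sigma>) m" if "card \<sigma> = ?p" "m \<notin> UX t \<inter> UY t" for \<sigma> m
    using b' that unfolding mem_Collect_eq mem_mono_ideal_iff lookup_minus by auto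
  \<comment> \<open>The only variable of \<open>?n\<close> outside \<open>Y\<close> is
    \<open>x\<close>. So at \<open>Y\<close> the coefficient of \<open>?n\<close>, which lies
    outside \<open>UY t\<close>, sees no other coefficient of the filling and must be 1 up to
    sign.\<close>
  define \<beta> where "\<beta> = coef (b 0 (insert x Y)) ?m"
  have "1 = coef (C 0 Y) ?n" by (simp add: C_def)
  also have "\<dots> = coef (koszul (b 0) Y) ?n" using nUY by (intro b) auto
  also have "\<dots> = (\<Sum>u\<in>- Y. if u = x then ksign x Y * \<beta> else 0)"
    unfolding coef_koszul
  proof (intro sum.cong refl)
    fix u assume u: "u \<in> - Y"
    have "expo ?n u = (if u = x then t else 0)" using u t by (auto simp: lookup_add expo_socle lookup_single)
    then show "ksign u Y * (if 0 < expo ?n u then coef (b 0 (insert u Y)) (?n - uvec u) else 0)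
        = (if u = x then ksign x Y * \<beta> else 0)"
      using t by (auto simp: \<beta>_def)
  qed
  also have "\<dots> = ksign x Y * \<beta>" using xY by simp
  finally have \<beta>: "\<beta> \<noteq> 0" by auto
  \<comment> \<open>At this set the cycle vanishes, and the coefficient of
    \<open>?m + uvec y\<close>, which lies outside \<open>UX t\<close>, again sees only
    \<open>\<beta>\<close>; this forces it to be 0.\<close>
  define \<tau> where "\<tau> = insert x (Y - {y})"
  have c\<tau>: "card \<tau> = ?p" unfolding \<tau>_def using xY y card_Suc_Diff1[OF finite y] by simp
  have ins: "insert y \<tau> = insert x Y" unfolding \<tau>_def using y by auto
  have "x \<in> \<tau>" "\<tau> \<noteq> Y" using xY unfolding \<tau>_def by auto
  have "y \<notin> \<tau>" using xY y unfolding \<tau>_def by auto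
  have "deg_on X (?m + uvec y) = t - 1"
    using y disj unfolding deg_on_add deg_X_socle[OF x] deg_on_uvec[OF finite] by auto
  then have mX: "?m + uvec y \<notin> UX t" using t by (simp add: UX_def)
  have "0 = coef (C 0 \<tau>) (?m + uvec y)" using \<open>\<tau> \<noteq> Y\<close> by (simp add: C_def)
  also have "\<dots> = coef (koszul (b 0) \<tau>) (?m + uvec y)" using mX by (intro b c\<tau>) auto
  also have "\<dots> = (\<Sum>u\<in>- \<tau>. if u = y then ksign y \<tau> * \<beta> else 0)"
    unfolding coef_koszul
  proof (intro sum.cong refl)
    fix u assume u: "u \<in> - \<tau>"
    show "ksign u \<tau> * (if 0 < expo (?m + uvec y) u then coef (b 0 (insert u \<tau>)) (?m + uvec y - uvec u) else 0)
        = (if u = y then ksign y \<tau> * \<beta> else 0)"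
    proof (cases "u = y")
      case True
      then show ?thesis using ins by (simp add: \<beta>_def lookup_add)
    next
      case False
      then have "u \<notin> Y" "u \<noteq> x" using u unfolding \<tau>_def by auto
      then have "expo (?m + uvec y) u = 0" using False by (simp add: lookup_add expo_socle lookup_single)
      then show ?thesis using False by simp
    qed
  qed
  also have "\<dots> = ksign y \<tau> * \<beta>" using \<open>y \<notin> \<tau>\<close> by simp
  finally have "ksign y \<tau> * \<beta> = 0" ..
  then have "\<beta> = ksign y \<tau> * 0" using ksign_sq'[of y \<tau> \<beta>] by metis
  then show False using \<beta> by simp
qed

lemma reg_quot_join:
  assumes t: "1 \<le> t" and y: "y \<in> Y" and W: "\<And>v. v \<in> Y \<Longrightarrow> w v \<le> w y"
  shows "reg_quot (mono_ideal (UX t \<inter> UY t) :: ('v, 'k::field) polys set)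
    = int ((t - 1) * w y + (\<Sum>v\<in>Y. w v - 1) + t)"
proof (rule reg_quot_eqI[OF is_ideal_mono_ideal[OF upset_UXY]])
  show "hcomp d p \<in> mono_ideal (UX t \<inter> UY t)" if "p \<in> mono_ideal (UX t \<inter> UY t)" for p :: "('v, 'k) polys" and d
    using that by (simp add: mem_mono_ideal_iff coef_hcomp)
  show "coef p 0 = 0" if "p \<in> mono_ideal (UX t \<inter> UY t)" for p :: "('v, 'k) polys"
    using that t by (simp add: mem_mono_ideal_iff UX_def deg_on_def)
  show "1 \<le> card Y" using Y by (simp add: Suc_le_eq card_gt_0_iff)
  show "0 \<le> int ((t - 1) * w y + (\<Sum>v\<in>Y. w v - 1) + t)" by (rule of_nat_0_le_iff)
qed (rule koszul_exact_upper[OF t W] koszul_exact_lower[OF t y]; assumption)+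

end

theorem theorem1p3:
  fixes D1 D2 D :: "'v::finite wograph"
    and I :: "('v, 'k::field) polys set"
    and w t :: nat
  assumes "weighted_oriented_graph D1" and "weighted_oriented_graph D2"
    and "verts D1 \<noteq> {}" and "verts D2 \<noteq> {}"
    and "verts D1 \<inter> verts D2 = {}"
    and "verts D1 \<union> verts D2 = UNIV"
    and "edges D1 = {}" and "edges D2 = {}"
    and "D = graph_join D1 D2"
    and "\<forall>x. source D x \<longrightarrow> weight D x = 1"
    and "I = edge_ideal D"
    and "w = Max (weight D ` verts D)"
    and "t \<ge> 1"
  shows "(depth_quot (ideal_power I t) = 1 \<and> depth_quot (symbolic_power I t) = 1) \<and>
    (let r = (\<Sum>x\<in>verts D. int (weight D x)) - int (card (verts D)) + 1
               + (int t - 1) * (int w + 1)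
     in reg_quot (ideal_power I t) = r \<and> reg_quot (symbolic_power I t) = r)"
proof -
  let ?X = "verts D1" and ?Y = "verts D2" and ?w = "weight D"
  have V: "verts D = ?X \<union> ?Y" and E: "edges D = ?X \<times> ?Y"
    using assms(7-9) by (simp_all add: graph_join_def)
  have w2: "?w y = weight D2 y" if "y \<in> ?Y" for y
    using that assms(5,9) by (auto simp: graph_join_def)
  \<comment> \<open>All edges run from \<open>?X\<close> to \<open>?Y\<close>, so the vertices of
    \<open>?X\<close> are sources and the convention on weights applies.\<close>
  have w1: "?w x = 1" if "x \<in> ?X" for x
    using that assms(5,10) unfolding source_def V E by blast
  interpret join_weights ?X ?Y ?w
    using assms(2-6) w2 by unfold_locales (auto simp: weighted_oriented_graph_def)
  have I: "I = mono_ideal (UX 1 \<inter> UY 1)"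
    using edge_span[where 'k = 'k] unfolding assms(11) edge_ideal_def E by simp
  have power: "ideal_power I t = mono_ideal (UX t \<inter> UY t)" and symb: "symbolic_power I t = mono_ideal (UX t \<inter> UY t)"
    unfolding I by (rule ideal_power_eq, rule symbolic_power_eq)
  have fin: "finite (?w ` verts D)" "?w ` verts D \<noteq> {}" using assms(3) V by auto
  have wle: "?w v \<le> w" for v
    unfolding assms(12) by (rule Max_ge[OF fin(1)]) (use V assms(6) in auto)
  \<comment> \<open>The maximum is taken over both vertex sets but must be attained in
    \<open>?Y\<close>. If it is attained in \<open>?X\<close>, it equals 1, and then every weight in
    \<open>?Y\<close> is 1 as well.\<close>
  obtain y where y: "y \<in> ?Y" "?w y = w"
  proof -
    obtain v where v: "v \<in> verts D" "?w v = w" using Max_in[OF fin] unfolding assms(12) by auto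
    show ?thesis
    proof (cases "v \<in> ?Y")
      case True
      then show ?thesis using that v by blast
    next
      case False
      then have "w = 1" using v w1 V by auto
      moreover obtain u where u: "u \<in> ?Y" using assms(4) by blast
      ultimately have "?w u = w" using wle[of u] w2[OF u] assms(2) u by (fastforce simp: weighted_oriented_graph_def)
      then show ?thesis using that u by blast
    qed
  qed
  \<comment> \<open>The vertices of \<open>?X\<close> contribute \<open>w - 1 = 0\<close>, and (t -
    1)w + t = (t - 1)(w + 1) + 1.\<close>
  have r: "int ((t - 1) * ?w y + (\<Sum>v\<in>?Y. ?w v - 1) + t)
      = (\<Sum>x\<in>verts D. int (?w x)) - int (card (verts D)) + 1 + (int t - 1) * (int w + 1)"
  proof -
    have "(\<Sum>x\<in>verts D. int (?w x)) - int (card (verts D)) = (\<Sum>x\<in>verts D. int (?w x) - 1)"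
      by (simp add: sum_subtractf)
    also have "\<dots> = (\<Sum>x\<in>?X. int (?w x) - 1) + (\<Sum>x\<in>?Y. int (?w x) - 1)"
      unfolding V by (rule sum.union_disjoint) (use assms(5) in auto)
    also have "(\<Sum>x\<in>?X. int (?w x) - 1) = 0" using w1 by simp
    also have "(\<Sum>x\<in>?Y. int (?w x) - 1) = int (\<Sum>v\<in>?Y. ?w v - 1)"
      unfolding of_nat_sum
    proof (intro sum.cong refl)
      fix v assume "v \<in> ?Y"
      then show "int (?w v) - 1 = int (?w v - 1)" using w[of v] by (simp add: of_nat_diff)
    qed
    finally have "(\<Sum>x\<in>verts D. int (?w x)) - int (card (verts D)) = int (\<Sum>v\<in>?Y. ?w v - 1)" by simp
    moreover obtain s where "t = Suc s" using assms(13) by (cases t) auto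
    ultimately show ?thesis unfolding y(2) by (simp add: algebra_simps)
  qed
  have "reg_quot (mono_ideal (UX t \<inter> UY t) :: ('v, 'k) polys set)
      = (\<Sum>x\<in>verts D. int (?w x)) - int (card (verts D)) + 1 + (int t - 1) * (int w + 1)"
    unfolding r[symmetric] by (rule reg_quot_join[OF assms(13) y(1)]) (use wle y in simp)
  then show ?thesis
    unfolding power symb Let_def using depth_quot_join[OF assms(13), where 'k = 'k] by blast
qed

end
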